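(* Let $(A_N)$ be a sequence of deterministic Hermitian matrices with limiting spectral measure $\nu$ and spikes $\theta_1>\dots>\theta_J$, as described in the context. Let $\Theta_{\sigma,\nu}=\{\theta_1,\dots,\theta_J\}\cap(\mathbb{R}\setminus\overline{U_{\sigma,\nu}})$, let $\rho_{\theta_j}=H_{\sigma,\nu}(\theta_j)=\theta_j+\sigma^2g_\nu(\theta_j)$ for $\theta_j\in\Theta_{\sigma,\nu}$, and $$K_{\sigma,\nu}(\theta_1,\dots,\theta_J)=\mathrm{supp}(\mu_\sigma\boxplus\nu)\cup\{\rho_{\theta_j}:\ \theta_j\in\Theta_{\sigma,\nu}\}.$$ Then for every $\epsilon>0$, for all $N$ large enough, $$\mathrm{supp}(\mu_\sigma\boxplus\mu_{A_N})\subset K_{\sigma,\nu}(\theta_1,\dots,\theta_J)+(-\epsilon,\epsilon).$$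
   Context: $\sigma>0$. $A_N$ is a deterministic $N\times N$ Hermitian matrix whose spectral measure $\mu_{A_N}=\frac1N\sum_{i=1}^N\delta_{\gamma_i}$ ($\gamma_i=\gamma_i^{(N)}$ the eigenvalues of $A_N$) converges weakly to a compactly supported probability measure $\nu$ on $\mathbb{R}$. There is a fixed integer $r\ge0$ such that $A_N$ has $N-r$ eigenvalues $\beta_j(N)$ with $\max_{1\le j\le N-r}\mathrm{dist}(\beta_j(N),\mathrm{supp}(\nu))\to0$; the other $r$ eigenvalues are given by fixed real numbers $\theta_1>\dots>\theta_J$ (the spikes), independent of $N$, outside $\mathrm{supp}(\nu)$, each $\theta_j$ being an eigenvalue of $A_N$ with fixed multiplicity $k_j$, $\sum_{j=1}^Jk_j=r$. $\mu_\sigma$ is the semicircle distribution with density $\frac{1}{2\pi\sigma^2}\sqrt{4\sigma^2-x^2}\,\mathbf 1_{[-2\sigma,2\sigma]}(x)$; $\boxplus$ is free additive convolution. For a probability measure $\tau$ on $\mathbb{R}$, $g_\tau(z)=\int\frac{d\tau(x)}{z-x}$ for $z\notin\mathrm{supp}(\tau)$. $U_{\sigma,\nu}=\{u\in\mathbb{R}:\int\frac{d\nu(x)}{(u-x)^2}>\frac1{\sigma^2}\}$ and $H_{\sigma,\nu}(z)=z+\sigma^2g_\nu(z)$. For $S\subset\mathbb{R}$, $S+(-\epsilon,\epsilon)=\{x\in\mathbb{R}:\mathrm{dist}(x,S)<\epsilon\}$. *)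

theory Defs
  imports "HOL-Probability.Probability" "Jordan_Normal_Form.Schur_Decomposition"
begin

definition measure_support :: "real measure \<Rightarrow> real set" where
  "measure_support \<mu> = {x. \<forall>U. open U \<longrightarrow> x \<in> U \<longrightarrow> emeasure \<mu> U > 0}"

text \<open>The transform \<open>g\<^sub>\<tau>\<close>; polymorphic so that it can be evaluated both at complex points and,
  with real values, at real points outside the support.\<close>

definition cauchy_transform ::
    "real measure \<Rightarrow> 'a \<Rightarrow> 'a::{real_normed_field, banach, second_countable_topology}" where
  "cauchy_transform \<tau> z = (LINT x|\<tau>. 1 / (z - of_real x))"

definition semicircle :: "real \<Rightarrow> real measure" where
  "semicircle \<sigma> = density lborel
     (\<lambda>x. ennreal (indicator {-2*\<sigma>..2*\<sigma>} x * (1 / (2*pi*\<sigma>\<^sup>2) * sqrt (4*\<sigma>\<^sup>2 - x\<^sup>2))))"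

definition hermitian_mat :: "complex mat \<Rightarrow> bool" where
  "hermitian_mat A \<longleftrightarrow> mat_adjoint A = A"

text \<open>Eigenvalues with multiplicity.\<close>

definition eigenvalue_mset :: "complex mat \<Rightarrow> complex multiset" where
  "eigenvalue_mset A = proots (char_poly A)"

text \<open>The law of a uniformly chosen eigenvalue, counted with multiplicity. Only meant for Hermitian
  \<open>A\<close> of positive size; then \<open>Re\<close> is the identity on the eigenvalues.\<close>

definition spectral_measure :: "complex mat \<Rightarrow> real measure" where
  "spectral_measure A = distr (measure_pmf (pmf_of_multiset (eigenvalue_mset A))) borel Re"

text \<open>Free additive convolution through the R-transform. On a truncated angle
  \<open>D = {u + iv. |u| < \<alpha>v, v > \<beta>}\<close> where \<open>g\<^sub>\<tau>\<close> is univalent, let \<open>K\<^sub>\<tau>\<close> be the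
  inverse of \<open>g\<^sub>\<tau>\<close> on \<open>g\<^sub>\<tau>(D)\<close> and \<open>R\<^sub>\<tau>(w) = K\<^sub>\<tau>(w) - 1/w\<close>. Then
  \<open>\<mu> \<boxplus> \<tau>\<close> is the unique probability measure \<open>\<lambda>\<close> with
  \<open>R\<^sub>\<lambda> = R\<^sub>\<mu> + R\<^sub>\<tau>\<close> on a common domain of definition. That domain is required to contain the
  reciprocals of a truncated angle (as is always possible): it is then nonempty, and the domains
  belonging to different choices of the parameters overlap near \<open>0\<close>.\<close>

definition truncated_angle :: "real \<Rightarrow> real \<Rightarrow> complex set" where
  "truncated_angle \<alpha> \<beta> = {z. \<bar>Re z\<bar> < \<alpha> * Im z \<and> Im z > \<beta>}"

definition R_transform :: "complex set \<Rightarrow> real measure \<Rightarrow> complex \<Rightarrow> complex" where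
  "R_transform D \<tau> w = the_inv_into D (cauchy_transform \<tau>) w - 1 / w"

definition is_free_convolution :: "real measure \<Rightarrow> real measure \<Rightarrow> real measure \<Rightarrow> bool" where
  "is_free_convolution \<mu> \<tau> \<kappa> \<longleftrightarrow> real_distribution \<kappa> \<and>
     (\<exists>\<alpha>>0. \<exists>\<beta>>0. \<exists>\<alpha>'>0. \<exists>\<beta>'>0.
       let D = truncated_angle \<alpha> \<beta>; \<Gamma> = {w. 1 / w \<in> truncated_angle \<alpha>' \<beta>'} in
         (\<forall>\<rho>\<in>{\<mu>, \<tau>, \<kappa>}. inj_on (cauchy_transform \<rho>) D \<and> \<Gamma> \<subseteq> cauchy_transform \<rho> ` D) \<and>
         (\<forall>w\<in>\<Gamma>. R_transform D \<kappa> w = R_transform D \<mu> w + R_transform D \<tau> w))"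

definition free_convolution :: "real measure \<Rightarrow> real measure \<Rightarrow> real measure" (infixl "\<boxplus>" 65) where
  "\<mu> \<boxplus> \<tau> = (THE \<kappa>. is_free_convolution \<mu> \<tau> \<kappa>)"

text \<open>The integral is taken in \<open>[0, \<infinity>]\<close>, and the integrand is \<open>\<infinity>\<close> at \<open>x = u\<close>
  (\<open>inverse 0 = \<infinity>\<close> in \<^typ>\<open>ennreal\<close>, unlike in \<^typ>\<open>real\<close>).\<close>

definition U_set :: "real \<Rightarrow> real measure \<Rightarrow> real set" where
  "U_set \<sigma> \<nu> = {u. (\<integral>\<^sup>+x. inverse (ennreal ((u - x)\<^sup>2)) \<partial>\<nu>) > ennreal (1 / \<sigma>\<^sup>2)}"

definition H_map ::
    "real \<Rightarrow> real measure \<Rightarrow> 'a \<Rightarrow> 'a::{real_normed_field, banach, second_countable_topology}" where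
  "H_map \<sigma> \<nu> z = z + of_real (\<sigma>\<^sup>2) * cauchy_transform \<nu> z"

definition Theta_set :: "real \<Rightarrow> real measure \<Rightarrow> real set \<Rightarrow> real set" where
  "Theta_set \<sigma> \<nu> S = S \<inter> (UNIV - closure (U_set \<sigma> \<nu>))"

definition K_set :: "real \<Rightarrow> real measure \<Rightarrow> real set \<Rightarrow> real set" where
  "K_set \<sigma> \<nu> S = measure_support (semicircle \<sigma> \<boxplus> \<nu>) \<union> H_map \<sigma> \<nu> ` Theta_set \<sigma> \<nu> S"

definition neighbourhood :: "real set \<Rightarrow> real \<Rightarrow> real set" where
  "neighbourhood S \<epsilon> = {x. infdist x S < \<epsilon>}"

end

theory Submission
  imports Defs "HOL-Complex_Analysis.Complex_Analysis"
begin

text \<open>For compactly supported \<open>\<tau>\<close>, the measure \<open>\<kappa> = \<mu>\<^sub>\<sigma> \<boxplus> \<tau>\<close> is characterised by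
  \<open>g\<^sub>\<kappa>(z) = g\<^sub>\<tau>(\<omega>(z))\<close> with \<open>\<omega>(z) = z - \<sigma>\<^sup>2 g\<^sub>\<kappa>(z)\<close>, so that \<open>\<omega>\<close> is a right inverse of
  \<open>H\<^sub>\<tau>\<close> on the upper half-plane. Since \<open>Im H\<^sub>\<tau>(w) = Im w (1 - \<sigma>\<^sup>2 \<integral> d\<tau>(t) / \<bar>w - t\<bar>\<^sup>2)\<close>,
  the map \<open>H\<^sub>\<tau>\<close> is injective on the set where its imaginary part is positive.

  A point \<open>x\<close> outside the support of \<open>\<mu>\<^sub>\<sigma> \<boxplus> \<nu>\<close> is therefore \<open>H\<^sub>\<nu>(u)\<close> for a real \<open>u\<close> near which
  \<open>\<nu>\<close> has no mass and \<open>\<sigma>\<^sup>2 \<integral> d\<nu>(t) / (u - t)\<^sup>2 \<le> q < 1\<close>; so \<open>u\<close> is not in the closure of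
  \<open>U\<close>, and \<open>x \<notin> K\<close> excludes that \<open>u\<close> is a spike. Then all eigenvalues of \<open>A\<^sub>N\<close> eventually stay away
  from \<open>u\<close>, weak convergence transfers the integral bound to the spectral measure \<open>\<mu>\<^sub>N\<close> of \<open>A\<^sub>N\<close>, and a fixed point argument
  inverts \<open>H\<close> for \<open>\<mu>\<^sub>N\<close> near \<open>u\<close>. This bounds \<open>Im g / Im z\<close> for \<open>\<mu>\<^sub>\<sigma> \<boxplus> \<mu>\<^sub>N\<close> near \<open>x\<close>, which therefore has no
  mass there. Compactness makes the argument uniform in \<open>x\<close>.

  The existence of the free convolution is obtained for finitely supported measures from the
  iteration \<open>g \<mapsto> g\<^sub>\<tau>(z - \<sigma>\<^sup>2 g)\<close>, which preserves the Cauchy transforms of finitely supported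
  probability measures, and for \<open>\<nu>\<close> by a weak limit.\<close>

section \<open>The Cauchy transform off the support\<close>

text \<open>\<open>free_convolution\<close> is a definite description, so nothing can be said about
  it before existence and uniqueness are both known, and uniqueness has to hold against competitors
  that come with an arbitrary truncated angle and no bound on their support. Subordination serves as
  the working notion because it contains no inverse functions and survives weak limits.

  Weak convergence alone cannot control the integral of 1 / (u - t)^2 against the spectral measures:
  a vanishing fraction of the eigenvalues close to u could make it explode. Hence every single
  eigenvalue has to be kept away from u, by its distance to the support of \<nu> or as a spike
  different from u.

  The strict bound q < 1 at u is what makes the argument stable. Its margin pays for three losses:
  the passage from \<nu> to the spectral measure, the passage from u to a disc around u, and the
  movement of H(u) with N.\<close>

definition gap :: "real measure \<Rightarrow> complex \<Rightarrow> real \<Rightarrow> bool" where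
  "gap \<rho> z d \<longleftrightarrow> 0 < d \<and> (AE t in \<rho>. d \<le> cmod (z - of_real t))"

text \<open>For non-real z this is -Im g(z) / Im z. It also makes sense on the real line off the
  support, where it is -g'(z) and the integral that defines \<open>U_set\<close>.\<close>

definition inv_square :: "real measure \<Rightarrow> complex \<Rightarrow> real" where
  "inv_square \<rho> z = (LINT t|\<rho>. 1 / (cmod (z - of_real t))\<^sup>2)"

text \<open>The negated divided difference of g. There is no complex conjugation, so its diagonal is
  -g'(z), whose modulus \<open>inv_square\<close> merely bounds.\<close>

definition inv_prod :: "real measure \<Rightarrow> complex \<Rightarrow> complex \<Rightarrow> complex" where
  "inv_prod \<rho> z w = (LINT t|\<rho>. 1 / ((z - of_real t) * (w - of_real t)))"

lemma gap_pos: "gap \<rho> z d \<Longrightarrow> 0 < d"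
  by (simp add: gap_def)

lemma gap_AE: "gap \<rho> z d \<Longrightarrow> AE t in \<rho>. d \<le> cmod (z - of_real t)"
  by (simp add: gap_def)

lemma gap_mono: "gap \<rho> z d \<Longrightarrow> 0 < e \<Longrightarrow> e \<le> d \<Longrightarrow> gap \<rho> z e"
  unfolding gap_def by (auto elim!: eventually_mono)

lemma gap_shift:
  assumes "gap \<rho> z d" "cmod (w - z) < d"
  shows "gap \<rho> w (d - cmod (w - z))"
  unfolding gap_def
proof
  show "0 < d - cmod (w - z)" using assms by simp
  show "AE t in \<rho>. d - cmod (w - z) \<le> cmod (w - of_real t)"
    using assms(1) unfolding gap_def
  proof (elim conjE eventually_mono)
    fix t assume "d \<le> cmod (z - of_real t)"
    moreover have "cmod (z - of_real t) \<le> cmod (w - of_real t) + cmod (w - z)"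
      using norm_triangle_ineq4[of "w - of_real t" "w - z"] by simp
    ultimately show "d - cmod (w - z) \<le> cmod (w - of_real t)" by simp
  qed
qed

text \<open>Gaps have three sources: height in the upper half-plane, distance from a disc containing
  a bounded support, and real points off the support. Stating the analysis for \<open>gap\<close>
  treats them all at once.\<close>

lemma gap_upper: "0 < Im z \<Longrightarrow> gap \<rho> z (Im z)"
  unfolding gap_def using abs_Im_le_cmod[of "z - of_real _"] by (auto intro!: AE_I2)

lemma gap_bounded:
  assumes "AE t in \<rho>. \<bar>t\<bar> \<le> B" "B < cmod z"
  shows "gap \<rho> z (cmod z - B)"
  unfolding gap_def
proof
  show "AE t in \<rho>. cmod z - B \<le> cmod (z - of_real t)"
    using assms(1)
  proof eventually_elim
    case (elim t)
    have "cmod z - cmod (of_real t) \<le> cmod (z - of_real t)" by (rule norm_triangle_ineq2)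
    then show ?case using elim by simp
  qed
qed (use assms in simp)

lemma gap_norm_prod_le:
  assumes "gap \<rho> z d" "gap \<rho> w e"
  shows "AE t in \<rho>. norm (1 / ((z - of_real t) * (w - of_real t))) \<le> 1 / (d * e)"
  using gap_AE[OF assms(1)] gap_AE[OF assms(2)]
proof eventually_elim
  case (elim t)
  have "1 / (cmod (z - of_real t) * cmod (w - of_real t)) \<le> 1 / (d * e)"
    using elim gap_pos[OF assms(1)] gap_pos[OF assms(2)]
    by (intro divide_left_mono mult_mono mult_pos_pos) auto
  then show ?case by (simp add: norm_divide norm_mult)
qed

context real_distribution
begin

lemma gap_integrable:
  assumes "gap M z d"
  shows "integrable M (\<lambda>t. 1 / (z - of_real t))"
proof (rule integrable_const_bound)
  show "AE t in M. norm (1 / (z - of_real t)) \<le> 1 / d"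
    using assms unfolding gap_def
    by (auto elim!: eventually_mono simp: norm_divide intro!: divide_left_mono mult_pos_pos)
qed simp

lemma gap_integrable_square:
  assumes "gap M z d"
  shows "integrable M (\<lambda>t. 1 / (cmod (z - of_real t))\<^sup>2)"
proof (rule integrable_const_bound)
  show "AE t in M. norm (1 / (cmod (z - of_real t))\<^sup>2) \<le> 1 / d\<^sup>2"
    using assms unfolding gap_def
    by (auto elim!: eventually_mono simp: norm_divide intro!: divide_left_mono mult_pos_pos power_mono)
qed simp

lemma gap_integrable_prod:
  assumes "gap M z d" "gap M w e"
  shows "integrable M (\<lambda>t. 1 / ((z - of_real t) * (w - of_real t)))"
proof (rule integrable_const_bound)
  show "AE t in M. norm (1 / ((z - of_real t) * (w - of_real t))) \<le> 1 / (d * e)"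
    by (rule gap_norm_prod_le[OF assms])
qed simp

text \<open>The resolvent identity under the integral. Lipschitz bounds, injectivity in z and the
  derivative all start from it.\<close>

lemma cauchy_transform_diff:
  assumes "gap M z d" "gap M w e"
  shows "cauchy_transform M z - cauchy_transform M w = - (z - w) * inv_prod M z w"
proof -
  have "cauchy_transform M z - cauchy_transform M w
      = (LINT t|M. 1 / (z - of_real t) - 1 / (w - of_real t))"
    unfolding cauchy_transform_def
    by (rule Bochner_Integration.integral_diff[symmetric]) (use assms gap_integrable in blast)+
  also have "\<dots> = (LINT t|M. - (z - w) * (1 / ((z - of_real t) * (w - of_real t))))"
  proof (rule integral_cong_AE)
    show "AE t in M. 1 / (z - of_real t) - 1 / (w - of_real t)
        = - (z - w) * (1 / ((z - of_real t) * (w - of_real t)))"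
      using gap_AE[OF assms(1)] gap_AE[OF assms(2)]
    proof eventually_elim
      case (elim t)
      then have "z - of_real t \<noteq> 0" "w - of_real t \<noteq> 0"
        using gap_pos[OF assms(1)] gap_pos[OF assms(2)] by auto
      then show ?case by (simp add: divide_simps)
    qed
  qed simp_all
  also have "\<dots> = - (z - w) * inv_prod M z w"
    unfolding inv_prod_def by (rule integral_mult_right_zero)
  finally show ?thesis .
qed

lemma inv_square_nonneg: "0 \<le> inv_square M z"
  unfolding inv_square_def by (rule integral_nonneg_AE) simp

text \<open>Pointwise AM-GM. It turns bounds at the two points alone into a bound on the difference
  quotient, with no path between them along which a derivative would have to be controlled.\<close>

lemma inv_prod_le:
  assumes "gap M z d" "gap M w e"
  shows "cmod (inv_prod M z w) \<le> (inv_square M z + inv_square M w) / 2"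
proof -
  have "cmod (inv_prod M z w) \<le> (LINT t|M. norm (1 / ((z - of_real t) * (w - of_real t))))"
    unfolding inv_prod_def by (rule integral_norm_bound)
  also have "\<dots> \<le> (LINT t|M. (1 / (cmod (z - of_real t))\<^sup>2 + 1 / (cmod (w - of_real t))\<^sup>2) / 2)"
  proof (rule integral_mono)
    show "integrable M (\<lambda>t. norm (1 / ((z - of_real t) * (w - of_real t))))"
      using gap_integrable_prod[OF assms] by (rule integrable_norm)
    show "integrable M (\<lambda>t. (1 / (cmod (z - of_real t))\<^sup>2 + 1 / (cmod (w - of_real t))\<^sup>2) / 2)"
      using gap_integrable_square[OF assms(1)] gap_integrable_square[OF assms(2)] by auto
    fix t
    have "2 * (1 / cmod (z - of_real t)) * (1 / cmod (w - of_real t))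
        \<le> (1 / cmod (z - of_real t))\<^sup>2 + (1 / cmod (w - of_real t))\<^sup>2"
      by (rule sum_squares_bound)
    then show "norm (1 / ((z - of_real t) * (w - of_real t)))
        \<le> (1 / (cmod (z - of_real t))\<^sup>2 + 1 / (cmod (w - of_real t))\<^sup>2) / 2"
      by (simp add: norm_divide norm_mult power_divide)
  qed
  also have "\<dots> = (inv_square M z + inv_square M w) / 2"
    unfolding inv_square_def
    using gap_integrable_square[OF assms(1)] gap_integrable_square[OF assms(2)] by simp
  finally show ?thesis .
qed

lemma inv_square_le:
  assumes "gap M z d"
  shows "inv_square M z \<le> 1 / d\<^sup>2"
proof -
  have "inv_square M z \<le> (LINT t|M. 1 / d\<^sup>2)"
    unfolding inv_square_def
  proof (rule integral_mono_AE)
    show "AE t in M. 1 / (cmod (z - of_real t))\<^sup>2 \<le> 1 / d\<^sup>2"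
      using assms unfolding gap_def
      by (auto elim!: eventually_mono intro!: divide_left_mono mult_pos_pos power_mono)
  qed (use gap_integrable_square[OF assms] in auto)
  then show ?thesis using prob_space by simp
qed

lemma inv_prod_le_gap:
  assumes "gap M z d" "gap M w e"
  shows "cmod (inv_prod M z w) \<le> 1 / (d * e)"
proof -
  have "cmod (inv_prod M z w) \<le> (LINT t|M. norm (1 / ((z - of_real t) * (w - of_real t))))"
    unfolding inv_prod_def by (rule integral_norm_bound)
  also have "\<dots> \<le> (LINT t|M. 1 / (d * e))"
  proof (rule integral_mono_AE)
    show "integrable M (\<lambda>t. norm (1 / ((z - of_real t) * (w - of_real t))))"
      using gap_integrable_prod[OF assms] by (rule integrable_norm)
    show "AE t in M. norm (1 / ((z - of_real t) * (w - of_real t))) \<le> 1 / (d * e)"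
      by (rule gap_norm_prod_le[OF assms])
  qed auto
  finally show ?thesis using prob_space by simp
qed

lemma cauchy_transform_le:
  assumes "gap M z d"
  shows "cmod (cauchy_transform M z) \<le> 1 / d"
proof -
  have "cmod (cauchy_transform M z) \<le> (LINT t|M. norm (1 / (z - of_real t)))"
    unfolding cauchy_transform_def by (rule integral_norm_bound)
  also have "\<dots> \<le> (LINT t|M. 1 / d)"
  proof (rule integral_mono_AE)
    show "integrable M (\<lambda>t. norm (1 / (z - of_real t)))"
      using gap_integrable[OF assms] by (rule integrable_norm)
    show "AE t in M. norm (1 / (z - of_real t)) \<le> 1 / d"
      using assms unfolding gap_def
      by (auto elim!: eventually_mono simp: norm_divide intro!: divide_left_mono mult_pos_pos)
  qed auto
  finally show ?thesis using prob_space by simp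
qed

lemma Im_cauchy_transform:
  assumes "gap M z d"
  shows "Im (cauchy_transform M z) = - Im z * inv_square M z"
proof -
  have "Im (cauchy_transform M z) = (LINT t|M. Im (1 / (z - of_real t)))"
    unfolding cauchy_transform_def by (rule integral_Im[OF gap_integrable[OF assms], symmetric])
  also have "\<dots> = (LINT t|M. - Im z * (1 / (cmod (z - of_real t))\<^sup>2))"
    by (rule Bochner_Integration.integral_cong) (simp_all add: Im_divide cmod_def)
  also have "\<dots> = - Im z * inv_square M z"
    unfolding inv_square_def by (rule integral_mult_right_zero)
  finally show ?thesis .
qed

lemma inv_square_pos:
  assumes "gap M z d"
  shows "0 < inv_square M z"
proof -
  have "inv_square M z \<noteq> 0"
  proof
    assume "inv_square M z = 0"
    then have "AE t in M. 1 / (cmod (z - of_real t))\<^sup>2 = 0"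
      unfolding inv_square_def
      by (subst (asm) integral_nonneg_eq_0_iff_AE) (use gap_integrable_square[OF assms] in auto)
    then have "AE t in M. False"
      using gap_AE[OF assms]
    proof eventually_elim
      case (elim t)
      then show ?case using gap_pos[OF assms] by auto
    qed
    then show False by simp
  qed
  then show ?thesis using inv_square_nonneg[of z] by simp
qed

lemma Im_cauchy_transform_neg: "0 < Im z \<Longrightarrow> Im (cauchy_transform M z) < 0"
  using Im_cauchy_transform[OF gap_upper] inv_square_pos[OF gap_upper] by simp

lemma cauchy_transform_nonzero: "0 < Im z \<Longrightarrow> cauchy_transform M z \<noteq> 0"
  using Im_cauchy_transform_neg[of z] by auto

lemma inv_prod_diff_le:
  assumes "gap M z d" "cmod (w - z) \<le> d / 2"
  shows "cmod (inv_prod M w z - inv_prod M z z) \<le> cmod (w - z) * (2 / d ^ 3)"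
proof -
  have d: "0 < d" using assms(1) by (simp add: gap_def)
  have gw: "gap M w (d / 2)"
    using gap_mono[OF gap_shift[OF assms(1), of w], of "d/2"] assms(2) d by simp
  have eq: "inv_prod M w z - inv_prod M z z
      = (LINT t|M. 1 / ((w - of_real t) * (z - of_real t)) - 1 / ((z - of_real t) * (z - of_real t)))"
    unfolding inv_prod_def
    by (rule Bochner_Integration.integral_diff[symmetric]) (use assms gw gap_integrable_prod in blast)+
  have "cmod (inv_prod M w z - inv_prod M z z)
      \<le> (LINT t|M. norm (1 / ((w - of_real t) * (z - of_real t)) - 1 / ((z - of_real t) * (z - of_real t))))"
    unfolding eq by (rule integral_norm_bound)
  also have "\<dots> \<le> (LINT t|M. cmod (w - z) * (2 / d ^ 3))"
  proof (rule integral_mono_AE)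
    show "integrable M (\<lambda>t. norm (1 / ((w - of_real t) * (z - of_real t)) - 1 / ((z - of_real t) * (z - of_real t))))"
      using gap_integrable_prod[OF gw assms(1)] gap_integrable_prod[OF assms(1) assms(1)]
      by (intro integrable_norm Bochner_Integration.integrable_diff)
    show "AE t in M. norm (1 / ((w - of_real t) * (z - of_real t)) - 1 / ((z - of_real t) * (z - of_real t)))
         \<le> cmod (w - z) * (2 / d ^ 3)"
      using gap_AE[OF assms(1)] gap_AE[OF gw]
    proof eventually_elim
      case (elim t)
      define a b where "a = z - of_real t" and "b = w - of_real t"
      have ab: "d \<le> cmod a" "d / 2 \<le> cmod b" "w - z = b - a" using elim by (auto simp: a_def b_def)
      then have nz: "a \<noteq> 0" "b \<noteq> 0" using d by auto
      have "1 / (b * a) - 1 / (a * a) = - (b - a) * (1 / (b * a * a))"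
        using nz by (simp add: divide_simps)
      then have "norm (1 / (b * a) - 1 / (a * a)) = cmod (w - z) * (1 / (cmod b * cmod a * cmod a))"
        by (simp add: norm_mult norm_divide ab(3) norm_minus_commute)
      \<comment> \<open>\<open>a\<close> is at least d and occurs twice, \<open>b\<close> is at
        least d / 2; this is the origin of 2 / d^3.\<close>
      moreover have "1 / (cmod b * cmod a * cmod a) \<le> 1 / (d / 2 * d * d)"
        using ab d nz by (intro divide_left_mono mult_mono mult_pos_pos) auto
      then have "cmod (w - z) * (1 / (cmod b * cmod a * cmod a)) \<le> cmod (w - z) * (1 / (d / 2 * d * d))"
        by (rule mult_left_mono) simp
      ultimately show ?case by (simp add: a_def b_def power3_eq_cube)
    qed
  qed auto
  finally show ?thesis using prob_space by simp
qed

text \<open>The difference quotient is \<open>- inv_prod M w z\<close>, so continuity of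
  \<open>inv_prod\<close> in its first argument replaces differentiation under the integral
  sign.\<close>

lemma cauchy_transform_has_field_derivative:
  assumes "gap M z d"
  shows "(cauchy_transform M has_field_derivative - inv_prod M z z) (at z)"
  unfolding has_field_derivative_iff
proof (rule LIM_zero_cancel, rule Lim_null_comparison)
  have d: "0 < d" using assms by (simp add: gap_def)
  have "\<forall>\<^sub>F w in at z. w \<noteq> z \<and> dist w z < d / 2"
    unfolding eventually_at using d by (auto intro!: exI[of _ "d/2"])
  then show "\<forall>\<^sub>F w in at z. norm ((cauchy_transform M w - cauchy_transform M z) / (w - z) - - inv_prod M z z)
      \<le> cmod (w - z) * (2 / d ^ 3)"
  proof eventually_elim
    case (elim w)
    have gw: "gap M w (d / 2)"
      using gap_mono[OF gap_shift[OF assms(1), of w], of "d/2"] elim d by (simp add: dist_norm)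
    have "(cauchy_transform M w - cauchy_transform M z) / (w - z) = - inv_prod M w z"
      using elim by (simp add: cauchy_transform_diff[OF gw assms] divide_simps) (simp add: algebra_simps)
    moreover have "cmod (- inv_prod M w z - - inv_prod M z z) = cmod (inv_prod M w z - inv_prod M z z)"
      by (simp add: norm_minus_commute)
    moreover have "cmod (w - z) \<le> d / 2" using elim by (simp add: dist_norm)
    ultimately show ?case
      using inv_prod_diff_le[OF assms, of w] by (simp only:)
  qed
  show "((\<lambda>w. cmod (w - z) * (2 / d ^ 3)) \<longlongrightarrow> 0) (at z)"
    by (rule tendsto_mult_left_zero) (auto intro!: tendsto_eq_intros)
qed

lemma cauchy_transform_holomorphic:
  assumes "\<And>z. z \<in> S \<Longrightarrow> \<exists>d. gap M z d"
  shows "cauchy_transform M holomorphic_on S"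
  unfolding holomorphic_on_def field_differentiable_def
  using assms cauchy_transform_has_field_derivative has_field_derivative_at_within by blast

lemma cauchy_transform_holomorphic_upper: "cauchy_transform M holomorphic_on {z. 0 < Im z}"
  using gap_upper by (intro cauchy_transform_holomorphic) blast

text \<open>Bridges the two instances of the polymorphic transform: the analysis is complex, while
  u, x and the values of \<open>H_map\<close> at the spikes are real.\<close>

lemma cauchy_transform_of_real:
  "cauchy_transform M (of_real x :: complex) = of_real (cauchy_transform M x)"
proof -
  have "cauchy_transform M (of_real x :: complex) = (LINT t|M. complex_of_real (1 / (x - of_real t)))"
    unfolding cauchy_transform_def by (rule Bochner_Integration.integral_cong) (simp_all add: of_real_def[where ?'a=real])
  also have "\<dots> = of_real (cauchy_transform M x)"
    unfolding cauchy_transform_def by (rule integral_complex_of_real)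
  finally show ?thesis .
qed

end

section \<open>Support and mass\<close>

lemma cmod_of_real_minus_of_real: "cmod (of_real x - of_real t) = \<bar>x - t\<bar>"
  by (metis norm_of_real of_real_diff)

context real_distribution
begin

lemma not_in_support_gap:
  assumes "x \<notin> measure_support M"
  shows "\<exists>d. gap M (of_real x) d"
proof -
  obtain U where U: "open U" "x \<in> U" "emeasure M U = 0"
    using assms unfolding measure_support_def by (auto simp: zero_less_iff_neq_zero)
  then obtain d where d: "0 < d" "ball x d \<subseteq> U" by (meson open_contains_ball)
  have "AE t in M. t \<notin> U"
    using U by (intro AE_not_in) (auto simp: null_sets_def)
  then have "AE t in M. d \<le> cmod (of_real x - of_real t)"
  proof eventually_elim
    case (elim t)
    then have "t \<notin> ball x d" using d by auto
    then show ?case by (simp add: cmod_of_real_minus_of_real dist_real_def)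
  qed
  then show ?thesis using d by (auto simp: gap_def)
qed

lemma gap_not_in_support:
  assumes "gap M (of_real x) d"
  shows "x \<notin> measure_support M"
proof
  assume x: "x \<in> measure_support M"
  have "AE t in M. t \<notin> ball x d"
    using gap_AE[OF assms]
    by eventually_elim (auto simp: cmod_of_real_minus_of_real dist_real_def)
  then have "emeasure M (ball x d) = 0"
    by (subst (asm) AE_iff_measurable[of "ball x d"]) auto
  then show False using x gap_pos[OF assms] centre_in_ball[of x d] unfolding measure_support_def
    by (metis (mono_tags, lifting) less_irrefl mem_Collect_eq open_ball)
qed

text \<open>The complement of the support is the union of all open null sets, an uncountable family;
  by Lindelof countably many of them have the same union.\<close>

lemma AE_support: "AE t in M. t \<in> measure_support M"
proof -
  define F where "F = {U. open U \<and> emeasure M U = 0}"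
  obtain F' where F': "F' \<subseteq> F" "countable F'" "\<Union>F' = \<Union>F"
    using Lindelof[of F] unfolding F_def by blast
  have "\<Union>F' \<in> null_sets M"
    using F' unfolding F_def by (intro null_sets_UN'[of F' "\<lambda>x. x", simplified]) (auto simp: null_sets_def)
  then have "AE t in M. t \<notin> \<Union>F" using AE_not_in F'(3) by metis
  then show ?thesis
    by eventually_elim (auto simp: F_def measure_support_def zero_less_iff_neq_zero)
qed

lemma measure_support_nonempty: "measure_support M \<noteq> {}"
proof
  assume "measure_support M = {}"
  then have "AE t in M. False" using AE_support by simp
  then show False by simp
qed

lemma bounded_support:
  assumes "AE t in M. \<bar>t\<bar> \<le> B" "x \<in> measure_support M"
  shows "\<bar>x\<bar> \<le> B"
proof (rule ccontr)
  assume "\<not> \<bar>x\<bar> \<le> B"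
  then have "gap M (of_real x) (cmod (of_real x) - B)" using assms(1) by (intro gap_bounded) auto
  then show False using gap_not_in_support assms(2) by blast
qed

text \<open>On the interval the integrand 1 / ((x - t)^2 + y^2) is at least 1 / (2 y^2).\<close>

lemma measure_le_inv_square:
  assumes "0 < y"
  shows "measure M {x - y..x + y} \<le> 2 * y\<^sup>2 * inv_square M (Complex x y)"
proof -
  have "measure M {x - y..x + y} = (LINT t|M. indicator {x - y..x + y} t)" by simp
  also have "\<dots> \<le> (LINT t|M. 2 * y\<^sup>2 * (1 / (cmod (Complex x y - of_real t))\<^sup>2))"
  proof (rule integral_mono)
    show "integrable M (indicator {x - y..x + y} :: real \<Rightarrow> real)"
      by (rule integrable_const_bound[of _ 1]) (auto simp: indicator_def)
    show "integrable M (\<lambda>t. 2 * y\<^sup>2 * (1 / (cmod (Complex x y - of_real t))\<^sup>2))"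
      by (rule integrable_mult_right[OF gap_integrable_square[OF gap_upper]]) (use assms in simp)
    fix t
    have c: "(cmod (Complex x y - of_real t))\<^sup>2 = (x - t)\<^sup>2 + y\<^sup>2"
      by (simp add: cmod_def)
    show "indicator {x - y..x + y} t \<le> 2 * y\<^sup>2 * (1 / (cmod (Complex x y - of_real t))\<^sup>2)"
    proof (cases "t \<in> {x - y..x + y}")
      case True
      then have "\<bar>x - t\<bar> \<le> \<bar>y\<bar>" by auto
      then have "(x - t)\<^sup>2 \<le> y\<^sup>2" by (rule abs_le_square_iff[THEN iffD1])
      moreover have "0 < (x - t)\<^sup>2 + y\<^sup>2" using assms by (simp add: add_nonneg_pos)
      ultimately show ?thesis unfolding c using True by (simp add: divide_simps)
    qed auto
  qed
  also have "\<dots> = 2 * y\<^sup>2 * inv_square M (Complex x y)"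
    unfolding inv_square_def by (rule integral_mult_right_zero)
  finally show ?thesis .
qed

text \<open>Each of \<open>n\<close> intervals covering \<open>{a..b}\<close> has mass \<open>O(1 / n\<^sup>2)\<close>.\<close>

lemma measure_interval_eq_0:
  assumes "a < b" "0 < y0"
    and "\<And>x y. a \<le> x \<Longrightarrow> x \<le> b \<Longrightarrow> 0 < y \<Longrightarrow> y < y0 \<Longrightarrow> inv_square M (Complex x y) \<le> C"
  shows "measure M {a..b} = 0"
proof -
  define h where "h n = (b - a) / (2 * real n)" for n :: nat
  have "C \<ge> 0"
    using assms(3)[of a "y0/2"] assms(1,2) inv_square_nonneg[of "Complex a (y0/2)"] by simp
  have bound: "measure M {a..b} \<le> C * (b - a)\<^sup>2 / 2 * inverse (real n)" if n: "0 < n" "h n < y0" for n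
  proof -
    have h: "0 < h n" using n assms by (simp add: h_def)
    define c where "c i = a + (2 * real i + 1) * h n" for i :: nat
    have sub: "{a..b} \<subseteq> (\<Union>i<n. {c i - h n..c i + h n})"
    proof
      fix x assume x: "x \<in> {a..b}"
      show "x \<in> (\<Union>i<n. {c i - h n..c i + h n})"
      \<comment> \<open>The floor that locates the other points would give the index n, out of
        range, at the right end point.\<close>
      proof (cases "x = b")
        case True
        have "2 * real n * h n = b - a" using n by (simp add: h_def)
        then have "x \<in> {c (n - 1) - h n..c (n - 1) + h n}"
          using n h True by (auto simp: c_def of_nat_diff algebra_simps)
        then show ?thesis using n by auto
      next
        case False
        define i where "i = nat \<lfloor>(x - a) / (2 * h n)\<rfloor>"
        have nn: "0 \<le> (x - a) / (2 * h n)" using x h by auto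
        have "real i \<le> (x - a) / (2 * h n)" "(x - a) / (2 * h n) < real i + 1"
          using nn unfolding i_def by linarith+
        then have i: "2 * real i * h n \<le> x - a" "x - a < 2 * (real i + 1) * h n"
          using h by (simp_all add: field_simps)
        have "2 * real i * h n < 2 * real n * h n"
          using i x False n by (simp add: h_def)
        then have "i < n" using h by simp
        moreover have "x \<in> {c i - h n..c i + h n}" using i by (auto simp: c_def algebra_simps)
        ultimately show ?thesis by blast
      qed
    qed
    have "measure M {a..b} \<le> measure M (\<Union>i<n. {c i - h n..c i + h n})"
      using sub by (intro finite_measure_mono) auto
    also have "\<dots> \<le> (\<Sum>i<n. measure M {c i - h n..c i + h n})"
      by (intro finite_measure_subadditive_finite) auto
    also have "\<dots> \<le> (\<Sum>i<n. 2 * (h n)\<^sup>2 * C)"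
    proof (rule sum_mono)
      fix i assume "i \<in> {..<n}"
      then have i: "real i + 1 \<le> real n" by auto
      have "2 * real n * h n = b - a" using n by (simp add: h_def)
      moreover have "(2 * real i + 1) * h n \<le> 2 * real n * h n"
        using i h by (intro mult_right_mono) auto
      ultimately have "a \<le> c i" "c i \<le> b" using h by (auto simp: c_def)
      then have "inv_square M (Complex (c i) (h n)) \<le> C" using assms(3) h n by simp
      then have "2 * (h n)\<^sup>2 * inv_square M (Complex (c i) (h n)) \<le> 2 * (h n)\<^sup>2 * C"
        by (intro mult_left_mono) auto
      then show "measure M {c i - h n..c i + h n} \<le> 2 * (h n)\<^sup>2 * C"
        using measure_le_inv_square[OF h, of "c i"] by linarith
    qed
    also have "\<dots> = C * (b - a)\<^sup>2 / 2 * inverse (real n)"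
      using n by (simp add: h_def field_simps power2_eq_square)
    finally show ?thesis .
  qed
  have "h \<longlonglongrightarrow> 0" unfolding h_def by real_asymp
  then have "eventually (\<lambda>n. h n < y0) sequentially" using assms(2) by (rule order_tendstoD)
  then have ev: "eventually (\<lambda>n. measure M {a..b} \<le> C * (b - a)\<^sup>2 / 2 * inverse (real n)) sequentially"
    using eventually_gt_at_top[of 0] by eventually_elim (use bound in auto)
  have lim: "(\<lambda>n. C * (b - a)\<^sup>2 / 2 * inverse (real n)) \<longlonglongrightarrow> C * (b - a)\<^sup>2 / 2 * 0"
    by (intro tendsto_intros lim_inverse_n)
  have "measure M {a..b} \<le> 0"
    using tendsto_lowerbound[OF lim ev] by simp
  then show ?thesis by (simp add: measure_le_0_iff)
qed

text \<open>This is how points are removed from a support: from that of \<nu> near u and from that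
  of the free convolution near x.\<close>

lemma not_in_support_if_inv_square_bounded:
  assumes "0 < r" "\<And>w. cmod (w - of_real x) < r \<Longrightarrow> 0 < Im w \<Longrightarrow> inv_square M w \<le> C"
  shows "x \<notin> measure_support M"
proof
  assume x: "x \<in> measure_support M"
  have "measure M {x - r/3..x + r/3} = 0"
  \<comment> \<open>A rectangle of half-width and height r / 3 above the axis lies in the disc of
    radius r, because r / 3 + r / 3 < r.\<close>
  proof (rule measure_interval_eq_0[of _ _ "r/3" C])
    fix t y assume *: "x - r/3 \<le> t" "t \<le> x + r/3" "0 < y" "y < r/3"
    have "cmod (Complex t y - of_real x) \<le> \<bar>t - x\<bar> + \<bar>y\<bar>"
      using cmod_le[of "Complex t y - of_real x"] by simp
    then show "inv_square M (Complex t y) \<le> C" using * assms by (intro assms(2)) auto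
  qed (use assms(1) in auto)
  then have "measure M {x - r/3<..<x + r/3} = 0"
    using finite_measure_mono[of "{x - r/3<..<x + r/3}" "{x - r/3..x + r/3}"]
    by (auto simp: measure_le_0_iff greaterThanLessThan_subseteq_atLeastAtMost_iff)
  then have "emeasure M {x - r/3<..<x + r/3} = 0" by (simp add: emeasure_eq_measure)
  moreover have "x \<in> {x - r/3<..<x + r/3}" "open {x - r/3<..<x + r/3}" using assms(1) by auto
  ultimately show False using x unfolding measure_support_def by (metis (mono_tags, lifting) less_irrefl mem_Collect_eq)
qed

end

section \<open>Injectivity of the Cauchy transform\<close>

text \<open>The kernel lacks the factor \<open>1 / pi\<close> and its Fourier transform is not computed: it only matters
  that the latter is nonzero for small \<open>y\<close>, so that it can be cancelled.\<close>

definition poisson :: "real \<Rightarrow> real \<Rightarrow> real" where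
  "poisson y u = y / (u\<^sup>2 + y\<^sup>2)"

lemma poisson_measurable[measurable]: "poisson y \<in> borel_measurable borel"
  unfolding poisson_def by measurable

lemma poisson_nonneg: "0 < y \<Longrightarrow> 0 \<le> poisson y u"
  unfolding poisson_def by simp

lemma poisson_scale: "0 < y \<Longrightarrow> poisson y (y * u) = inverse (1 + u\<^sup>2) / y"
proof -
  assume "0 < y"
  moreover have "(y * u)\<^sup>2 + y\<^sup>2 = y * (y * (1 + u\<^sup>2))" by (simp add: power2_eq_square algebra_simps)
  ultimately show ?thesis unfolding poisson_def by (simp add: divide_inverse)
qed

lemma integrable_inverse_1_plus_square_lborel: "integrable lborel (\<lambda>u::real. inverse (1 + u\<^sup>2))"
  using integrable_inverse_1_plus_square by (simp add: set_integrable_def)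

lemma integrable_poisson:
  assumes "0 < y"
  shows "integrable lborel (\<lambda>x. poisson y (x - t))"
proof -
  have "integrable lborel (\<lambda>u. poisson y (0 + y * u))"
    using integrable_inverse_1_plus_square_lborel assms by (simp add: poisson_scale)
  then have "integrable lborel (poisson y)"
    using lborel_integrable_real_affine_iff[of y "poisson y" 0] assms by simp
  from lborel_integrable_real_affine[OF this, of 1 "-t"] show ?thesis by simp
qed

definition poisson_char :: "real \<Rightarrow> real \<Rightarrow> complex" where
  "poisson_char y s = (LINT u|lborel. iexp (s * u) * of_real (poisson y u))"

text \<open>After rescaling u by y, the frequency enters only through the product s y. As y tends to
  0, dominated convergence gives the total integral of 1 / (1 + u^2), which is positive.\<close>

lemma poisson_char_nonzero: "\<exists>y>0. poisson_char y s \<noteq> 0"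
proof -
  define k :: "real \<Rightarrow> real" where "k u = inverse (1 + u\<^sup>2)" for u
  have k0: "0 \<le> k u" for u by (simp add: k_def)
  have [measurable]: "k \<in> borel_measurable borel" unfolding k_def by measurable
  have kint: "integrable lborel k"
    unfolding k_def by (rule integrable_inverse_1_plus_square_lborel)
  have eq: "poisson_char y s = (LINT u|lborel. iexp (s * (y * u)) * of_real (k u))" if y: "0 < y" for y
  proof -
    have "poisson_char y s = y *\<^sub>R (LINT u|lborel. iexp (s * (0 + y * u)) * of_real (poisson y (0 + y * u)))"
      unfolding poisson_char_def using y by (subst lborel_integral_real_affine[of y _ 0]) auto
    also have "\<dots> = (LINT u|lborel. y *\<^sub>R (iexp (s * (0 + y * u)) * of_real (poisson y (0 + y * u))))"
      by simp
    also have "\<dots> = (LINT u|lborel. iexp (s * (y * u)) * of_real (k u))"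
      by (rule Bochner_Integration.integral_cong)
        (use y in \<open>auto simp: poisson_scale k_def scaleR_conv_of_real\<close>)
    finally show ?thesis .
  qed
  have "(\<lambda>n. LINT u|lborel. iexp (s * (inverse (real (Suc n)) * u)) * of_real (k u))
      \<longlonglongrightarrow> (LINT u|lborel. iexp (s * (0 * u)) * of_real (k u))"
  proof (rule integral_dominated_convergence)
    show "integrable lborel k" by (rule kint)
    show "AE u in lborel. (\<lambda>n. iexp (s * (inverse (real (Suc n)) * u)) * of_real (k u))
        \<longlonglongrightarrow> iexp (s * (0 * u)) * of_real (k u)"
      by (intro AE_I2 tendsto_intros LIMSEQ_inverse_real_of_nat)
    show "AE u in lborel. norm (iexp (s * (inverse (real (Suc n)) * u)) * of_real (k u)) \<le> k u" for n
      by (intro AE_I2) (simp add: norm_mult k0 del: of_real_mult)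
  qed simp_all
  also have "(LINT u|lborel. iexp (s * (0 * u)) * of_real (k u)) = of_real (LINT u|lborel. k u)"
    by simp
  finally have lim: "(\<lambda>n. poisson_char (inverse (real (Suc n))) s) \<longlonglongrightarrow> of_real (LINT u|lborel. k u)"
    by (subst eq) auto
  have "(LINT u|lborel. k u) \<noteq> 0"
  proof
    assume "(LINT u|lborel. k u) = 0"
    then have "AE u in lborel. k u = 0"
      by (subst (asm) integral_nonneg_eq_0_iff_AE) (use kint in \<open>auto simp: k_def\<close>)
    moreover have "k u \<noteq> 0" for u
      by (simp add: k_def) (metis add.commute power2_eq_square sum_power2_eq_zero_iff one_power2 zero_neq_one)
    ultimately have "AE u::real in lborel. False" by simp
    then show False by (auto simp: AE_iff_null null_sets_def)
  qed
  then have "eventually (\<lambda>n. poisson_char (inverse (real (Suc n))) s \<noteq> 0) sequentially"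
    by (intro tendsto_imp_eventually_ne[OF lim]) simp
  then obtain n where "poisson_char (inverse (real (Suc n))) s \<noteq> 0"
    by (auto simp: eventually_sequentially)
  then show ?thesis by (intro exI[of _ "inverse (real (Suc n))"]) auto
qed

context real_distribution
begin

lemma Im_cauchy_transform_poisson:
  assumes "0 < y"
  shows "- Im (cauchy_transform M (Complex x y)) = (LINT t|M. poisson y (x - t))"
proof -
  have "- Im (cauchy_transform M (Complex x y)) = (LINT t|M. y * (1 / (cmod (Complex x y - of_real t))\<^sup>2))"
    using Im_cauchy_transform[OF gap_upper[of "Complex x y"]] assms
    unfolding inv_square_def by (simp only: integral_mult_right_zero complex.sel)
  also have "\<dots> = (LINT t|M. poisson y (x - t))"
    by (rule Bochner_Integration.integral_cong) (simp_all add: poisson_def cmod_def)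
  finally show ?thesis .
qed

text \<open>On a horizontal line -Im g is the convolution of the measure with the Poisson kernel, so
  its Fourier transform factors.\<close>

lemma fourier_poisson_integral:
  assumes y: "0 < y"
  shows "(LINT x|lborel. iexp (s * x) * of_real (- Im (cauchy_transform M (Complex x y))))
    = char M s * poisson_char y s"
proof -
  interpret pair_sigma_finite M lborel ..
  define f where "f t x = iexp (s * x) * complex_of_real (poisson y (x - t))" for t x
  have meas[measurable]: "case_prod f \<in> borel_measurable (M \<Otimes>\<^sub>M lborel)"
    unfolding f_def by measurable
  have nrm: "norm (f t x) = poisson y (x - t)" for t x
    unfolding f_def using poisson_nonneg[OF y] by (simp add: norm_mult del: of_real_mult)
  have shift: "(LINT x|lborel. h (x - t)) = (LINT x|lborel. h x)" for h :: "real \<Rightarrow> 'b::{banach, second_countable_topology}" and t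
    using lborel_integral_real_affine[of 1 h "-t"] by simp
  have int: "integrable (M \<Otimes>\<^sub>M lborel) (case_prod f)"
  proof (rule Fubini_integrable)
    \<comment> \<open>By translation invariance the inner integral is a constant in the outer
      variable.\<close>
    show "integrable M (\<lambda>x. LINT y|lborel. norm (case_prod f (x, y)))"
      by (simp add: nrm shift)
    show "AE t in M. integrable lborel (\<lambda>x. case_prod f (t, x))"
    proof (rule AE_I2)
      fix t
      show "integrable lborel (\<lambda>x. case_prod f (t, x))"
        by (rule Bochner_Integration.integrable_bound[OF integrable_poisson[OF y, of t]])
          (auto simp: nrm f_def norm_mult simp del: of_real_mult)
    qed
  qed (rule meas)
  have "(LINT x|lborel. iexp (s * x) * of_real (- Im (cauchy_transform M (Complex x y))))
      = (LINT x|lborel. (LINT t|M. f t x))"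
    unfolding f_def Im_cauchy_transform_poisson[OF y] by simp
  also have "\<dots> = (LINT t|M. (LINT x|lborel. f t x))" by (rule Fubini_integral[OF int])
  also have "\<dots> = (LINT t|M. iexp (s * t) * poisson_char y s)"
  proof (rule Bochner_Integration.integral_cong)
    fix t
    have "(LINT x|lborel. f t x) = (LINT x|lborel. iexp (s * t) * (iexp (s * (x - t)) * of_real (poisson y (x - t))))"
      unfolding f_def
      by (rule Bochner_Integration.integral_cong) (auto simp: algebra_simps simp flip: exp_add)
    also have "\<dots> = iexp (s * t) * poisson_char y s"
      unfolding poisson_char_def
      by (simp only: integral_mult_right_zero shift[of "\<lambda>x. iexp (s * x) * of_real (poisson y x)"])
    finally show "(LINT x|lborel. f t x) = iexp (s * t) * poisson_char y s" .
  qed simp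
  also have "\<dots> = char M s * poisson_char y s"
    unfolding char_def by simp
  finally show ?thesis .
qed

end

text \<open>Takes the place of Stieltjes inversion. The characteristic functions are compared at one
  frequency at a time, so the height y may depend on s.\<close>

theorem cauchy_transform_inj:
  assumes "real_distribution \<mu>" "real_distribution \<kappa>"
    and eq: "\<And>z::complex. 0 < Im z \<Longrightarrow> cauchy_transform \<mu> z = cauchy_transform \<kappa> z"
  shows "\<mu> = \<kappa>"
proof (rule Levy_uniqueness[OF assms(1,2)], rule ext)
  fix s
  obtain y where y: "0 < y" "poisson_char y s \<noteq> 0" using poisson_char_nonzero by blast
  have "char \<mu> s * poisson_char y s = char \<kappa> s * poisson_char y s"
    using real_distribution.fourier_poisson_integral[OF assms(1) y(1), of s]
      real_distribution.fourier_poisson_integral[OF assms(2) y(1), of s] eq y(1)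
    by simp
  then show "char \<mu> s = char \<kappa> s" using y by simp
qed

section \<open>The Cauchy transform of the semicircle distribution\<close>

definition semicircle_density :: "real \<Rightarrow> real \<Rightarrow> real" where
  "semicircle_density \<sigma> x = indicator {-2*\<sigma>..2*\<sigma>} x * (1 / (2*pi*\<sigma>\<^sup>2) * sqrt (4*\<sigma>\<^sup>2 - x\<^sup>2))"

lemma semicircle_eq: "semicircle \<sigma> = density lborel (\<lambda>x. ennreal (semicircle_density \<sigma> x))"
  unfolding semicircle_def semicircle_density_def ..

lemma semicircle_density_measurable[measurable]: "semicircle_density \<sigma> \<in> borel_measurable borel"
  unfolding semicircle_density_def by measurable

lemma semicircle_density_nonneg: "0 < \<sigma> \<Longrightarrow> 0 \<le> semicircle_density \<sigma> x"
proof -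
  assume "0 < \<sigma>"
  moreover have "x\<^sup>2 \<le> 4 * \<sigma>\<^sup>2" if "x \<in> {-2*\<sigma>..2*\<sigma>}"
    using that abs_le_square_iff[of x "2 * \<sigma>"] by (auto simp: power_mult_distrib)
  ultimately show ?thesis by (auto simp: semicircle_density_def indicator_def)
qed

lemma has_integral_sqrt_circle:
  assumes "0 < (r::real)"
  shows "((\<lambda>x. sqrt (r\<^sup>2 - x\<^sup>2)) has_integral (pi * r\<^sup>2 / 2)) {-r..r}"
proof -
  define F where "F x = (x * sqrt (r\<^sup>2 - x\<^sup>2) + r\<^sup>2 * arcsin (x / r)) / 2" for x
  have "((\<lambda>x. sqrt (r\<^sup>2 - x\<^sup>2)) has_integral (F r - F (-r))) {-r..r}"
  \<comment> \<open>The derivative rules of \<open>arcsin\<close> and \<open>sqrt\<close> break down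
    at the end points, where F is only used through its continuity.\<close>
  proof (rule fundamental_theorem_of_calculus_interior)
    show "continuous_on {-r..r} F"
      unfolding F_def using assms by (intro continuous_intros) (auto simp: field_simps)
    fix x assume x: "x \<in> {-r<..<r}"
    have pos: "0 < r\<^sup>2 - x\<^sup>2" using x mult_pos_pos[of "r - x" "r + x"] by (simp add: algebra_simps power2_eq_square)
    define s where "s = sqrt (r\<^sup>2 - x\<^sup>2)"
    have s: "0 < s" "s * s = r\<^sup>2 - x\<^sup>2" using pos by (auto simp: s_def)
    have q: "sqrt (1 - (x / r)\<^sup>2) = s / r"
    proof -
      have "1 - (x / r)\<^sup>2 = (r\<^sup>2 - x\<^sup>2) / r\<^sup>2" using assms by (simp add: field_simps)
      then show ?thesis using assms by (simp add: s_def real_sqrt_divide)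
    qed
    have d: "(F has_real_derivative ((1 * s + (inverse s / 2) * (0 - 2 * x) * x) + r\<^sup>2 * (inverse (s / r) * (1 / r))) / 2) (at x)"
      unfolding F_def using x assms pos
      by (auto intro!: derivative_eq_intros simp: q simp flip: s_def) (simp_all add: field_simps)
    have "((1 * s + (inverse s / 2) * (0 - 2 * x) * x) + r\<^sup>2 * (inverse (s / r) * (1 / r))) / 2
        = (s * s + r\<^sup>2 - x\<^sup>2) / (2 * s)"
      using s(1) assms by (simp add: field_simps power2_eq_square)
    also have "\<dots> = s" using s by (simp add: field_simps power2_eq_square)
    finally have E: "((1 * s + (inverse s / 2) * (0 - 2 * x) * x) + r\<^sup>2 * (inverse (s / r) * (1 / r))) / 2 = s" .
    show "(F has_vector_derivative sqrt (r\<^sup>2 - x\<^sup>2)) (at x)"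
      using d unfolding E by (simp only: has_real_derivative_iff_has_vector_derivative s_def)
  qed (use assms in simp)
  moreover have "F r - F (-r) = pi * r\<^sup>2 / 2" using assms by (simp add: F_def arcsin_minus field_simps)
  ultimately show ?thesis by simp
qed

lemma has_integral_sqrt_circle_cauchy:
  assumes r: "0 < (r::real)" and a: "r < a"
  shows "((\<lambda>x. sqrt (r\<^sup>2 - x\<^sup>2) / (a - x)) has_integral (pi * (a - sqrt (a\<^sup>2 - r\<^sup>2)))) {-r..r}"
proof -
  define b where "b = sqrt (a\<^sup>2 - r\<^sup>2)"
  have ar: "0 < a\<^sup>2 - r\<^sup>2" using r a by (simp add: power_strict_mono)
  have b: "0 < b" "b * b = a\<^sup>2 - r\<^sup>2" using ar by (auto simp: b_def)
  \<comment> \<open>\<open>r\<^sup>2 - x\<^sup>2 = (a - x) (a + x) - b\<^sup>2\<close>, and \<open>arcsin Y\<close> is an antiderivative of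
    \<open>b / ((a - x) sqrt (r\<^sup>2 - x\<^sup>2))\<close>.\<close>
  define Y where "Y x = (a * x - r\<^sup>2) / (r * (a - x))" for x
  define F where "F x = a * arcsin (x / r) - sqrt (r\<^sup>2 - x\<^sup>2) - b * arcsin (Y x)" for x
  have Yle: "Y x \<le> 1" "-1 \<le> Y x" if "-r \<le> x" "x \<le> r" for x
  proof -
    have p: "0 < r * (a - x)" using that r a by simp
    have "0 \<le> (a + r) * (r - x)" "0 \<le> (a - r) * (r + x)" using that r a by auto
    then have "a * x - r\<^sup>2 \<le> r * (a - x)" "- (r * (a - x)) \<le> a * x - r\<^sup>2"
      by (simp_all add: algebra_simps power2_eq_square)
    then show "Y x \<le> 1" "-1 \<le> Y x" unfolding Y_def using p
      by (auto simp: pos_divide_le_eq pos_le_divide_eq simp del: mult_pos_pos)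
  qed
  have "((\<lambda>x. sqrt (r\<^sup>2 - x\<^sup>2) / (a - x)) has_integral (F r - F (-r))) {-r..r}"
  proof (rule fundamental_theorem_of_calculus_interior)
    have "continuous_on {-r..r} Y"
      unfolding Y_def using r a by (intro continuous_intros) auto
    then show "continuous_on {-r..r} F"
      unfolding F_def using r Yle by (intro continuous_intros) (auto simp: field_simps)
    fix x assume x: "x \<in> {-r<..<r}"
    have pos: "0 < r\<^sup>2 - x\<^sup>2" using x mult_pos_pos[of "r - x" "r + x"] by (simp add: algebra_simps power2_eq_square)
    define s where "s = sqrt (r\<^sup>2 - x\<^sup>2)"
    have s: "0 < s" "s * s = r\<^sup>2 - x\<^sup>2" using pos by (auto simp: s_def)
    have ax: "0 < a - x" using x a by simp
    have q: "sqrt (1 - (x / r)\<^sup>2) = s / r"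
    proof -
      have "1 - (x / r)\<^sup>2 = (r\<^sup>2 - x\<^sup>2) / r\<^sup>2" using r by (simp add: field_simps)
      then show ?thesis using r by (simp add: s_def real_sqrt_divide)
    qed
    have Ysq: "1 - (Y x)\<^sup>2 = (b * s / (r * (a - x)))\<^sup>2"
    proof -
      have "(b * s)\<^sup>2 = (a\<^sup>2 - r\<^sup>2) * (r\<^sup>2 - x\<^sup>2)"
        by (simp only: power_mult_distrib power2_eq_square[of b] power2_eq_square[of s] b(2) s(2))
      then have "(b * s / (r * (a - x)))\<^sup>2 = (a\<^sup>2 - r\<^sup>2) * (r\<^sup>2 - x\<^sup>2) / (r * (a - x))\<^sup>2"
        by (simp add: power_divide)
      also have "(a\<^sup>2 - r\<^sup>2) * (r\<^sup>2 - x\<^sup>2) = (r * (a - x))\<^sup>2 - (a * x - r\<^sup>2)\<^sup>2"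
        by (simp add: power2_eq_square algebra_simps)
      also have "((r * (a - x))\<^sup>2 - (a * x - r\<^sup>2)\<^sup>2) / (r * (a - x))\<^sup>2 = 1 - (Y x)\<^sup>2"
        unfolding Y_def power_divide using r ax by (simp only: diff_divide_distrib) simp
      finally show ?thesis ..
    qed
    have Ys: "sqrt (1 - (Y x)\<^sup>2) = b * s / (r * (a - x))"
      unfolding Ysq using b s r ax by simp
    have "0 < (b * s / (r * (a - x)))\<^sup>2" using b s r ax by simp
    then have "(Y x)\<^sup>2 < 1" using Ysq by linarith
    then have Y1: "-1 < Y x" "Y x < 1" by (auto simp: abs_square_less_1)
    have dY: "(Y has_real_derivative b * b / (r * (a - x)\<^sup>2)) (at x)"
    proof -
      have "(Y has_real_derivative (a * (r * (a - x)) - (a * x - r\<^sup>2) * (- r)) / ((r * (a - x)) * (r * (a - x)))) (at x)"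
        unfolding Y_def using r ax by (intro DERIV_divide) (auto intro!: derivative_eq_intros)
      moreover have "(a * (r * (a - x)) - (a * x - r\<^sup>2) * (- r)) / ((r * (a - x)) * (r * (a - x)))
          = b * b / (r * (a - x)\<^sup>2)"
      proof -
        have "a * (r * (a - x)) - (a * x - r\<^sup>2) * (- r) = r * (b * b)" unfolding b(2) by (simp add: power2_eq_square algebra_simps)
        then show ?thesis using r by (simp add: power2_eq_square)
      qed
      ultimately show ?thesis by simp
    qed
    have dA: "((\<lambda>x. arcsin (Y x)) has_real_derivative inverse (sqrt (1 - (Y x)\<^sup>2)) * (b * b / (r * (a - x)\<^sup>2))) (at x)"
      by (rule DERIV_chain'[OF dY DERIV_arcsin[OF Y1]])
    have d: "(F has_real_derivative a * (inverse (s / r) * (1 / r)) - (inverse s / 2) * (0 - 2 * x)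
        - b * (inverse (sqrt (1 - (Y x)\<^sup>2)) * (b * b / (r * (a - x)\<^sup>2)))) (at x)"
      unfolding F_def
    proof (intro DERIV_diff DERIV_cmult dA)
      show "((\<lambda>x. arcsin (x / r)) has_real_derivative inverse (s / r) * (1 / r)) (at x)"
        using x r by (auto intro!: derivative_eq_intros simp: q pos_less_divide_eq pos_divide_less_eq)
      have "((\<lambda>x. r\<^sup>2 - x\<^sup>2) has_real_derivative 0 - 2 * x) (at x)"
        by (auto intro!: derivative_eq_intros)
      from DERIV_chain'[OF this DERIV_real_sqrt[OF pos]]
      show "((\<lambda>x. sqrt (r\<^sup>2 - x\<^sup>2)) has_real_derivative inverse s / 2 * (0 - 2 * x)) (at x)"
        by (simp only: s_def)
    qed
    have "a * (inverse (s / r) * (1 / r)) - (inverse s / 2) * (0 - 2 * x)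
        - b * (inverse (sqrt (1 - (Y x)\<^sup>2)) * (b * b / (r * (a - x)\<^sup>2)))
        = (a + x) / s - b * b / (s * (a - x))"
    proof -
      define X where "X = a - x"
      have "a * (inverse (s / r) * (1 / r)) = a / s" "(inverse s / 2) * (0 - 2 * x) = - (x / s)"
        using r s(1) by (simp_all add: field_simps)
      moreover have "b * (inverse (b * s / (r * X)) * (b * b / (r * X\<^sup>2))) = b * b / (s * X)"
      proof -
        have "0 < X" using ax by (simp add: X_def)
        then show ?thesis using r s(1) b(1)
          by (simp add: power2_eq_square field_simps)
      qed
      ultimately show ?thesis unfolding Ys X_def by (simp add: add_divide_distrib)
    qed
    also have "\<dots> = ((a + x) * (a - x) - b * b) / (s * (a - x))"
      using s ax by (simp add: field_simps)
    also have "(a + x) * (a - x) - b * b = s * s" unfolding b(2) s(2) by (simp add: power2_eq_square algebra_simps)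
    also have "s * s / (s * (a - x)) = s / (a - x)" using s(1) by simp
    finally have E: "a * (inverse (s / r) * (1 / r)) - (inverse s / 2) * (0 - 2 * x)
        - b * (inverse (sqrt (1 - (Y x)\<^sup>2)) * (b * b / (r * (a - x)\<^sup>2))) = s / (a - x)" .
    show "(F has_vector_derivative sqrt (r\<^sup>2 - x\<^sup>2) / (a - x)) (at x)"
      using d unfolding E by (simp only: has_real_derivative_iff_has_vector_derivative s_def)
  qed (use r in simp)
  moreover have "F r - F (-r) = pi * (a - b)"
  proof -
    have "a * r - r\<^sup>2 = r * (a - r)" by (simp add: power2_eq_square algebra_simps)
    then have "Y r = 1" using r a by (simp add: Y_def)
    moreover have "Y (-r) = -1"
    proof -
      have "a * - r - r\<^sup>2 = - (r * (a + r))" by (simp add: power2_eq_square algebra_simps)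
      moreover have "r * (a + r) \<noteq> 0" using r a by simp
      ultimately show ?thesis by (simp add: Y_def)
    qed
    moreover have "arcsin (-1 :: real) = - (pi / 2)" by (simp add: arcsin_minus)
    ultimately have "F r = a * (pi / 2) - b * (pi / 2)" "F (-r) = - (a * (pi / 2)) + b * (pi / 2)"
      using r by (simp_all add: F_def)
    then show ?thesis by (simp add: algebra_simps)
  qed
  ultimately show ?thesis by (simp add: b_def)
qed

lemma lborel_integral_indicator_eq:
  fixes f :: "real \<Rightarrow> real"
  assumes "(f has_integral I) S" "\<And>x. x \<in> S \<Longrightarrow> 0 \<le> f x" "(\<lambda>x. indicator S x * f x) \<in> borel_measurable borel" "0 \<le> I"
  shows "has_bochner_integral lborel (\<lambda>x. indicator S x * f x) I"
proof (rule has_bochner_integral_nn_integral)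
  show "AE x in lborel. 0 \<le> indicator S x * f x" using assms(2) by (auto simp: indicator_def)
  show "(\<integral>\<^sup>+ x. ennreal (indicator S x * f x) \<partial>lborel) = ennreal I"
    using assms(1,2) by (intro nn_integral_has_integral_lebesgue) auto
qed (use assms in auto)

lemma real_distribution_semicircle:
  assumes "0 < \<sigma>"
  shows "real_distribution (semicircle \<sigma>)"
proof -
  have "has_bochner_integral lborel (\<lambda>x. indicator {-(2*\<sigma>)..2*\<sigma>} x * sqrt ((2*\<sigma>)\<^sup>2 - x\<^sup>2)) (pi * (2*\<sigma>)\<^sup>2 / 2)"
  proof (rule lborel_integral_indicator_eq)
    fix x assume "x \<in> {-(2*\<sigma>)..2*\<sigma>}"
    then have "0 \<le> (2*\<sigma>)\<^sup>2 - x\<^sup>2" using abs_le_square_iff[of x "2*\<sigma>"] by auto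
    then show "0 \<le> sqrt ((2*\<sigma>)\<^sup>2 - x\<^sup>2)" by simp
  qed (use has_integral_sqrt_circle[of "2*\<sigma>"] assms in auto)
  from has_bochner_integral_mult_right[OF this, of "1 / (2*pi*\<sigma>\<^sup>2)"]
  have "has_bochner_integral lborel (\<lambda>x. 1 / (2*pi*\<sigma>\<^sup>2) * (indicator {-(2*\<sigma>)..2*\<sigma>} x * sqrt ((2*\<sigma>)\<^sup>2 - x\<^sup>2))) 1"
    using assms by (simp add: power_mult_distrib)
  moreover have "(\<lambda>x. 1 / (2*pi*\<sigma>\<^sup>2) * (indicator {-(2*\<sigma>)..2*\<sigma>} x * sqrt ((2*\<sigma>)\<^sup>2 - x\<^sup>2))) = semicircle_density \<sigma>"
    by (rule ext) (simp add: semicircle_density_def power_mult_distrib)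
  ultimately have "has_bochner_integral lborel (semicircle_density \<sigma>) 1"
    by simp
  then have "(\<integral>\<^sup>+ x. ennreal (semicircle_density \<sigma> x) \<partial>lborel) = 1"
    using semicircle_density_nonneg[OF assms]
    by (subst nn_integral_eq_integral) (auto simp: has_bochner_integral_iff)
  then have "prob_space (semicircle \<sigma>)"
    by (intro prob_spaceI) (simp add: semicircle_eq emeasure_density)
  then show ?thesis
    by (simp add: real_distribution_def real_distribution_axioms_def semicircle_eq)
qed

lemma AE_semicircle: "AE x in semicircle \<sigma>. \<bar>x\<bar> \<le> 2 * \<sigma>"
  unfolding semicircle_eq by (subst AE_density) (auto simp: semicircle_density_def indicator_def)

lemma cauchy_transform_semicircle_real:
  assumes s: "0 < \<sigma>" and a: "2 * \<sigma> < a"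
  shows "cauchy_transform (semicircle \<sigma>) a = (a - sqrt (a\<^sup>2 - 4 * \<sigma>\<^sup>2)) / (2 * \<sigma>\<^sup>2)"
proof -
  have hb: "has_bochner_integral lborel (\<lambda>x. indicator {-(2*\<sigma>)..2*\<sigma>} x * (sqrt ((2*\<sigma>)\<^sup>2 - x\<^sup>2) / (a - x)))
      (pi * (a - sqrt (a\<^sup>2 - (2*\<sigma>)\<^sup>2)))"
  proof (rule lborel_integral_indicator_eq)
    show "0 \<le> pi * (a - sqrt (a\<^sup>2 - (2*\<sigma>)\<^sup>2))"
    proof -
      have "sqrt (a\<^sup>2 - (2*\<sigma>)\<^sup>2) \<le> sqrt (a\<^sup>2)" by (rule real_sqrt_le_mono) simp
      then show ?thesis using s a by simp
    qed
    fix x assume x: "x \<in> {-(2*\<sigma>)..2*\<sigma>}"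
    then have "0 \<le> (2*\<sigma>)\<^sup>2 - x\<^sup>2" using abs_le_square_iff[of x "2*\<sigma>"] by auto
    then show "0 \<le> sqrt ((2*\<sigma>)\<^sup>2 - x\<^sup>2) / (a - x)"
      using x a by (intro divide_nonneg_nonneg real_sqrt_ge_zero) auto
  qed (use has_integral_sqrt_circle_cauchy[of "2*\<sigma>" a] assms in auto)
  from has_bochner_integral_mult_right[OF hb, of "1 / (2*pi*\<sigma>\<^sup>2)"]
  have "has_bochner_integral lborel (\<lambda>x. semicircle_density \<sigma> x * (1 / (a - x)))
      ((a - sqrt (a\<^sup>2 - 4 * \<sigma>\<^sup>2)) / (2 * \<sigma>\<^sup>2))"
    unfolding semicircle_density_def using assms by (simp add: power_mult_distrib mult_ac)
  then have "(LINT x|lborel. semicircle_density \<sigma> x * (1 / (a - x))) = (a - sqrt (a\<^sup>2 - 4 * \<sigma>\<^sup>2)) / (2 * \<sigma>\<^sup>2)"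
    by (rule has_bochner_integral_integral_eq)
  moreover have "cauchy_transform (semicircle \<sigma>) a = (LINT x|lborel. semicircle_density \<sigma> x * (1 / (a - x)))"
    unfolding cauchy_transform_def semicircle_eq
    by (subst integral_density) (auto simp: semicircle_density_nonneg[OF s])
  ultimately show ?thesis by simp
qed

text \<open>The equation is checked on the real ray to the right of 2 \<sigma>, where the integral
  is elementary and the square root is an ordinary real one. The identity theorem carries it to the
  complement of the disc of radius 2 \<sigma> and from there to the upper half-plane.\<close>

lemma cauchy_transform_semicircle:
  assumes s: "0 < \<sigma>" and z: "0 < Im z"
  shows "of_real (\<sigma>\<^sup>2) * (cauchy_transform (semicircle \<sigma>) z)\<^sup>2 - z * cauchy_transform (semicircle \<sigma>) z + 1 = (0::complex)"
proof -
  interpret real_distribution "semicircle \<sigma>" by (rule real_distribution_semicircle[OF s])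
  define G where "G z = of_real (\<sigma>\<^sup>2) * (cauchy_transform (semicircle \<sigma>) z)\<^sup>2 - z * cauchy_transform (semicircle \<sigma>) z + 1" for z :: complex
  define S where "S = - cball (0::complex) (2 * \<sigma>)"
  have gap_out: "\<exists>d. gap (semicircle \<sigma>) z d" if "2 * \<sigma> < cmod z" for z
    using gap_bounded[OF AE_semicircle that] by blast
  have hol: "G holomorphic_on T" if "\<And>z. z \<in> T \<Longrightarrow> \<exists>d. gap (semicircle \<sigma>) z d" for T
    unfolding G_def using cauchy_transform_holomorphic[OF that] by (intro holomorphic_intros) auto
  have real0: "G (of_real a) = 0" if "2 * \<sigma> < a" for a
  proof -
    define b where "b = sqrt (a\<^sup>2 - 4 * \<sigma>\<^sup>2)"
    have "(2 * \<sigma>)\<^sup>2 \<le> a\<^sup>2" using that s by (intro power_mono) auto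
    then have b: "b\<^sup>2 = a\<^sup>2 - 4 * \<sigma>\<^sup>2" by (simp add: b_def power_mult_distrib)
    have c: "cauchy_transform (semicircle \<sigma>) a = (a - b) / (2 * \<sigma>\<^sup>2)"
      using cauchy_transform_semicircle_real[OF s that] by (simp add: b_def)
    have "\<sigma>\<^sup>2 * ((a - b) / (2 * \<sigma>\<^sup>2))\<^sup>2 - a * ((a - b) / (2 * \<sigma>\<^sup>2)) + 1
        = ((a - b)\<^sup>2 - 2 * a * (a - b) + 4 * \<sigma>\<^sup>2) / (4 * \<sigma>\<^sup>2)"
      using s by (simp add: field_simps power2_eq_square)
    also have "(a - b)\<^sup>2 - 2 * a * (a - b) + 4 * \<sigma>\<^sup>2 = 0" using b by (simp add: power2_eq_square algebra_simps)
    finally have "\<sigma>\<^sup>2 * (cauchy_transform (semicircle \<sigma>) a)\<^sup>2 - a * cauchy_transform (semicircle \<sigma>) a + 1 = 0"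
      unfolding c by simp
    then have "complex_of_real (\<sigma>\<^sup>2 * (cauchy_transform (semicircle \<sigma>) a)\<^sup>2 - a * cauchy_transform (semicircle \<sigma>) a + 1) = 0"
      by (simp only: of_real_0)
    then show ?thesis unfolding G_def cauchy_transform_of_real by simp
  qed
  have S0: "G z = 0" if "z \<in> S" for z
  proof (rule analytic_continuation[of G S "of_real ` {2 * \<sigma><..}" "of_real (3 * \<sigma>)"])
    show "G holomorphic_on S" by (rule hol) (auto simp: S_def gap_out)
    show "open S" unfolding S_def by auto
    show "connected S" unfolding S_def
      by (rule connected_complement_bounded_convex) (auto simp: DIM_complex)
    show "of_real ` {2 * \<sigma><..} \<subseteq> S" using s by (auto simp: S_def)
    show "of_real (3 * \<sigma>) \<in> S" using s by (auto simp: S_def norm_mult)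
    show "complex_of_real (3 * \<sigma>) islimpt of_real ` {2 * \<sigma><..}"
      unfolding islimpt_sequential
    proof (intro exI conjI allI)
      fix n
      show "complex_of_real (3 * \<sigma> + \<sigma> * inverse (real (Suc n))) \<in> of_real ` {2 * \<sigma><..} - {of_real (3 * \<sigma>)}"
      proof -
        have "0 < \<sigma> * inverse (real (Suc n))" using s by simp
        then have "2 * \<sigma> < 3 * \<sigma> + \<sigma> * inverse (real (Suc n))" "3 * \<sigma> + \<sigma> * inverse (real (Suc n)) \<noteq> 3 * \<sigma>"
          using s by linarith+
        moreover define x where "x = 3 * \<sigma> + \<sigma> * inverse (real (Suc n))"
        ultimately have "2 * \<sigma> < x" "x \<noteq> 3 * \<sigma>" by simp_all
        then have "complex_of_real x \<in> of_real ` {2 * \<sigma><..} - {of_real (3 * \<sigma>)}"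
          by (simp only: image_iff Diff_iff singleton_iff of_real_eq_iff greaterThan_iff) blast
        then show ?thesis by (simp only: x_def)
      qed
      have "(\<lambda>n. complex_of_real (3 * \<sigma> + \<sigma> * inverse (real (Suc n)))) \<longlonglongrightarrow> of_real (3 * \<sigma> + \<sigma> * 0)"
        by (intro tendsto_intros LIMSEQ_inverse_real_of_nat)
      then show "(\<lambda>n. complex_of_real (3 * \<sigma> + \<sigma> * inverse (real (Suc n)))) \<longlonglongrightarrow> of_real (3 * \<sigma>)" by simp
    qed
  qed (use that real0 in auto)
  \<comment> \<open>Points of the upper half-plane inside the disc are reached from the half-plane
    Im > 2 \<sigma>, which lies in \<open>S\<close>.\<close>
  have "G z = 0"
  proof (rule analytic_continuation_open[where f = G and g = "\<lambda>_. 0" and s = "{z. 2 * \<sigma> < Im z}" and s' = "{z. 0 < Im z}"])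
    show "open {z. 2 * \<sigma> < Im z}" "open {z. 0 < Im z}" by (simp_all add: open_halfspace_Im_gt)
    show "{z. 2 * \<sigma> < Im z} \<noteq> {}" by (auto intro!: exI[of _ "Complex 0 (3 * \<sigma>)"] simp: s)
    show "connected {z. 0 < Im z}" by (simp add: convex_connected convex_halfspace_Im_gt)
    show "{z. 2 * \<sigma> < Im z} \<subseteq> {z. 0 < Im z}" using s by auto
    show "G holomorphic_on {z. 0 < Im z}" by (rule hol) (use gap_upper in auto)
    show "G w = 0" if "w \<in> {z. 2 * \<sigma> < Im z}" for w
      using that abs_Im_le_cmod[of w] s by (intro S0) (auto simp: S_def)
  qed (use z in simp_all)
  then show ?thesis by (simp add: G_def)
qed

section \<open>Subordination characterises the free convolution\<close>

text \<open>Pastur's equation: the additivity of R-transforms with R(w) = \<sigma>^2 w for the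
  semicircle, rewritten without inverse functions.\<close>

definition subordinate :: "real \<Rightarrow> real measure \<Rightarrow> real measure \<Rightarrow> bool" where
  "subordinate \<sigma> \<tau> \<kappa> \<longleftrightarrow> (\<forall>z::complex. 0 < Im z \<longrightarrow>
     cauchy_transform \<kappa> z = cauchy_transform \<tau> (z - of_real (\<sigma>\<^sup>2) * cauchy_transform \<kappa> z))"

lemma in_truncated_angleD: "z \<in> truncated_angle \<alpha> \<beta> \<Longrightarrow> 0 < \<beta> \<Longrightarrow> 0 < Im z"
  by (auto simp: truncated_angle_def)

context real_distribution
begin

lemma Im_subordination_ge:
  assumes "0 < Im z"
  shows "Im z \<le> Im (z - of_real (\<sigma>\<^sup>2) * cauchy_transform M z)"
proof -
  have "0 \<le> \<sigma>\<^sup>2 * (- Im (cauchy_transform M z))"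
    using Im_cauchy_transform_neg[OF assms] by (intro mult_nonneg_nonneg) auto
  then show ?thesis by simp
qed

lemma Im_H_map:
  assumes "gap M w d"
  shows "Im (H_map \<sigma> M w) = Im w * (1 - \<sigma>\<^sup>2 * inv_square M w)"
  using Im_cauchy_transform[OF assms] by (simp add: H_map_def algebra_simps)

lemma H_map_diff:
  assumes "gap M z d" "gap M w e"
  shows "H_map \<sigma> M z - H_map \<sigma> M w = (z - w) * (1 - of_real (\<sigma>\<^sup>2) * inv_prod M z w)"
proof -
  have "H_map \<sigma> M z - H_map \<sigma> M w = (z - w) + of_real (\<sigma>\<^sup>2) * (cauchy_transform M z - cauchy_transform M w)"
    by (simp add: H_map_def algebra_simps)
  then show ?thesis unfolding cauchy_transform_diff[OF assms] by (simp add: algebra_simps)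
qed

text \<open>\<open>Im H(w) > 0\<close> forces \<open>\<sigma>\<^sup>2 \<integral> d\<mu>(t) / \<bar>w - t\<bar>\<^sup>2 < 1\<close>, so the difference quotient of \<open>H\<close>
  cannot vanish.\<close>

lemma H_map_inj_upper:
  assumes "0 < Im w" "0 < Im v" "H_map \<sigma> M w = H_map \<sigma> M v" "0 < Im (H_map \<sigma> M v)"
  shows "w = v"
proof (rule ccontr)
  assume "w \<noteq> v"
  have less: "\<sigma>\<^sup>2 * inv_square M u < 1" if "0 < Im u" "0 < Im (H_map \<sigma> M u)" for u
    using that Im_H_map[OF gap_upper[OF that(1)], of \<sigma>] by (simp add: zero_less_mult_iff)
  have g: "gap M w (Im w)" "gap M v (Im v)" using assms gap_upper by auto
  have "1 - of_real (\<sigma>\<^sup>2) * inv_prod M w v = 0"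
    using H_map_diff[OF g, of \<sigma>] assms(3) \<open>w \<noteq> v\<close> by simp
  then have "of_real (\<sigma>\<^sup>2) * inv_prod M w v = 1" by simp
  then have "1 = cmod (of_real (\<sigma>\<^sup>2) * inv_prod M w v)" by simp
  also have "\<dots> = \<sigma>\<^sup>2 * cmod (inv_prod M w v)" by (simp add: norm_mult norm_power)
  also have "\<dots> \<le> \<sigma>\<^sup>2 * ((inv_square M w + inv_square M v) / 2)"
    by (intro mult_left_mono inv_prod_le[OF g]) auto
  also have "\<dots> = (\<sigma>\<^sup>2 * inv_square M w + \<sigma>\<^sup>2 * inv_square M v) / 2"
    by (simp add: algebra_simps add_divide_distrib)
  also have "\<dots> < 1" using less[of w] less[of v] assms by simp
  finally show False by simp
qed

text \<open>The product z w \<open>inv_prod\<close> is the mean of (1 + t / (z - t)) (1 + t / (w -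
  t)). Beyond 8 B the distances are at least 7 B, both fractions are at most 1 / 7 in modulus, and
  the mean stays within 15 / 49 < 1 / 2 of 1. So the divided difference cannot vanish.\<close>

lemma cauchy_transform_inj_on_large:
  assumes B: "0 < B" "AE t in M. \<bar>t\<bar> \<le> B"
  shows "inj_on (cauchy_transform M) {z::complex. 8 * B < cmod z}"
proof (rule inj_onI, rule ccontr)
  fix z w :: complex
  assume zw: "z \<in> {z. 8 * B < cmod z}" "w \<in> {z. 8 * B < cmod z}"
    and eq: "cauchy_transform M z = cauchy_transform M w" and ne: "z \<noteq> w"
  have g: "gap M z (7 * B)" "gap M w (7 * B)"
    using zw B gap_mono[OF gap_bounded[OF B(2)], of _ "7 * B"] by auto
  have z0: "inv_prod M z w = 0" using cauchy_transform_diff[OF g] eq ne by simp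
  have int: "integrable M (\<lambda>t. z * w * (1 / ((z - of_real t) * (w - of_real t))))"
    by (rule integrable_mult_right[OF gap_integrable_prod[OF g]])
  have "z * w * inv_prod M z w - 1 = (LINT t|M. z * w * (1 / ((z - of_real t) * (w - of_real t))) - 1)"
    unfolding inv_prod_def using int prob_space
    by (subst Bochner_Integration.integral_diff) (simp_all only: integral_mult_right_zero integrable_const, simp)
  then have "cmod (z * w * inv_prod M z w - 1) \<le> (LINT t|M. norm (z * w * (1 / ((z - of_real t) * (w - of_real t))) - 1))"
    by (simp only:) (rule integral_norm_bound)
  also have "\<dots> \<le> (LINT t|M. 1 / 2)"
  proof (rule integral_mono_AE)
    show "integrable M (\<lambda>t. norm (z * w * (1 / ((z - of_real t) * (w - of_real t))) - 1))"
      using int by (intro integrable_norm Bochner_Integration.integrable_diff) auto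
    show "AE t in M. norm (z * w * (1 / ((z - of_real t) * (w - of_real t))) - 1) \<le> 1 / 2"
      using gap_AE[OF g(1)] gap_AE[OF g(2)] B(2)
    proof eventually_elim
      case (elim t)
      define a b where "a = z - of_real t" and "b = w - of_real t"
      have ab: "7 * B \<le> cmod a" "7 * B \<le> cmod b" using elim by (auto simp: a_def b_def)
      then have nz: "a \<noteq> 0" "b \<noteq> 0" using B by auto
      have zw: "z = a + of_real t" "w = b + of_real t" by (auto simp: a_def b_def)
      have le: "cmod (of_real t / a) \<le> 1 / 7" "cmod (of_real t / b) \<le> 1 / 7"
      proof -
        have "7 * \<bar>t\<bar> \<le> cmod a" "7 * \<bar>t\<bar> \<le> cmod b" using ab elim by linarith+
        then show "cmod (of_real t / a) \<le> 1 / 7" "cmod (of_real t / b) \<le> 1 / 7"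
          using nz by (simp_all add: norm_divide divide_le_eq)
      qed
      have "z * w * (1 / (a * b)) - 1 = of_real t / a + of_real t / b + (of_real t / a) * (of_real t / b)"
        unfolding zw using nz by (simp add: field_simps)
      also have "cmod \<dots> \<le> cmod (of_real t / a) + cmod (of_real t / b) + cmod (of_real t / a) * cmod (of_real t / b)"
        by (metis norm_mult norm_triangle_le norm_triangle_ineq add_right_mono)
      also have "\<dots> \<le> 1 / 7 + 1 / 7 + 1 / 7 * (1 / 7)"
        using le by (intro add_mono mult_mono) auto
      also have "\<dots> \<le> 1 / 2" by simp
      finally show ?case by (simp add: a_def b_def)
    qed
  qed auto
  finally show False using z0 prob_space by simp
qed

text \<open>z g(z) differs from 1 by O(B / |z|), and 1 / g(z) - z = -z (z g(z) - 1) / (z g(z)). The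
  factor z cancels the decay and leaves a bound independent of z.\<close>

lemma inverse_cauchy_transform_near:
  assumes B: "0 < B" "AE t in M. \<bar>t\<bar> \<le> B" and z: "8 * B < cmod z"
  shows "cmod (1 / cauchy_transform M z - z) \<le> 4 * B"
proof -
  have g: "gap M z (cmod z - B)" using z B gap_bounded[OF B(2)] by simp
  have z0: "z \<noteq> 0" using z B by auto
  have int: "integrable M (\<lambda>t. z * (1 / (z - of_real t)))"
    by (rule integrable_mult_right[OF gap_integrable[OF g]])
  have "z * cauchy_transform M z - 1 = (LINT t|M. z * (1 / (z - of_real t)) - 1)"
    unfolding cauchy_transform_def using int prob_space
    by (subst Bochner_Integration.integral_diff) (simp_all only: integral_mult_right_zero integrable_const, simp)
  then have "cmod (z * cauchy_transform M z - 1) \<le> (LINT t|M. norm (z * (1 / (z - of_real t)) - 1))"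
    by (simp only:) (rule integral_norm_bound)
  also have "\<dots> \<le> (LINT t|M. 2 * B / cmod z)"
  proof (rule integral_mono_AE)
    show "integrable M (\<lambda>t. norm (z * (1 / (z - of_real t)) - 1))"
      using int by (intro integrable_norm Bochner_Integration.integrable_diff) auto
    show "AE t in M. norm (z * (1 / (z - of_real t)) - 1) \<le> 2 * B / cmod z"
      using gap_AE[OF g] B(2)
    proof eventually_elim
      case (elim t)
      have h: "cmod z \<le> 2 * cmod (z - of_real t)" using elim z B by linarith
      then have nz: "z - of_real t \<noteq> 0" using z0 by auto
      have "z * (1 / (z - of_real t)) - 1 = of_real t / (z - of_real t)"
        using nz by (simp add: field_simps)
      then have "norm (z * (1 / (z - of_real t)) - 1) = \<bar>t\<bar> / cmod (z - of_real t)"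
        by (simp add: norm_divide)
      also have "\<dots> \<le> B / (cmod z / 2)"
        using elim h z0 by (intro frac_le) auto
      finally show ?case by (simp add: mult.commute)
    qed
  qed auto
  finally have le: "cmod (z * cauchy_transform M z - 1) \<le> 2 * B / cmod z" using prob_space by simp
  also have "\<dots> \<le> 1 / 2" using z B z0 by (simp add: field_simps)
  finally have half: "cmod (z * cauchy_transform M z - 1) \<le> 1 / 2" .
  have "1 - cmod (z * cauchy_transform M z) \<le> cmod (z * cauchy_transform M z - 1)"
    using norm_triangle_ineq2[of 1 "z * cauchy_transform M z"] by (simp add: norm_minus_commute)
  then have ge: "1 / 2 \<le> cmod (z * cauchy_transform M z)" using half by linarith
  then have c0: "cauchy_transform M z \<noteq> 0" by auto
  have "1 / cauchy_transform M z - z = - z * (z * cauchy_transform M z - 1) / (z * cauchy_transform M z)"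
    using c0 z0 by (simp add: field_simps)
  then have "cmod (1 / cauchy_transform M z - z)
      = cmod z * cmod (z * cauchy_transform M z - 1) / cmod (z * cauchy_transform M z)"
    by (simp only: norm_divide norm_mult norm_minus_cancel)
  also have "\<dots> \<le> cmod z * (2 * B / cmod z) / (1 / 2)"
    using le ge B by (intro frac_le mult_left_mono mult_nonneg_nonneg) auto
  also have "\<dots> = 4 * B" using z0 by simp
  finally show ?thesis .
qed

text \<open>g(z) = w means 1 / g(z) = c with c = 1 / w, so z is a fixed point of c + z - 1 / g(z),
  which maps the ball of radius 4 B around c to itself by
  \<open>inverse_cauchy_transform_near\<close>. The opening 1 / 2 and the extra height 16 B keep
  this ball inside the angle of opening 1: |Re z| < Im c / 2 + 4 B \<le> Im c - 4 B \<le> Im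
  z.\<close>

lemma cauchy_transform_covers_angle:
  assumes B: "0 < B" "AE t in M. \<bar>t\<bar> \<le> B" and \<beta>: "8 * B \<le> \<beta>"
    and w: "1 / w \<in> truncated_angle (1 / 2) (\<beta> + 16 * B)"
  shows "w \<in> cauchy_transform M ` truncated_angle 1 \<beta>"
proof -
  define c where "c = 1 / w"
  have c: "\<bar>Re c\<bar> < Im c / 2" "\<beta> + 16 * B < Im c"
    using w unfolding c_def[symmetric] by (auto simp: truncated_angle_def)
  have sub: "z \<in> truncated_angle 1 \<beta>" "8 * B < cmod z" "0 < Im z" if "z \<in> cball c (4 * B)" for z
  proof -
    have d: "cmod (z - c) \<le> 4 * B" using that by (simp add: dist_norm norm_minus_commute)
    have "\<bar>Re z - Re c\<bar> \<le> 4 * B" "\<bar>Im z - Im c\<bar> \<le> 4 * B"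
      using abs_Re_le_cmod[of "z - c"] abs_Im_le_cmod[of "z - c"] d by simp_all
    then have "\<bar>Re z\<bar> < Im z" "\<beta> < Im z" using c B(1) \<beta> by linarith+
    then show "z \<in> truncated_angle 1 \<beta>" "8 * B < cmod z" "0 < Im z"
      using abs_Im_le_cmod[of z] \<beta> B by (auto simp: truncated_angle_def)
  qed
  have "continuous_on (cball c (4 * B)) (cauchy_transform M)"
    by (rule holomorphic_on_imp_continuous_on, rule holomorphic_on_subset[OF cauchy_transform_holomorphic_upper])
      (use sub in auto)
  then have cont: "continuous_on (cball c (4 * B)) (\<lambda>z. c + z - 1 / cauchy_transform M z)"
    using sub(3) cauchy_transform_nonzero by (intro continuous_intros) auto
  have "(\<lambda>z. c + z - 1 / cauchy_transform M z) \<in> cball c (4 * B) \<rightarrow> cball c (4 * B)"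
  proof
    fix z assume "z \<in> cball c (4 * B)"
    then have "cmod (1 / cauchy_transform M z - z) \<le> 4 * B"
      using sub(2) by (intro inverse_cauchy_transform_near[OF B]) auto
    then show "c + z - 1 / cauchy_transform M z \<in> cball c (4 * B)"
      by (simp add: dist_norm algebra_simps)
  qed
  then obtain z where z: "z \<in> cball c (4 * B)" "c + z - 1 / cauchy_transform M z = z"
    using brouwer_ball[OF _ cont] B by auto
  have "c \<noteq> 0" using c B \<beta> by auto
  moreover have "1 / cauchy_transform M z = c" using z(2) by (simp add: algebra_simps)
  ultimately have "cauchy_transform M z = w" by (auto simp: c_def field_simps)
  then show ?thesis using sub(1)[OF z(1)] by blast
qed

end

lemma AE_abs_le_mono:
  fixes \<rho> :: "real measure"
  shows "AE t in \<rho>. \<bar>t\<bar> \<le> B \<Longrightarrow> B \<le> C \<Longrightarrow> AE t in \<rho>. \<bar>t\<bar> \<le> C"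
  by (auto elim!: eventually_mono)

lemma the_inv_into_image:
  assumes "inj_on f D" "\<Gamma> \<subseteq> f ` D" "w \<in> \<Gamma>"
  shows "the_inv_into D f w \<in> D" "f (the_inv_into D f w) = w"
  using assms by (auto intro!: the_inv_into_into f_the_inv_into_f)

text \<open>The R-transform of the semicircle is \<sigma>^2 w. The quadratic equation is linear in
  z, so no branch of a square root has to be chosen.\<close>

lemma cauchy_transform_semicircle_inverse:
  assumes "0 < \<sigma>" "0 < Im z" "cauchy_transform (semicircle \<sigma>) z = w"
  shows "z = 1 / w + of_real (\<sigma>\<^sup>2) * w"
proof -
  have "w \<noteq> 0"
    using real_distribution.cauchy_transform_nonzero[OF real_distribution_semicircle[OF assms(1)] assms(2)] assms(3) by simp
  moreover have "of_real (\<sigma>\<^sup>2) * w\<^sup>2 - z * w + 1 = 0"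
    using cauchy_transform_semicircle[OF assms(1,2)] assms(3) by simp
  then have "z * w = of_real (\<sigma>\<^sup>2) * w\<^sup>2 + 1" by (simp add: algebra_simps)
  ultimately show ?thesis by (simp add: field_simps power2_eq_square)
qed

text \<open>All three laws live in [-C, C], so one angle at height 8 C serves them together.
  Additivity of the R-transforms then amounts to z - \<sigma>^2 w being the preimage of w under
  g_\<tau>.\<close>

lemma subordinate_imp_is_free_convolution:
  assumes s: "0 < \<sigma>" and \<tau>: "real_distribution \<tau>" "AE t in \<tau>. \<bar>t\<bar> \<le> B"
    and \<kappa>: "real_distribution \<kappa>" "AE t in \<kappa>. \<bar>t\<bar> \<le> B" and sub: "subordinate \<sigma> \<tau> \<kappa>"
  shows "is_free_convolution (semicircle \<sigma>) \<tau> \<kappa>"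
proof -
  define C where "C = max B (2 * \<sigma>)"
  have C: "0 < C" using s by (simp add: C_def)
  define D \<Gamma> where "D = truncated_angle 1 (8 * C)" and "\<Gamma> = {w. 1 / w \<in> truncated_angle (1/2) (8 * C + 16 * C)}"
  have all: "real_distribution \<rho> \<and> (AE t in \<rho>. \<bar>t\<bar> \<le> C)" if "\<rho> \<in> {semicircle \<sigma>, \<tau>, \<kappa>}" for \<rho>
    using that real_distribution_semicircle[OF s] \<tau> \<kappa> AE_abs_le_mono[OF AE_semicircle, of \<sigma> C]
      AE_abs_le_mono[OF \<tau>(2), of C] AE_abs_le_mono[OF \<kappa>(2), of C] by (auto simp: C_def)
  have Dsub: "D \<subseteq> {z. 8 * C < cmod z}"
  proof
    fix z assume "z \<in> D"
    then show "z \<in> {z. 8 * C < cmod z}"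
      using abs_Im_le_cmod[of z] by (auto simp: D_def truncated_angle_def)
  qed
  have large: "inj_on (cauchy_transform \<rho>) {z::complex. 8 * C < cmod z}" if "\<rho> \<in> {semicircle \<sigma>, \<tau>, \<kappa>}" for \<rho>
    using real_distribution.cauchy_transform_inj_on_large[of \<rho> C] all[OF that] C by auto
  have inj: "inj_on (cauchy_transform \<rho>) D" if "\<rho> \<in> {semicircle \<sigma>, \<tau>, \<kappa>}" for \<rho>
    using inj_on_subset[OF large[OF that] Dsub] .
  have im: "\<Gamma> \<subseteq> cauchy_transform \<rho> ` D" if "\<rho> \<in> {semicircle \<sigma>, \<tau>, \<kappa>}" for \<rho>
    using real_distribution.cauchy_transform_covers_angle[of \<rho> C "8 * C"] all[OF that] C
    by (auto simp: \<Gamma>_def D_def)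
  have R: "R_transform D \<kappa> w = R_transform D (semicircle \<sigma>) w + R_transform D \<tau> w" if w: "w \<in> \<Gamma>" for w
  proof -
    define z v u where "z = the_inv_into D (cauchy_transform \<kappa>) w"
      and "v = the_inv_into D (cauchy_transform \<tau>) w"
      and "u = the_inv_into D (cauchy_transform (semicircle \<sigma>)) w"
    have z: "z \<in> D" "cauchy_transform \<kappa> z = w" and v: "v \<in> D" "cauchy_transform \<tau> v = w"
      and u: "u \<in> D" "cauchy_transform (semicircle \<sigma>) u = w"
      unfolding z_def v_def u_def using the_inv_into_image[OF inj im w] by blast+
    have Im: "0 < Im z" "0 < Im u" using z u C in_truncated_angleD by (auto simp: D_def)
    have u': "u = 1 / w + of_real (\<sigma>\<^sup>2) * w"
      by (rule cauchy_transform_semicircle_inverse[OF s Im(2) u(2)])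
    \<comment> \<open>\<open>y\<close> need not lie in the angle \<open>D\<close>; it is identified
      with \<open>v\<close> by injectivity outside the disc of radius 8 C.\<close>
    define y where "y = z - of_real (\<sigma>\<^sup>2) * w"
    have "8 * C < Im z" using z by (simp add: D_def truncated_angle_def)
    then have "8 * C < Im y"
      using real_distribution.Im_subordination_ge[OF \<kappa>(1) Im(1), of \<sigma>] z(2) by (simp add: y_def)
    then have "8 * C < cmod y" using abs_Im_le_cmod[of y] by linarith
    moreover have "cauchy_transform \<tau> y = cauchy_transform \<tau> v"
      using sub Im(1) z(2) v(2) by (auto simp: subordinate_def y_def)
    ultimately have "y = v"
      using inj_onD[OF large[of \<tau>]] v(1) Dsub by blast
    then show ?thesis
      unfolding R_transform_def z_def[symmetric] v_def[symmetric] u_def[symmetric] u'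
      by (simp add: y_def algebra_simps)
  qed
  show ?thesis
    unfolding is_free_convolution_def Let_def
    apply (rule conjI[OF \<kappa>(1)])
    apply (rule exI[of _ 1], rule conjI, simp)
    apply (rule exI[of _ "8 * C"], rule conjI, simp add: C)
    apply (rule exI[of _ "1 / 2"], rule conjI, simp)
    apply (rule exI[of _ "8 * C + 16 * C"], rule conjI, simp add: C)
    using inj im R unfolding D_def \<Gamma>_def by blast
qed

lemma truncated_angle_open: "open (truncated_angle \<alpha> \<beta>)"
proof -
  have "truncated_angle \<alpha> \<beta> = {z. \<bar>Re z\<bar> < \<alpha> * Im z} \<inter> {z. \<beta> < Im z}"
    by (auto simp: truncated_angle_def)
  also have "open \<dots>" by (intro open_Int open_Collect_less continuous_intros)
  finally show ?thesis .
qed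

text \<open>The R-transform relation of the competitor \<mu> is available only at those z in
  \<open>D\<close> that g_\<mu> maps into \<Gamma>. They form a nonempty open set on which the
  injectivity of H_\<tau> forces g_\<mu> = g_\<kappa>, and the identity theorem does the
  rest.\<close>

lemma subordinate_imp_free_convolution_unique:
  assumes s: "0 < \<sigma>" and \<tau>: "real_distribution \<tau>" and \<kappa>: "real_distribution \<kappa>"
    and sub: "subordinate \<sigma> \<tau> \<kappa>" and free: "is_free_convolution (semicircle \<sigma>) \<tau> \<mu>"
  shows "\<mu> = \<kappa>"
proof -
  have \<mu>: "real_distribution \<mu>" using free by (simp add: is_free_convolution_def)
  obtain \<alpha> \<beta> \<alpha>' \<beta>' where pos: "0 < \<alpha>" "0 < \<beta>" "0 < \<alpha>'" "0 < \<beta>'"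
    and inj: "\<And>\<rho>. \<rho> \<in> {semicircle \<sigma>, \<tau>, \<mu>} \<Longrightarrow> inj_on (cauchy_transform \<rho>) (truncated_angle \<alpha> \<beta>)"
    and im: "\<And>\<rho>. \<rho> \<in> {semicircle \<sigma>, \<tau>, \<mu>} \<Longrightarrow>
      {w. 1 / w \<in> truncated_angle \<alpha>' \<beta>'} \<subseteq> cauchy_transform \<rho> ` truncated_angle \<alpha> \<beta>"
    and R: "\<And>w. 1 / w \<in> truncated_angle \<alpha>' \<beta>' \<Longrightarrow> R_transform (truncated_angle \<alpha> \<beta>) \<mu> w =
      R_transform (truncated_angle \<alpha> \<beta>) (semicircle \<sigma>) w + R_transform (truncated_angle \<alpha> \<beta>) \<tau> w"
    using free unfolding is_free_convolution_def Let_def by blast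
  define D \<Gamma> where "D = truncated_angle \<alpha> \<beta>" and "\<Gamma> = {w. 1 / w \<in> truncated_angle \<alpha>' \<beta>'}"
  have inj': "inj_on (cauchy_transform \<rho>) D" and im': "\<Gamma> \<subseteq> cauchy_transform \<rho> ` D"
    if "\<rho> \<in> {semicircle \<sigma>, \<tau>, \<mu>}" for \<rho>
    using inj[OF that] im[OF that] by (auto simp: D_def \<Gamma>_def)
  have Dup: "0 < Im z" if "z \<in> D" for z using that pos in_truncated_angleD by (auto simp: D_def)
  define S where "S = {z \<in> D. cauchy_transform \<mu> z \<in> \<Gamma>}"
  have Seq: "cauchy_transform \<mu> z = cauchy_transform \<kappa> z" if z: "z \<in> S" for z
  proof -
    define w where "w = cauchy_transform \<mu> z"
    have w: "w \<in> \<Gamma>" and zD: "z \<in> D" using z by (auto simp: S_def w_def)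
    define v u where "v = the_inv_into D (cauchy_transform \<tau>) w"
      and "u = the_inv_into D (cauchy_transform (semicircle \<sigma>)) w"
    have v: "v \<in> D" "cauchy_transform \<tau> v = w"
      and u: "u \<in> D" "cauchy_transform (semicircle \<sigma>) u = w"
      unfolding v_def u_def using the_inv_into_image[OF inj' im' w] by blast+
    have z': "the_inv_into D (cauchy_transform \<mu>) w = z"
      unfolding w_def by (rule the_inv_into_f_f[OF inj' zD]) simp
    have u': "u = 1 / w + of_real (\<sigma>\<^sup>2) * w"
      by (rule cauchy_transform_semicircle_inverse[OF s Dup[OF u(1)] u(2)])
    have "R_transform D \<mu> w = R_transform D (semicircle \<sigma>) w + R_transform D \<tau> w"
      using R w by (simp add: D_def \<Gamma>_def)
    then have zv: "z = v + of_real (\<sigma>\<^sup>2) * w"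
      unfolding R_transform_def z' v_def[symmetric] u_def[symmetric] u' by (simp add: algebra_simps)
    then have Hv: "H_map \<sigma> \<tau> v = z" using v(2) by (simp add: H_map_def)
    define y where "y = z - of_real (\<sigma>\<^sup>2) * cauchy_transform \<kappa> z"
    have y: "0 < Im y" using real_distribution.Im_subordination_ge[OF \<kappa> Dup[OF zD], of \<sigma>] Dup[OF zD]
      by (simp add: y_def)
    have "cauchy_transform \<tau> y = cauchy_transform \<kappa> z"
      using sub Dup[OF zD] by (simp add: subordinate_def y_def)
    then have Hy: "H_map \<sigma> \<tau> y = z" by (simp add: H_map_def y_def)
    \<comment> \<open>z = H(v) comes from the R-transforms of \<mu>, z = H(y) from the subordination
      of \<kappa>.\<close>
    have "y = v"
      by (rule real_distribution.H_map_inj_upper[OF \<tau> y Dup[OF v(1)], of \<sigma>])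
        (use Hv Hy Dup[OF zD] in auto)
    have "of_real (\<sigma>\<^sup>2) * cauchy_transform \<kappa> z = z - y" by (simp add: y_def)
    also have "\<dots> = of_real (\<sigma>\<^sup>2) * w" unfolding \<open>y = v\<close> zv by simp
    finally have "of_real (\<sigma>\<^sup>2) * cauchy_transform \<kappa> z = of_real (\<sigma>\<^sup>2) * w" .
    then have "cauchy_transform \<kappa> z = w" using s by simp
    then show ?thesis by (simp only: w_def)
  qed
  have opS: "open S"
  proof -
    have "S = D \<inter> (\<lambda>z. 1 / cauchy_transform \<mu> z) -` truncated_angle \<alpha>' \<beta>'"
      by (auto simp: S_def \<Gamma>_def)
    moreover have "continuous_on D (\<lambda>z. 1 / cauchy_transform \<mu> z)"
    proof (intro continuous_intros)
      show "continuous_on D (cauchy_transform \<mu>)"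
        using Dup by (intro holomorphic_on_imp_continuous_on
            holomorphic_on_subset[OF real_distribution.cauchy_transform_holomorphic_upper[OF \<mu>]]) auto
      show "\<forall>z\<in>D. cauchy_transform \<mu> z \<noteq> 0"
        using Dup real_distribution.cauchy_transform_nonzero[OF \<mu>] by blast
    qed
    ultimately show ?thesis
      using continuous_open_preimage[of D "\<lambda>z. 1 / cauchy_transform \<mu> z" "truncated_angle \<alpha>' \<beta>'"]
      by (simp add: truncated_angle_open D_def)
  qed
  have neS: "S \<noteq> {}"
  proof -
    \<comment> \<open>The reciprocal of a point on the axis of the angle.\<close>
    define w where "w = 1 / Complex 0 (\<beta>' + 1)"
    have "w \<in> \<Gamma>" using pos by (simp add: \<Gamma>_def w_def truncated_angle_def)
    then show ?thesis using the_inv_into_image[OF inj'[of \<mu>] im'[of \<mu>], of w] by (auto simp: S_def)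
  qed
  have "cauchy_transform \<mu> z = cauchy_transform \<kappa> z" if "0 < Im z" for z
  proof (rule analytic_continuation_open[where s = S and s' = "{z. 0 < Im z}" and f = "cauchy_transform \<mu>" and g = "cauchy_transform \<kappa>"])
    show "open {z. 0 < Im z}" by (simp add: open_halfspace_Im_gt)
    show "connected {z. 0 < Im z}" by (simp add: convex_connected convex_halfspace_Im_gt)
    show "S \<subseteq> {z. 0 < Im z}" using Dup by (auto simp: S_def)
    show "cauchy_transform \<mu> holomorphic_on {z. 0 < Im z}" "cauchy_transform \<kappa> holomorphic_on {z. 0 < Im z}"
      using real_distribution.cauchy_transform_holomorphic_upper \<mu> \<kappa> by blast+
  qed (use opS neS Seq that in simp_all)
  then show ?thesis by (intro cauchy_transform_inj[OF \<mu> \<kappa>])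
qed

text \<open>From here on the definite description is not unfolded again; only
  \<open>subordinate\<close> is used.\<close>

theorem free_convolution_semicircle_eq:
  assumes "0 < \<sigma>" "real_distribution \<tau>" "AE t in \<tau>. \<bar>t\<bar> \<le> B"
    "real_distribution \<kappa>" "AE t in \<kappa>. \<bar>t\<bar> \<le> B" "subordinate \<sigma> \<tau> \<kappa>"
  shows "semicircle \<sigma> \<boxplus> \<tau> = \<kappa>"
  unfolding free_convolution_def
proof (rule the_equality)
  show "is_free_convolution (semicircle \<sigma>) \<tau> \<kappa>"
    by (rule subordinate_imp_is_free_convolution[OF assms])
  show "\<mu> = \<kappa>" if "is_free_convolution (semicircle \<sigma>) \<tau> \<mu>" for \<mu>
    by (rule subordinate_imp_free_convolution_unique[OF assms(1,2,4,6) that])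
qed

section \<open>Composition of Cauchy transforms of finitely supported measures\<close>

definition linear_product :: "complex set \<Rightarrow> complex poly" where
  "linear_product A = (\<Prod>a\<in>A. [:-a, 1:])"

lemma poly_linear_product: "poly (linear_product A) z = (\<Prod>a\<in>A. z - a)"
  by (simp add: linear_product_def poly_prod)

lemma poly_linear_product_eq_0_iff: "finite A \<Longrightarrow> poly (linear_product A) z = 0 \<longleftrightarrow> z \<in> A"
  by (auto simp: poly_linear_product)

lemma degree_linear_product: "degree (linear_product A) = card A"
  by (simp add: linear_product_def degree_prod_sum_eq)

lemma lead_coeff_linear_product: "lead_coeff (linear_product A) = 1"
  by (simp add: linear_product_def lead_coeff_prod)

lemma linear_product_remove:
  "finite A \<Longrightarrow> a \<in> A \<Longrightarrow> linear_product A = [:-a, 1:] * linear_product (A - {a})"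
  unfolding linear_product_def by (rule prod.remove)

lemma poly_linear_product_remove:
  assumes "finite A" "a \<in> A"
  shows "poly (linear_product A) z = (z - a) * poly (linear_product (A - {a})) z"
  by (subst linear_product_remove[OF assms]) (simp add: algebra_simps)

text \<open>The partial fraction decomposition of \<open>1 / f\<close>: the zeros of \<open>f\<close> are real because \<open>Im f\<close> has
  the sign of \<open>Im z\<close>, and simple with positive residues \<open>1 / f'\<close> because \<open>f' > 0\<close> on the real line
  (\<open>h\<close> below is \<open>f'\<close>). Their sum is read off the leading coefficients.\<close>

lemma reciprocal_partial_fractions:
  fixes X :: "complex set" and w :: "complex \<Rightarrow> real" and c \<gamma> :: real
  assumes X: "finite X" "X \<noteq> {}" "X \<subseteq> \<real>" and w: "\<And>x. x \<in> X \<Longrightarrow> 0 < w x" and c: "0 < c"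
  defines "f \<equiv> \<lambda>z. z - of_real \<gamma> - of_real c * (\<Sum>x\<in>X. of_real (w x) / (z - x))"
  shows "\<exists>Y v. finite Y \<and> Y \<subseteq> \<real> \<and> (\<forall>s\<in>Y. s \<notin> X \<and> f s = 0 \<and> 0 < (v s :: real)) \<and> (\<Sum>s\<in>Y. v s) = 1 \<and>
    (\<forall>z. z \<notin> X \<longrightarrow> z \<notin> Y \<longrightarrow> (\<Sum>s\<in>Y. of_real (v s) / (z - s)) * f z = 1)"
proof -
  define n where "n = card X"
  have n: "0 < n" using X by (simp add: n_def card_gt_0_iff)
  define P where "P = linear_product X"
  define Pm where "Pm x = linear_product (X - {x})" for x
  define R where "R = (\<Sum>x\<in>X. Polynomial.smult (of_real (w x)) (Pm x))"
  define Q where "Q = [:- of_real \<gamma>, 1:] * P - Polynomial.smult (of_real c) R"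
  have P: "degree P = n" "lead_coeff P = 1" "P \<noteq> 0"
    using lead_coeff_linear_product[of X] by (auto simp: P_def n_def degree_linear_product)
  have Pm: "poly P z = (z - x) * poly (Pm x) z" if "x \<in> X" for x z
    using poly_linear_product_remove[OF X(1) that] by (simp add: P_def Pm_def)
  have Pnz: "poly P z \<noteq> 0" if "z \<notin> X" for z
    using that X by (simp add: P_def poly_linear_product_eq_0_iff)
  have degPm: "degree (Pm x) < n" if "x \<in> X" for x
    using that X n by (simp add: Pm_def degree_linear_product n_def)
  have Rsum: "(\<Sum>x\<in>X. of_real (a x) * poly (Pm x) z) = poly P z * (\<Sum>x\<in>X. of_real (a x) / (z - x))"
    if "z \<notin> X" for z :: complex and a :: "complex \<Rightarrow> real"
    unfolding sum_distrib_left
  proof (rule sum.cong)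
    fix x assume x: "x \<in> X"
    then have "z - x \<noteq> 0" using that by auto
    then show "of_real (a x) * poly (Pm x) z = poly P z * (of_real (a x) / (z - x))"
      using Pm[OF x, of z] by simp
  qed simp
  have Qf: "poly Q z = poly P z * f z" if "z \<notin> X" for z
    using Rsum[OF that, of w] by (simp add: Q_def R_def f_def poly_sum algebra_simps)
  have degR: "degree (Polynomial.smult (of_real c) R) < n"
    unfolding R_def using degPm n
    by (intro le_less_trans[OF degree_smult_le] degree_sum_less) (auto intro: le_less_trans[OF degree_smult_le])
  have degL: "degree ([:- of_real \<gamma>, 1:] * P) = Suc n"
    using P by (subst degree_mult_eq) auto
  have degQ: "degree Q = Suc n"
    unfolding Q_def diff_conv_add_uminus using degL degR by (subst degree_add_eq_left) auto
  have lcQ: "lead_coeff Q = 1"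
  proof -
    have "Polynomial.coeff Q (Suc n) = Polynomial.coeff ([:- of_real \<gamma>, 1:] * P) (Suc n)"
      unfolding Q_def Polynomial.coeff_diff
      using Polynomial.coeff_eq_0[of "Polynomial.smult (of_real c) R" "Suc n"] degR by (simp del: Polynomial.coeff_smult)
    also have "\<dots> = lead_coeff ([:- of_real \<gamma>, 1:] * P)" by (simp only: degL)
    also have "\<dots> = 1" using P by (simp only: lead_coeff_mult) simp
    finally show ?thesis by (simp add: degQ)
  qed
  then have Q0: "Q \<noteq> 0" by auto
  \<comment> \<open>At a pole s of f only the summand of s survives in \<open>R\<close>, so Q(s) =
    -c w(s) \<open>poly (Pm s) s\<close> is nonzero.\<close>
  have rootX: "s \<notin> X" if "poly Q s = 0" for s
  proof
    assume s: "s \<in> X"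
    have "poly R s = (\<Sum>x\<in>X. of_real (w x) * poly (Pm x) s)" by (simp add: R_def poly_sum)
    also have "\<dots> = (\<Sum>x\<in>{s}. of_real (w x) * poly (Pm x) s)"
    proof (rule sum.mono_neutral_right)
      show "\<forall>x\<in>X - {s}. of_real (w x) * poly (Pm x) s = 0"
        using s X by (auto simp: Pm_def poly_linear_product_eq_0_iff)
    qed (use X s in auto)
    finally have "poly R s = of_real (w s) * poly (Pm s) s" by simp
    moreover have "poly (Pm s) s \<noteq> 0" using X by (simp add: Pm_def poly_linear_product_eq_0_iff)
    moreover have "poly P s = 0" using Pm[OF s, of s] by simp
    ultimately show False using that w[OF s] c by (simp add: Q_def)
  qed
  have rootf: "f s = 0" if "poly Q s = 0" for s
    using Qf[OF rootX[OF that]] Pnz[OF rootX[OF that]] that by simp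
  have real: "s \<in> \<real>" if "poly Q s = 0" for s
  proof -
    have "Im (of_real (w x) / (s - x)) = - Im s * (w x / (cmod (s - x))\<^sup>2)" if "x \<in> X" for x
    proof -
      have "Im x = 0" using X(3) that by (auto simp: complex_is_Real_iff)
      then show ?thesis by (simp add: Im_divide cmod_def)
    qed
    then have "Im (\<Sum>x\<in>X. of_real (w x) / (s - x)) = - Im s * (\<Sum>x\<in>X. w x / (cmod (s - x))\<^sup>2)"
      by (simp add: sum_distrib_left)
    then have "Im (f s) = Im s * (1 + c * (\<Sum>x\<in>X. w x / (cmod (s - x))\<^sup>2))"
      by (simp add: f_def algebra_simps)
    moreover have "0 < 1 + c * (\<Sum>x\<in>X. w x / (cmod (s - x))\<^sup>2)"
      using c w by (intro add_pos_nonneg mult_nonneg_nonneg sum_nonneg) (auto simp: less_imp_le)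
    ultimately show ?thesis using rootf[OF that] by (simp add: complex_is_Real_iff)
  qed
  define h where "h s = 1 + c * (\<Sum>x\<in>X. w x / (Re s - Re x)\<^sup>2)" for s
  have hpos: "0 < h s" for s
    unfolding h_def using c w by (intro add_pos_nonneg mult_nonneg_nonneg sum_nonneg) (auto simp: less_imp_le)
  have "\<exists>T. Q = [:-s, 1:] * T \<and> poly T s = poly P s * of_real (h s)" if s: "poly Q s = 0" for s
  proof (intro exI conjI)
    \<comment> \<open>This is P(z) (f(z) - f(s)) / (z - s): the divided difference of 1 / (z - x) at
      z and s is -1 / ((s - x) (z - x)).\<close>
    define T where "T = P + Polynomial.smult (of_real c) (\<Sum>x\<in>X. Polynomial.smult (of_real (w x) / (s - x)) (Pm x))"
    have sX: "s \<notin> X" by (rule rootX[OF s])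
    have T: "poly T z = poly P z + of_real c * (\<Sum>x\<in>X. of_real (w x) / (s - x) * poly (Pm x) z)" for z
      by (simp add: T_def poly_sum)
    have "poly Q z = poly ([:-s, 1:] * T) z" for z
    proof -
      have "(z - s) * (of_real (w x) / (s - x) * poly (Pm x) z)
          = of_real (w x) / (s - x) * poly P z - of_real (w x) * poly (Pm x) z" if x: "x \<in> X" for x
      proof -
        define W where "W = of_real (w x) / (s - x)"
        have "s - x \<noteq> 0" using sX x by auto
        then have wW: "of_real (w x) = W * (s - x)" by (simp add: W_def)
        show ?thesis unfolding W_def[symmetric] unfolding Pm[OF x, of z] unfolding wW by (simp add: algebra_simps)
      qed
      then have 2: "(z - s) * (\<Sum>x\<in>X. of_real (w x) / (s - x) * poly (Pm x) z)
          = (\<Sum>x\<in>X. of_real (w x) / (s - x)) * poly P z - poly R z"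
        by (simp add: sum_distrib_left sum_distrib_right sum_subtractf R_def poly_sum)
      have 3: "of_real c * (\<Sum>x\<in>X. of_real (w x) / (s - x)) = s - of_real \<gamma>"
        using rootf[OF s] by (simp add: f_def)
      have 1: "of_real c * ((z - s) * (\<Sum>x\<in>X. of_real (w x) / (s - x) * poly (Pm x) z))
          = (s - of_real \<gamma>) * poly P z - of_real c * poly R z"
        unfolding 2 3[symmetric] by (simp only: right_diff_distrib mult.assoc)
      have "poly ([:-s, 1:] * T) z = (z - s) * poly P z
          + of_real c * ((z - s) * (\<Sum>x\<in>X. of_real (w x) / (s - x) * poly (Pm x) z))"
        unfolding poly_mult T by (simp add: algebra_simps)
      also have "\<dots> = (z - of_real \<gamma>) * poly P z - of_real c * poly R z"
        unfolding 1 by (simp add: algebra_simps)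
      also have "\<dots> = poly Q z"
        by (simp add: Q_def algebra_simps)
      finally show ?thesis ..
    qed
    then have "poly Q = poly ([:-s, 1:] * T)" by (rule ext)
    then show "Q = [:-s, 1:] * T" by (simp only: poly_eq_poly_eq_iff)
    have "of_real (w x) / (s - x) * poly (Pm x) s = poly P s * of_real (w x / (Re s - Re x)\<^sup>2)" if x: "x \<in> X" for x
    proof -
      have "s = of_real (Re s)" "x = of_real (Re x)"
        using real[OF s] X(3) x by (auto simp: complex_is_Real_iff complex_eq_iff)
      then have d: "s - x = of_real (Re s - Re x)" by (metis of_real_diff)
      moreover have "s - x \<noteq> 0" using sX x by auto
      ultimately have d0: "Re s - Re x \<noteq> 0" by auto
      show ?thesis using d0 unfolding Pm[OF x, of s] d by (simp add: power2_eq_square del: of_real_diff)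
    qed
    then show "poly T s = poly P s * of_real (h s)"
      unfolding T h_def by (simp add: sum_distrib_left algebra_simps)
  qed
  then obtain T where T: "\<And>s. poly Q s = 0 \<Longrightarrow> Q = [:-s, 1:] * T s"
    "\<And>s. poly Q s = 0 \<Longrightarrow> poly (T s) s = poly P s * of_real (h s)"
    by metis
  have Tnz: "poly (T s) s \<noteq> 0" if "poly Q s = 0" for s
    using T(2)[OF that] Pnz[OF rootX[OF that]] hpos[of s] by simp
  define Y where "Y = {s. poly Q s = 0}"
  have finY: "finite Y" unfolding Y_def by (rule poly_roots_finite[OF Q0])
  have "rsquarefree Q"
    unfolding rsquarefree_roots
  proof (intro allI notI)
    fix s assume s: "poly Q s = 0 \<and> poly (pderiv Q) s = 0"
    have "poly (pderiv ([:-s, 1:] * T s)) s = poly (T s) s"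
      by (simp only: pderiv_mult poly_add poly_mult) (simp add: pderiv_pCons)
    then have "poly (pderiv Q) s = poly (T s) s" using T(1)[OF conjunct1[OF s]] by (simp only:)
    then show False using s Tnz[OF conjunct1[OF s]] by (metis)
  qed
  from complex_poly_decompose_rsquarefree[OF this]
  have QY: "Q = linear_product Y" unfolding linear_product_def Y_def lcQ by simp
  have cardY: "card Y = Suc n" using degQ unfolding QY by (simp add: degree_linear_product)
  have TY: "T s = linear_product (Y - {s})" if "s \<in> Y" for s
  proof -
    have "[:-s, 1:] * T s = [:-s, 1:] * linear_product (Y - {s})"
    proof (rule trans)
      show "[:-s, 1:] * T s = Q"
        by (rule T(1)[symmetric]) (use that in \<open>simp add: Y_def\<close>)
      show "Q = [:-s, 1:] * linear_product (Y - {s})"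
        using linear_product_remove[OF finY that] QY by (simp only:)
    qed
    then show ?thesis by (subst (asm) mult_left_cancel) auto
  qed
  \<comment> \<open>Lagrange interpolation: both sides have degree at most n and agree at the n + 1
    points of \<open>Y\<close>. Division by Q = (z - s) \<open>T s\<close> turns this into the
    partial fractions of P / Q = 1 / f with residues 1 / h(s).\<close>
  have PT: "P = (\<Sum>s\<in>Y. Polynomial.smult (of_real (1 / h s)) (T s))"
  proof (rule poly_eqI_degree[of Y])
    fix s assume s: "s \<in> Y"
    have "poly (\<Sum>s\<in>Y. Polynomial.smult (of_real (1 / h s)) (T s)) s = (\<Sum>u\<in>Y. of_real (1 / h u) * poly (T u) s)"
      by (simp add: poly_sum)
    also have "\<dots> = (\<Sum>u\<in>{s}. of_real (1 / h u) * poly (T u) s)"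
      by (rule sum.mono_neutral_right) (use s finY in \<open>auto simp: TY poly_linear_product_eq_0_iff\<close>)
    also have "\<dots> = poly P s"
      using s T(2)[of s] hpos[of s] by (simp add: Y_def)
    finally show "poly P s = poly (\<Sum>s\<in>Y. Polynomial.smult (of_real (1 / h s)) (T s)) s" ..
  next
    show "degree P < card Y" using P cardY by simp
    show "degree (\<Sum>s\<in>Y. Polynomial.smult (of_real (1 / h s)) (T s)) < card Y"
      using cardY finY by (intro degree_sum_less)
        (auto intro!: le_less_trans[OF degree_smult_le] simp: TY degree_linear_product)
  qed
  have "(\<Sum>s\<in>Y. complex_of_real (1 / h s)) = 1"
  proof -
    have "Polynomial.coeff (T s) n = 1" if "s \<in> Y" for s
      using lead_coeff_linear_product[of "Y - {s}"] that finY cardY by (simp add: TY degree_linear_product)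
    then have "Polynomial.coeff (\<Sum>s\<in>Y. Polynomial.smult (of_real (1 / h s)) (T s)) n = (\<Sum>s\<in>Y. complex_of_real (1 / h s))"
      by (simp add: Polynomial.coeff_sum)
    then show ?thesis using P unfolding PT[symmetric] by simp
  qed
  then have "complex_of_real (\<Sum>s\<in>Y. 1 / h s) = of_real 1" by simp
  then have sum1: "(\<Sum>s\<in>Y. 1 / h s) = 1" by (simp only: of_real_eq_iff)
  have "(\<Sum>s\<in>Y. of_real (1 / h s) / (z - s)) * f z = 1" if z: "z \<notin> X" "z \<notin> Y" for z
  proof -
    have "poly (T s) z = poly Q z / (z - s)" if s: "s \<in> Y" for s
    proof -
      have "poly Q z = (z - s) * poly (T s) z"
        unfolding QY TY[OF s] by (rule poly_linear_product_remove[OF finY s])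
      moreover have "z - s \<noteq> 0" using s z by auto
      ultimately show ?thesis by simp
    qed
    then have "(\<Sum>s\<in>Y. of_real (1 / h s) * poly (T s) z) = poly Q z * (\<Sum>s\<in>Y. of_real (1 / h s) / (z - s))"
      unfolding sum_distrib_left by (intro sum.cong) auto
    moreover have "poly P z = (\<Sum>s\<in>Y. of_real (1 / h s) * poly (T s) z)"
      by (subst PT) (simp add: poly_sum)
    ultimately have "poly P z = poly P z * f z * (\<Sum>s\<in>Y. of_real (1 / h s) / (z - s))"
      using Qf[OF z(1)] by simp
    then have "poly P z * (f z * (\<Sum>s\<in>Y. of_real (1 / h s) / (z - s)) - 1) = 0"
      by (simp add: algebra_simps)
    then have "f z * (\<Sum>s\<in>Y. of_real (1 / h s) / (z - s)) - 1 = 0"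
      using Pnz[OF z(1)] by (simp only: mult_eq_0_iff) simp
    then show ?thesis by (simp add: mult.commute)
  qed
  note main = this
  show ?thesis
  proof (intro exI[of _ Y] exI[of _ "\<lambda>s. 1 / h s"] conjI ballI allI impI)
    show "finite Y" "(\<Sum>s\<in>Y. 1 / h s) = 1" by fact+
    show "Y \<subseteq> \<real>" using real by (auto simp: Y_def)
    fix s assume "s \<in> Y"
    then have "poly Q s = 0" by (simp add: Y_def)
    then show "s \<notin> X" "f s = 0" by (rule rootX, rule rootf)
    show "0 < 1 / h s" using hpos by simp
  next
    fix z assume "z \<notin> X" "z \<notin> Y"
    then show "(\<Sum>s\<in>Y. of_real (1 / h s) / (z - s)) * f z = 1" by (rule main)
  qed
qed

text \<open>\<open>measure_pmf\<close> carries the discrete sigma-algebra; the image under the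
  identity lives on \<open>borel\<close>, as \<open>real_distribution\<close> demands.\<close>

definition law :: "real pmf \<Rightarrow> real measure" where
  "law p = distr (measure_pmf p) borel (\<lambda>t. t)"

definition cauchy_pmf :: "real pmf \<Rightarrow> complex \<Rightarrow> complex" where
  "cauchy_pmf p z = measure_pmf.expectation p (\<lambda>t. 1 / (z - of_real t))"

lemma real_distribution_law: "real_distribution (law p)"
  unfolding law_def by (rule prob_space.real_distribution_distr[OF measure_pmf.prob_space_axioms]) simp

lemma cauchy_transform_law: "cauchy_transform (law p) = cauchy_pmf p"
  unfolding law_def cauchy_transform_def cauchy_pmf_def by (rule ext, subst integral_distr) auto

lemma AE_law: "(AE t in law p. P t) \<longleftrightarrow> (\<forall>t\<in>set_pmf p. P t)" if "Measurable.pred borel P" for P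
  unfolding law_def using that by (subst AE_distr_iff) (auto simp: AE_measure_pmf_iff)

lemma cauchy_pmf_sum:
  assumes "finite (set_pmf p)"
  shows "cauchy_pmf p z = (\<Sum>t\<in>set_pmf p. of_real (pmf p t) / (z - of_real t))"
  unfolding cauchy_pmf_def
  by (subst integral_measure_pmf[OF assms]) (auto simp: scaleR_conv_of_real)

text \<open>The case of a point mass at \<gamma> in place of \<tau>, where g_\<tau>(z - c g_p(z)) is
  a single reciprocal. The equation satisfied by the points of the new support is recorded because
  it later confines them.\<close>

lemma reciprocal_cauchy_pmf:
  assumes fin: "finite (set_pmf p)" and c: "0 < c"
  shows "\<exists>q. finite (set_pmf q) \<and>
    (\<forall>s\<in>set_pmf q. s \<notin> set_pmf p \<and> of_real s - of_real \<gamma> - of_real c * cauchy_pmf p (of_real s) = 0) \<and>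
    (\<forall>z. z \<notin> of_real ` set_pmf p \<longrightarrow> z \<notin> of_real ` set_pmf q \<longrightarrow>
      cauchy_pmf q z * (z - of_real \<gamma> - of_real c * cauchy_pmf p z) = 1)"
proof -
  define X where "X = complex_of_real ` set_pmf p"
  define w where "w x = pmf p (Re x)" for x
  have C: "cauchy_pmf p z = (\<Sum>x\<in>X. of_real (w x) / (z - x))" for z
    unfolding cauchy_pmf_sum[OF fin] X_def w_def by (subst sum.reindex) (auto simp: inj_on_def)
  have X: "finite X" "X \<noteq> {}" "X \<subseteq> \<real>" using fin set_pmf_not_empty[of p] by (auto simp: X_def)
  have w: "0 < w x" if "x \<in> X" for x using that by (auto simp: X_def w_def pmf_positive)
  have "\<exists>Y v. finite Y \<and> Y \<subseteq> \<real> \<and>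
      (\<forall>s\<in>Y. s \<notin> X \<and> s - of_real \<gamma> - of_real c * cauchy_pmf p s = 0 \<and> 0 < (v s :: real)) \<and>
      (\<Sum>s\<in>Y. v s) = 1 \<and>
      (\<forall>z. z \<notin> X \<longrightarrow> z \<notin> Y \<longrightarrow> (\<Sum>s\<in>Y. of_real (v s) / (z - s)) * (z - of_real \<gamma> - of_real c * cauchy_pmf p z) = 1)"
    unfolding C by (rule reciprocal_partial_fractions[OF X _ c]) (rule w)
  then obtain Y v where Y0: "finite Y \<and> Y \<subseteq> \<real> \<and>
      (\<forall>s\<in>Y. s \<notin> X \<and> s - of_real \<gamma> - of_real c * cauchy_pmf p s = 0 \<and> 0 < (v s :: real)) \<and>
      (\<Sum>s\<in>Y. v s) = 1 \<and>
      (\<forall>z. z \<notin> X \<longrightarrow> z \<notin> Y \<longrightarrow> (\<Sum>s\<in>Y. of_real (v s) / (z - s)) * (z - of_real \<gamma> - of_real c * cauchy_pmf p z) = 1)"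
    by (elim exE) (rule that)
  have Y: "finite Y" "Y \<subseteq> \<real>"
    "\<And>s. s \<in> Y \<Longrightarrow> s \<notin> X \<and> s - of_real \<gamma> - of_real c * cauchy_pmf p s = 0 \<and> 0 < v s"
    "(\<Sum>s\<in>Y. v s) = 1"
    "\<And>z. z \<notin> X \<Longrightarrow> z \<notin> Y \<Longrightarrow> (\<Sum>s\<in>Y. of_real (v s) / (z - s)) * (z - of_real \<gamma> - of_real c * cauchy_pmf p z) = 1"
    using Y0 by blast+
  have ReY: "of_real (Re s) = s" if "s \<in> Y" for s using Y(2) that by (auto elim!: Reals_cases)
  define Z where "Z = Re ` Y"
  have injRe: "inj_on Re Y" using ReY by (metis inj_onI)
  have finZ: "finite Z" using Y(1) by (simp add: Z_def)
  have YZ: "of_real t \<in> Y \<longleftrightarrow> t \<in> Z" for t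
  proof
    assume "of_real t \<in> Y"
    then show "t \<in> Z" unfolding Z_def by (metis Re_complex_of_real imageI)
  qed (use ReY in \<open>auto simp: Z_def\<close>)
  define m where "m t = (if t \<in> Z then v (of_real t) else 0)" for t
  have m0: "0 \<le> m t" for t using Y(3) YZ by (auto simp: m_def less_imp_le)
  have msum: "(\<Sum>t\<in>Z. f t (of_real t)) = (\<Sum>s\<in>Y. f (Re s) s)" for f :: "real \<Rightarrow> complex \<Rightarrow> 'b::comm_monoid_add"
    unfolding Z_def by (subst sum.reindex[OF injRe]) (auto intro!: sum.cong simp: ReY)
  have "(\<integral>\<^sup>+t. ennreal (m t) \<partial>count_space UNIV) = (\<Sum>t\<in>Z. ennreal (m t))"
    by (rule nn_integral_count_space'[OF finZ]) (auto simp: m_def)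
  also have "\<dots> = ennreal (\<Sum>t\<in>Z. m t)" using m0 by simp
  also have "(\<Sum>t\<in>Z. m t) = (\<Sum>t\<in>Z. v (of_real t))" by (simp add: m_def)
  also have "\<dots> = 1" using msum[of "\<lambda>t s. v s"] Y(4) by simp
  finally have m1: "(\<integral>\<^sup>+t. ennreal (m t) \<partial>count_space UNIV) = 1" by simp
  define q where "q = embed_pmf m"
  have pq: "pmf q t = m t" for t unfolding q_def by (rule pmf_embed_pmf[OF m0 m1])
  have sq: "set_pmf q = Z" using Y(3) YZ by (auto simp: set_pmf_eq pq m_def) (metis less_irrefl)
  have Cq: "cauchy_pmf q z = (\<Sum>s\<in>Y. of_real (v s) / (z - s))" for z
  proof -
    have "cauchy_pmf q z = (\<Sum>t\<in>Z. of_real (v (of_real t)) / (z - of_real t))"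
      using finZ by (subst cauchy_pmf_sum) (auto simp: sq pq m_def)
    then show ?thesis using msum[of "\<lambda>t s. of_real (v s) / (z - s)"] by simp
  qed
  show ?thesis
  proof (intro exI[of _ q] conjI ballI allI impI)
    show "finite (set_pmf q)" using finZ sq by simp
  next
    fix s assume "s \<in> set_pmf q"
    then have "of_real s \<in> Y" using sq YZ by simp
    then show "s \<notin> set_pmf p" "of_real s - of_real \<gamma> - of_real c * cauchy_pmf p (of_real s) = 0"
      using Y(3) by (auto simp: X_def)
  next
    fix z :: complex assume z: "z \<notin> of_real ` set_pmf p" "z \<notin> of_real ` set_pmf q"
    have "z \<notin> Y" using z(2) ReY unfolding sq Z_def by (metis imageI)
    then show "cauchy_pmf q z * (z - of_real \<gamma> - of_real c * cauchy_pmf p z) = 1"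
      using Y(5) z(1) unfolding Cq X_def by blast
  qed
qed

text \<open>g_\<tau>(z - c g_p(z)) is the \<tau>-average over \<gamma> of the reciprocals 1 / (z -
  \<gamma> - c g_p(z)); hence it belongs to the mixture of their laws.\<close>

lemma cauchy_pmf_compose:
  assumes fin: "finite (set_pmf p)" "finite (set_pmf \<tau>)" and c: "0 < c"
  shows "\<exists>q. finite (set_pmf q) \<and>
    (\<forall>s\<in>set_pmf q. s \<notin> set_pmf p \<and> (\<exists>\<gamma>\<in>set_pmf \<tau>. of_real s - of_real \<gamma> = of_real c * cauchy_pmf p (of_real s))) \<and>
    (\<forall>z. z \<notin> of_real ` set_pmf p \<longrightarrow> z \<notin> of_real ` set_pmf q \<longrightarrow>
      cauchy_pmf q z = cauchy_pmf \<tau> (z - of_real c * cauchy_pmf p z))"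
proof -
  have "\<forall>\<gamma>. \<exists>q. finite (set_pmf q) \<and>
    (\<forall>s\<in>set_pmf q. s \<notin> set_pmf p \<and> of_real s - of_real \<gamma> - of_real c * cauchy_pmf p (of_real s) = 0) \<and>
    (\<forall>z. z \<notin> of_real ` set_pmf p \<longrightarrow> z \<notin> of_real ` set_pmf q \<longrightarrow>
      cauchy_pmf q z * (z - of_real \<gamma> - of_real c * cauchy_pmf p z) = 1)"
    by (rule allI, rule reciprocal_cauchy_pmf[OF fin(1) c])
  then have "\<exists>f. \<forall>\<gamma>. finite (set_pmf (f \<gamma>)) \<and>
    (\<forall>s\<in>set_pmf (f \<gamma>). s \<notin> set_pmf p \<and> of_real s - of_real \<gamma> - of_real c * cauchy_pmf p (of_real s) = 0) \<and>
    (\<forall>z. z \<notin> of_real ` set_pmf p \<longrightarrow> z \<notin> of_real ` set_pmf (f \<gamma>) \<longrightarrow>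
      cauchy_pmf (f \<gamma>) z * (z - of_real \<gamma> - of_real c * cauchy_pmf p z) = 1)"
    by (rule choice)
  then obtain f where f0: "\<forall>\<gamma>. finite (set_pmf (f \<gamma>)) \<and>
    (\<forall>s\<in>set_pmf (f \<gamma>). s \<notin> set_pmf p \<and> of_real s - of_real \<gamma> - of_real c * cauchy_pmf p (of_real s) = 0) \<and>
    (\<forall>z. z \<notin> of_real ` set_pmf p \<longrightarrow> z \<notin> of_real ` set_pmf (f \<gamma>) \<longrightarrow>
      cauchy_pmf (f \<gamma>) z * (z - of_real \<gamma> - of_real c * cauchy_pmf p z) = 1)"
    by (elim exE) (rule that)
  have f: "\<And>\<gamma>. finite (set_pmf (f \<gamma>))"
    "\<And>\<gamma> s. s \<in> set_pmf (f \<gamma>) \<Longrightarrow> s \<notin> set_pmf p \<and> of_real s - of_real \<gamma> - of_real c * cauchy_pmf p (of_real s) = 0"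
    "\<And>\<gamma> z. z \<notin> of_real ` set_pmf p \<Longrightarrow> z \<notin> of_real ` set_pmf (f \<gamma>) \<Longrightarrow>
      cauchy_pmf (f \<gamma>) z * (z - of_real \<gamma> - of_real c * cauchy_pmf p z) = 1"
    using f0 by simp_all
  show ?thesis
  proof (intro exI[of _ "bind_pmf \<tau> f"] conjI ballI allI impI)
    show "finite (set_pmf (bind_pmf \<tau> f))" using fin f(1) by auto
  next
    fix s assume "s \<in> set_pmf (bind_pmf \<tau> f)"
    then obtain \<gamma> where \<gamma>: "\<gamma> \<in> set_pmf \<tau>" "s \<in> set_pmf (f \<gamma>)" by auto
    show "s \<notin> set_pmf p" using f(2)[OF \<gamma>(2)] by simp
    show "\<exists>\<gamma>\<in>set_pmf \<tau>. of_real s - of_real \<gamma> = of_real c * cauchy_pmf p (of_real s)"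
      using f(2)[OF \<gamma>(2)] \<gamma>(1) by (intro bexI[of _ \<gamma>]) auto
  next
    fix z :: complex assume z: "z \<notin> of_real ` set_pmf p" "z \<notin> of_real ` set_pmf (bind_pmf \<tau> f)"
    have "cauchy_pmf (bind_pmf \<tau> f) z = (\<Sum>\<gamma>\<in>set_pmf \<tau>. pmf \<tau> \<gamma> *\<^sub>R cauchy_pmf (f \<gamma>) z)"
      unfolding cauchy_pmf_def by (rule pmf_expectation_bind) (use fin f(1) in auto)
    also have "\<dots> = (\<Sum>\<gamma>\<in>set_pmf \<tau>. of_real (pmf \<tau> \<gamma>) / (z - of_real c * cauchy_pmf p z - of_real \<gamma>))"
    proof (rule sum.cong)
      fix \<gamma> assume "\<gamma> \<in> set_pmf \<tau>"
      then have "z \<notin> of_real ` set_pmf (f \<gamma>)" using z(2) by auto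
      then have "cauchy_pmf (f \<gamma>) z * (z - of_real \<gamma> - of_real c * cauchy_pmf p z) = 1"
        by (rule f(3)[OF z(1)])
      then have "cauchy_pmf (f \<gamma>) z = 1 / (z - of_real \<gamma> - of_real c * cauchy_pmf p z)"
        by (subst eq_divide_eq) auto
      also have "z - of_real \<gamma> - of_real c * cauchy_pmf p z = z - of_real c * cauchy_pmf p z - of_real \<gamma>"
        by simp
      finally have e: "cauchy_pmf (f \<gamma>) z = 1 / (z - of_real c * cauchy_pmf p z - of_real \<gamma>)" .
      show "pmf \<tau> \<gamma> *\<^sub>R cauchy_pmf (f \<gamma>) z = of_real (pmf \<tau> \<gamma>) / (z - of_real c * cauchy_pmf p z - of_real \<gamma>)"
        unfolding e by (simp add: scaleR_conv_of_real)
    qed simp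
    finally show "cauchy_pmf (bind_pmf \<tau> f) z = cauchy_pmf \<tau> (z - of_real c * cauchy_pmf p z)"
      by (simp add: cauchy_pmf_sum[OF fin(2)])
  qed
qed

lemma cauchy_pmf_le:
  assumes "finite (set_pmf p)" "\<And>t. t \<in> set_pmf p \<Longrightarrow> d \<le> cmod (z - of_real t)" "0 < d"
  shows "cmod (cauchy_pmf p z) \<le> 1 / d"
proof -
  have "gap (law p) z d" unfolding gap_def using assms by (subst AE_law) auto
  then show ?thesis
    using real_distribution.cauchy_transform_le[OF real_distribution_law] by (simp add: cauchy_transform_law)
qed

text \<open>The invariant that keeps the supports of the iterates in a fixed interval: with
  \<open>L = B + 2 \<sigma>\<close> and \<open>\<bar>x\<bar> \<ge> L\<close>, the bound \<open>\<bar>g(x)\<bar> \<le> 1 / \<sigma>\<close> keeps \<open>x - \<sigma>\<^sup>2 g(x)\<close> at distance at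
  least \<open>\<sigma>\<close> from \<open>{-B..B}\<close>, which reproduces the bound.\<close>

definition confined :: "real \<Rightarrow> real \<Rightarrow> real pmf \<Rightarrow> bool" where
  "confined \<sigma> L p \<longleftrightarrow> finite (set_pmf p) \<and> (\<forall>t\<in>set_pmf p. \<bar>t\<bar> < L) \<and>
    (\<forall>x. L \<le> \<bar>x\<bar> \<longrightarrow> cmod (cauchy_pmf p (of_real x)) \<le> 1 / \<sigma>)"

lemma confined_step:
  assumes s: "0 < \<sigma>" and \<tau>: "finite (set_pmf \<tau>)" "\<And>t. t \<in> set_pmf \<tau> \<Longrightarrow> \<bar>t\<bar> \<le> B"
    and p: "confined \<sigma> (B + 2 * \<sigma>) p"
  shows "\<exists>q. confined \<sigma> (B + 2 * \<sigma>) q \<and>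
    (\<forall>z. 0 < Im z \<longrightarrow> cauchy_pmf q z = cauchy_pmf \<tau> (z - of_real (\<sigma>\<^sup>2) * cauchy_pmf p z))"
proof -
  define L where "L = B + 2 * \<sigma>"
  have fin: "finite (set_pmf p)" using p by (simp add: confined_def)
  have pL: "\<bar>t\<bar> < L" if "t \<in> set_pmf p" for t using p that by (simp add: confined_def L_def)
  have small: "cmod (of_real (\<sigma>\<^sup>2) * cauchy_pmf p (of_real x)) \<le> \<sigma>" if "L \<le> \<bar>x\<bar>" for x
  proof -
    have "\<sigma>\<^sup>2 * cmod (cauchy_pmf p (of_real x)) \<le> \<sigma>\<^sup>2 * (1 / \<sigma>)"
      using p that by (intro mult_left_mono) (auto simp: confined_def L_def)
    then show ?thesis using s by (simp add: norm_mult norm_power power2_eq_square)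
  qed
  have s2: "0 < \<sigma>\<^sup>2" using s by simp
  obtain q where q0: "finite (set_pmf q) \<and>
    (\<forall>s\<in>set_pmf q. s \<notin> set_pmf p \<and> (\<exists>\<gamma>\<in>set_pmf \<tau>. of_real s - of_real \<gamma> = of_real (\<sigma>\<^sup>2) * cauchy_pmf p (of_real s))) \<and>
    (\<forall>z. z \<notin> of_real ` set_pmf p \<longrightarrow> z \<notin> of_real ` set_pmf q \<longrightarrow>
      cauchy_pmf q z = cauchy_pmf \<tau> (z - of_real (\<sigma>\<^sup>2) * cauchy_pmf p z))"
    using cauchy_pmf_compose[OF fin \<tau>(1) s2] by (elim exE) (rule that)
  have q: "finite (set_pmf q)"
    "\<And>u. u \<in> set_pmf q \<Longrightarrow> \<exists>\<gamma>\<in>set_pmf \<tau>. of_real u - of_real \<gamma> = of_real (\<sigma>\<^sup>2) * cauchy_pmf p (of_real u)"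
    "\<And>z. z \<notin> of_real ` set_pmf p \<Longrightarrow> z \<notin> of_real ` set_pmf q \<Longrightarrow>
      cauchy_pmf q z = cauchy_pmf \<tau> (z - of_real (\<sigma>\<^sup>2) * cauchy_pmf p z)"
    using q0 by blast+
  \<comment> \<open>A support point u of \<open>q\<close> satisfies u - \<gamma> = \<sigma>^2
    g_p(u). If |u| \<ge> L, the left side is at least 2 \<sigma> and the right side at most \<sigma>
    in modulus.\<close>
  have qL: "\<bar>u\<bar> < L" if "u \<in> set_pmf q" for u
  proof (rule ccontr)
    assume "\<not> \<bar>u\<bar> < L"
    then have u: "L \<le> \<bar>u\<bar>" by simp
    obtain \<gamma> where \<gamma>: "\<gamma> \<in> set_pmf \<tau>" "of_real u - of_real \<gamma> = of_real (\<sigma>\<^sup>2) * cauchy_pmf p (of_real u)"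
      using q(2)[OF \<open>u \<in> set_pmf q\<close>] by blast
    have "cmod (of_real u - of_real \<gamma>) \<le> \<sigma>" unfolding \<gamma>(2) by (rule small[OF u])
    then have "\<bar>u - \<gamma>\<bar> \<le> \<sigma>" by (simp add: cmod_of_real_minus_of_real)
    then show False using u \<tau>(2)[OF \<gamma>(1)] s by (simp add: L_def)
  qed
  show ?thesis
  proof (intro exI[of _ q] conjI allI impI)
    show "confined \<sigma> (B + 2 * \<sigma>) q"
      unfolding confined_def L_def[symmetric]
    proof (intro conjI ballI allI impI)
      fix x assume x: "L \<le> \<bar>x\<bar>"
      then have "cauchy_pmf q (of_real x) = cauchy_pmf \<tau> (of_real x - of_real (\<sigma>\<^sup>2) * cauchy_pmf p (of_real x))"
        using pL[of x] qL[of x] by (intro q(3)) auto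
      moreover have "cmod (cauchy_pmf \<tau> (of_real x - of_real (\<sigma>\<^sup>2) * cauchy_pmf p (of_real x))) \<le> 1 / \<sigma>"
      proof (rule cauchy_pmf_le[OF \<tau>(1) _ s])
        fix t assume t: "t \<in> set_pmf \<tau>"
        define e where "e = of_real (\<sigma>\<^sup>2) * cauchy_pmf p (of_real x)"
        have "2 * \<sigma> \<le> \<bar>x - t\<bar>" using x \<tau>(2)[OF t] by (simp add: L_def)
        then have "2 * \<sigma> \<le> cmod (of_real x - of_real t)" by (simp only: cmod_of_real_minus_of_real)
        moreover have "cmod (of_real x - of_real t) \<le> cmod (of_real x - e - of_real t) + cmod e"
          using norm_triangle_ineq[of "complex_of_real x - e - of_real t" e] by simp
        ultimately show "\<sigma> \<le> cmod (of_real x - of_real (\<sigma>\<^sup>2) * cauchy_pmf p (of_real x) - of_real t)"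
          using small[OF x] by (simp only: e_def[symmetric])
      qed
      ultimately show "cmod (cauchy_pmf q (of_real x)) \<le> 1 / \<sigma>" by simp
    qed (use q(1) qL in auto)
  next
    fix z :: complex assume "0 < Im z"
    then show "cauchy_pmf q z = cauchy_pmf \<tau> (z - of_real (\<sigma>\<^sup>2) * cauchy_pmf p z)"
      by (intro q(3)) auto
  qed
qed

lemma confined_sequence:
  assumes s: "0 < \<sigma>" and \<tau>: "finite (set_pmf \<tau>)" "\<And>t. t \<in> set_pmf \<tau> \<Longrightarrow> \<bar>t\<bar> \<le> B"
  shows "\<exists>P. \<forall>n. confined \<sigma> (B + 2 * \<sigma>) (P n) \<and>
    (\<forall>z. 0 < Im z \<longrightarrow> cauchy_pmf (P (Suc n)) z = cauchy_pmf \<tau> (z - of_real (\<sigma>\<^sup>2) * cauchy_pmf (P n) z))"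
proof (rule dependent_nat_choice)
  have B: "0 \<le> B"
  proof -
    obtain t where "t \<in> set_pmf \<tau>" using set_pmf_not_empty[of \<tau>] by blast
    then show ?thesis using \<tau>(2)[of t] by simp
  qed
  \<comment> \<open>The iteration starts from the point mass at 0, whose transform is 1 / x, small
    enough beyond B + 2 \<sigma> because B \<ge> 0.\<close>
  have "confined \<sigma> (B + 2 * \<sigma>) (return_pmf 0)"
    unfolding confined_def
  proof (intro conjI allI impI)
    fix x assume "B + 2 * \<sigma> \<le> \<bar>x\<bar>"
    then show "cmod (cauchy_pmf (return_pmf 0) (of_real x)) \<le> 1 / \<sigma>"
      using s B by (intro cauchy_pmf_le) auto
  qed (use s B in auto)
  then show "\<exists>p. confined \<sigma> (B + 2 * \<sigma>) p" by blast
qed (use confined_step[OF assms] in blast)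

section \<open>Existence of subordinate measures\<close>

lemma weak_conv_cauchy_transform:
  fixes \<mu> :: "nat \<Rightarrow> real measure"
  assumes "\<And>n. real_distribution (\<mu> n)" "real_distribution \<kappa>" "weak_conv_m \<mu> \<kappa>" "0 < Im z"
  shows "(\<lambda>n. cauchy_transform (\<mu> n) z) \<longlonglongrightarrow> cauchy_transform \<kappa> z"
  unfolding cauchy_transform_def
proof (rule weak_conv_imp_integral_bdd_continuous_conv[OF assms(1-3)])
  fix t :: real
  have im: "Im (z - of_real t) = Im z" by simp
  then have "z - of_real t \<noteq> 0" using assms(4) by (metis less_irrefl zero_complex.sel(2))
  then show "isCont (\<lambda>t. 1 / (z - of_real t)) t" by (intro continuous_intros) auto
  have "Im z \<le> cmod (z - of_real t)" using abs_Im_le_cmod[of "z - of_real t"] by simp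
  then show "norm (1 / (z - of_real t)) \<le> 1 / Im z"
    using assms(4) by (simp add: norm_divide frac_le)
qed

lemma weak_conv_bounded:
  fixes \<mu> :: "nat \<Rightarrow> real measure"
  assumes "\<And>n. real_distribution (\<mu> n)" "real_distribution \<kappa>" "weak_conv_m \<mu> \<kappa>"
    and bnd: "\<And>n. AE t in \<mu> n. \<bar>t\<bar> \<le> L"
  shows "AE t in \<kappa>. \<bar>t\<bar> \<le> L"
proof -
  interpret real_distribution \<kappa> by fact
  \<comment> \<open>A bounded continuous test function that vanishes exactly where |t| \<le>
    L.\<close>
  define f :: "real \<Rightarrow> real" where "f t = min 1 (max 0 (\<bar>t\<bar> - L))" for t
  have contf: "isCont f t" for t unfolding f_def by (intro continuous_intros)
  have [measurable]: "f \<in> borel_measurable borel" unfolding f_def by measurable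
  have bf: "0 \<le> f t" "norm (f t) \<le> 1" for t by (auto simp: f_def)
  have "(\<lambda>n. LINT t|\<mu> n. f t) \<longlonglongrightarrow> (LINT t|\<kappa>. f t)"
    by (rule weak_conv_imp_integral_bdd_continuous_conv[OF assms(1-3) contf bf(2)])
  moreover have "(LINT t|\<mu> n. f t) = 0" for n
  proof (rule integral_eq_zero_AE)
    show "AE t in \<mu> n. f t = 0" using bnd[of n] by eventually_elim (auto simp: f_def)
  qed
  ultimately have "(\<lambda>n. 0) \<longlonglongrightarrow> (LINT t|\<kappa>. f t)" by simp
  then have "(LINT t|\<kappa>. f t) = 0" by (metis LIMSEQ_unique tendsto_const)
  moreover have "integrable \<kappa> f" by (rule integrable_const_bound[of _ 1]) (use bf in auto)
  ultimately have "AE t in \<kappa>. f t = 0"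
    using bf(1) by (subst (asm) integral_nonneg_eq_0_iff_AE) auto
  then show ?thesis by eventually_elim (auto simp: f_def min_def max_def split: if_splits)
qed

lemma bounded_tight:
  fixes \<mu> :: "nat \<Rightarrow> real measure"
  assumes "\<And>n. real_distribution (\<mu> n)" and bnd: "\<And>n. AE t in \<mu> n. \<bar>t\<bar> \<le> L"
  shows "tight \<mu>"
  unfolding tight_def
proof (intro conjI allI impI)
  show "real_distribution (\<mu> n)" for n by fact
  fix e :: real assume e: "0 < e"
  define K where "K = max 1 (L + 1)"
  have "measure (\<mu> n) {-K<..K} = 1" for n
  proof -
    interpret real_distribution "\<mu> n" by fact
    have "AE t in \<mu> n. t \<in> {-K<..K}" using bnd[of n] by eventually_elim (auto simp: K_def)
    then show ?thesis by (subst prob_eq_1) auto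
  qed
  then show "\<exists>a b. a < b \<and> (\<forall>n. 1 - e < measure (\<mu> n) {a<..b})"
    using e by (intro exI[of _ "-K"] exI[of _ K]) (auto simp: K_def)
qed

lemma bounded_weak_subsequence:
  fixes \<mu> :: "nat \<Rightarrow> real measure"
  assumes "\<And>n. real_distribution (\<mu> n)" and bnd: "\<And>n. AE t in \<mu> n. \<bar>t\<bar> \<le> L"
  obtains r \<kappa> where "strict_mono (r :: nat \<Rightarrow> nat)" "real_distribution \<kappa>" "AE t in \<kappa>. \<bar>t\<bar> \<le> L"
    "\<And>z. 0 < Im z \<Longrightarrow> (\<lambda>n. cauchy_transform (\<mu> (r n)) z) \<longlonglongrightarrow> cauchy_transform \<kappa> z"
proof -
  have "strict_mono (id :: nat \<Rightarrow> nat)" by (simp add: strict_mono_def)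
  moreover have "tight \<mu>" by (rule bounded_tight) (rule assms)+
  ultimately obtain r \<kappa> where r: "strict_mono (r :: nat \<Rightarrow> nat)" "real_distribution \<kappa>" "weak_conv_m (\<mu> \<circ> id \<circ> r) \<kappa>"
    using tight_imp_convergent_subsubsequence[of \<mu> id] by blast
  have w: "weak_conv_m (\<lambda>n. \<mu> (r n)) \<kappa>" using r(3) by (simp add: comp_def)
  show ?thesis
  proof (rule that[OF r(1,2)])
    show "AE t in \<kappa>. \<bar>t\<bar> \<le> L" by (rule weak_conv_bounded[OF assms(1) r(2) w bnd])
    show "(\<lambda>n. cauchy_transform (\<mu> (r n)) z) \<longlonglongrightarrow> cauchy_transform \<kappa> z" if "0 < Im z" for z
      by (rule weak_conv_cauchy_transform[OF assms(1) r(2) w that])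
  qed
qed

text \<open>The constant depends on the height only, not on the measure; this gives the contraction
  and lets the measure and its argument vary together in weak limits.\<close>

lemma (in real_distribution) cauchy_transform_lipschitz:
  assumes "0 < d" "d \<le> Im z" "d \<le> Im w"
  shows "cmod (cauchy_transform M z - cauchy_transform M w) \<le> cmod (z - w) / d\<^sup>2"
proof -
  have g: "gap M z d" "gap M w d"
    using assms gap_mono[OF gap_upper] by auto
  have "cmod (cauchy_transform M z - cauchy_transform M w) = cmod (z - w) * cmod (inv_prod M z w)"
    unfolding cauchy_transform_diff[OF g] by (simp only: norm_mult norm_minus_cancel)
  also have "\<dots> \<le> cmod (z - w) * (1 / (d * d))"
    by (intro mult_left_mono inv_prod_le_gap[OF g]) auto
  finally show ?thesis by (simp add: power2_eq_square)
qed

text \<open>Only a subsequence of the iterates is known to converge everywhere; that it converges to a fixed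
  point follows because the iteration is a contraction with factor \<open>1 / 4\<close> where \<open>Im z > 2 \<sigma>\<close>.\<close>

theorem subordinate_exists_pmf:
  assumes s: "0 < \<sigma>" and \<tau>: "finite (set_pmf \<tau>)" "\<And>t. t \<in> set_pmf \<tau> \<Longrightarrow> \<bar>t\<bar> \<le> B"
  shows "\<exists>\<kappa>. real_distribution \<kappa> \<and> (AE t in \<kappa>. \<bar>t\<bar> \<le> B + 2 * \<sigma>) \<and> subordinate \<sigma> (law \<tau>) \<kappa>"
proof -
  interpret T: real_distribution "law \<tau>" by (rule real_distribution_law)
  have "\<exists>P. \<forall>n. confined \<sigma> (B + 2 * \<sigma>) (P n) \<and>
    (\<forall>z. 0 < Im z \<longrightarrow> cauchy_pmf (P (Suc n)) z = cauchy_pmf \<tau> (z - of_real (\<sigma>\<^sup>2) * cauchy_pmf (P n) z))"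
    by (rule confined_sequence[OF s \<tau>(1)]) (rule \<tau>(2))
  then obtain P where P: "\<forall>n. confined \<sigma> (B + 2 * \<sigma>) (P n) \<and>
    (\<forall>z. 0 < Im z \<longrightarrow> cauchy_pmf (P (Suc n)) z = cauchy_pmf \<tau> (z - of_real (\<sigma>\<^sup>2) * cauchy_pmf (P n) z))"
    by (elim exE) (rule that)
  define G where "G n z = cauchy_transform (law (P n)) z" for n and z :: complex
  define g where "g z = cauchy_transform (law \<tau>) z" for z :: complex
  have rec: "G (Suc n) z = g (z - of_real (\<sigma>\<^sup>2) * G n z)" if "0 < Im z" for n z
    using P that by (simp add: G_def g_def cauchy_transform_law)
  have Imge: "Im z \<le> Im (z - of_real (\<sigma>\<^sup>2) * G n z)" if "0 < Im z" for n z
    unfolding G_def by (rule real_distribution.Im_subordination_ge[OF real_distribution_law that])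
  have bnd: "AE t in law (P n). \<bar>t\<bar> \<le> B + 2 * \<sigma>" for n
    using P by (subst AE_law) (auto simp: confined_def less_imp_le)
  obtain r \<kappa> where r: "strict_mono (r :: nat \<Rightarrow> nat)" and \<kappa>: "real_distribution \<kappa>" "AE t in \<kappa>. \<bar>t\<bar> \<le> B + 2 * \<sigma>"
    and lim: "\<And>z. 0 < Im z \<Longrightarrow> (\<lambda>n. G (r n) z) \<longlonglongrightarrow> cauchy_transform \<kappa> z"
    by (rule bounded_weak_subsequence[where \<mu> = "\<lambda>n. law (P n)", OF real_distribution_law bnd]) (rule that, simp_all add: G_def)
  interpret K: real_distribution \<kappa> by (rule \<kappa>(1))
  define \<omega> where "\<omega> z = z - of_real (\<sigma>\<^sup>2) * cauchy_transform \<kappa> z" for z :: complex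
  have Im\<omega>: "0 < Im (\<omega> z)" if "0 < Im z" for z
    using K.Im_subordination_ge[OF that, of \<sigma>] that unfolding \<omega>_def by linarith
  have large: "cauchy_transform \<kappa> z = g (\<omega> z)" if z: "2 * \<sigma> < Im z" for z
  proof -
    have z0: "0 < Im z" using z s by linarith
    have contr: "cmod (G (Suc (Suc n)) z - G (Suc n) z) \<le> 1 / 4 * cmod (G (Suc n) z - G n z)" for n
    proof -
      \<comment> \<open>At this height g_\<tau> has Lipschitz constant 1 / (2 \<sigma>)^2, and its
        argument carries the factor \<sigma>^2; together 1 / 4.\<close>
      have "2 * \<sigma> \<le> Im (z - of_real (\<sigma>\<^sup>2) * G m z)" for m
        using Imge[OF z0, of m] z by linarith
      then have "cmod (g (z - of_real (\<sigma>\<^sup>2) * G (Suc n) z) - g (z - of_real (\<sigma>\<^sup>2) * G n z))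
          \<le> cmod ((z - of_real (\<sigma>\<^sup>2) * G (Suc n) z) - (z - of_real (\<sigma>\<^sup>2) * G n z)) / (2 * \<sigma>)\<^sup>2"
        unfolding g_def using s by (intro T.cauchy_transform_lipschitz) auto
      then have "cmod (G (Suc (Suc n)) z - G (Suc n) z)
          \<le> cmod ((z - of_real (\<sigma>\<^sup>2) * G (Suc n) z) - (z - of_real (\<sigma>\<^sup>2) * G n z)) / (2 * \<sigma>)\<^sup>2"
        by (simp only: rec[OF z0, of "Suc n"] rec[OF z0, of n, symmetric])
      also have "(z - of_real (\<sigma>\<^sup>2) * G (Suc n) z) - (z - of_real (\<sigma>\<^sup>2) * G n z)
          = - (of_real (\<sigma>\<^sup>2) * (G (Suc n) z - G n z))" by (simp add: algebra_simps)
      also have "cmod \<dots> / (2 * \<sigma>)\<^sup>2 = 1 / 4 * cmod (G (Suc n) z - G n z)"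
        using s by (simp add: norm_mult norm_power power_mult_distrib)
      finally show ?thesis .
    qed
    have geo: "cmod (G (Suc n) z - G n z) \<le> (1 / 4) ^ n * cmod (G 1 z - G 0 z)" for n
    proof (induction n)
      case (Suc n)
      then show ?case using contr[of n] by simp
    qed simp
    have "(\<lambda>n. (1 / 4) ^ n * cmod (G 1 z - G 0 z)) \<longlonglongrightarrow> 0 * cmod (G 1 z - G 0 z)"
      by (intro tendsto_mult tendsto_const LIMSEQ_power_zero) simp
    then have "(\<lambda>n. (1 / 4) ^ n * cmod (G 1 z - G 0 z)) \<longlonglongrightarrow> 0" by (simp only: mult_zero_left)
    then have "(\<lambda>n. G (Suc n) z - G n z) \<longlonglongrightarrow> 0"
      by (rule Lim_null_comparison[rotated]) (intro always_eventually allI geo)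
    from LIMSEQ_subseq_LIMSEQ[OF this r]
    have "(\<lambda>n. G (Suc (r n)) z - G (r n) z) \<longlonglongrightarrow> 0" by (simp add: comp_def)
    from tendsto_add[OF this lim[OF z0]]
    have l1: "(\<lambda>n. G (Suc (r n)) z) \<longlonglongrightarrow> cauchy_transform \<kappa> z" by simp
    have "isCont g (\<omega> z)"
      unfolding g_def
      using DERIV_isCont[OF T.cauchy_transform_has_field_derivative[OF gap_upper[OF Im\<omega>[OF z0]]]] .
    moreover have "(\<lambda>n. z - of_real (\<sigma>\<^sup>2) * G (r n) z) \<longlonglongrightarrow> \<omega> z"
      unfolding \<omega>_def by (intro tendsto_intros lim z0)
    ultimately have "(\<lambda>n. g (z - of_real (\<sigma>\<^sup>2) * G (r n) z)) \<longlonglongrightarrow> g (\<omega> z)"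
      by (rule isCont_tendsto_compose)
    then have l2: "(\<lambda>n. G (Suc (r n)) z) \<longlonglongrightarrow> g (\<omega> z)" by (simp only: rec[OF z0])
    show ?thesis by (rule LIMSEQ_unique[OF l1 l2])
  qed
  have "cauchy_transform \<kappa> z = g (\<omega> z)" if "0 < Im z" for z
  \<comment> \<open>The identity theorem extends the equation from the half-plane of contraction to
    the whole upper half-plane.\<close>
  proof (rule analytic_continuation_open[where f = "cauchy_transform \<kappa>" and g = "\<lambda>z. g (\<omega> z)"
        and s = "{z. 2 * \<sigma> < Im z}" and s' = "{z. 0 < Im z}"])
    show "open {z. 2 * \<sigma> < Im z}" "open {z. 0 < Im z}" by (simp_all add: open_halfspace_Im_gt)
    show "{z. 2 * \<sigma> < Im z} \<noteq> {}" by (auto intro!: exI[of _ "Complex 0 (3 * \<sigma>)"] simp: s)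
    show "connected {z. 0 < Im z}" by (simp add: convex_connected convex_halfspace_Im_gt)
    show "{z. 2 * \<sigma> < Im z} \<subseteq> {z. 0 < Im z}" using s by auto
    show "cauchy_transform \<kappa> holomorphic_on {z. 0 < Im z}" by (rule K.cauchy_transform_holomorphic_upper)
    then have h: "\<omega> holomorphic_on {z. 0 < Im z}" unfolding \<omega>_def by (intro holomorphic_intros)
    have "cauchy_transform (law \<tau>) \<circ> \<omega> holomorphic_on {z. 0 < Im z}"
      by (rule holomorphic_on_compose_gen[OF h T.cauchy_transform_holomorphic_upper])
        (use Im\<omega> in auto)
    then show "(\<lambda>z. g (\<omega> z)) holomorphic_on {z. 0 < Im z}" by (simp only: comp_def g_def)
    show "cauchy_transform \<kappa> z = g (\<omega> z)" if "z \<in> {z. 2 * \<sigma> < Im z}" for z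
      using large that by simp
    show "z \<in> {z. 0 < Im z}" using that by simp
  qed
  then have "subordinate \<sigma> (law \<tau>) \<kappa>" by (simp add: subordinate_def g_def \<omega>_def)
  then show ?thesis using \<kappa> by blast
qed

text \<open>Both the function g_{\<tau> n} and its argument vary with n. The uniform Lipschitz bound
  at height Im z freezes the argument at its limit, and weak convergence then handles the
  function.\<close>

theorem subordinate_weak_limit:
  fixes \<tau> \<kappa> :: "nat \<Rightarrow> real measure"
  assumes \<tau>: "\<And>n. real_distribution (\<tau> n)" "real_distribution \<nu>" "weak_conv_m \<tau> \<nu>"
    and \<kappa>: "\<And>n. real_distribution (\<kappa> n)" "\<And>n. AE t in \<kappa> n. \<bar>t\<bar> \<le> L" "\<And>n. subordinate \<sigma> (\<tau> n) (\<kappa> n)"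
  shows "\<exists>\<mu>. real_distribution \<mu> \<and> (AE t in \<mu>. \<bar>t\<bar> \<le> L) \<and> subordinate \<sigma> \<nu> \<mu>"
proof -
  obtain r \<mu> where r: "strict_mono (r :: nat \<Rightarrow> nat)" and \<mu>: "real_distribution \<mu>" "AE t in \<mu>. \<bar>t\<bar> \<le> L"
    and lim: "\<And>z. 0 < Im z \<Longrightarrow> (\<lambda>n. cauchy_transform (\<kappa> (r n)) z) \<longlonglongrightarrow> cauchy_transform \<mu> z"
    by (rule bounded_weak_subsequence[where \<mu> = \<kappa>, OF \<kappa>(1,2)]) (rule that)
  have "subordinate \<sigma> \<nu> \<mu>"
    unfolding subordinate_def
  proof (intro allI impI)
    fix z :: complex assume z: "0 < Im z"
    define \<omega> where "\<omega> = z - of_real (\<sigma>\<^sup>2) * cauchy_transform \<mu> z"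
    define w where "w n = z - of_real (\<sigma>\<^sup>2) * cauchy_transform (\<kappa> (r n)) z" for n
    have Im: "Im z \<le> Im \<omega>" "Im z \<le> Im (w n)" for n
      unfolding \<omega>_def w_def using real_distribution.Im_subordination_ge[OF _ z] \<mu>(1) \<kappa>(1) by blast+
    have wlim: "w \<longlonglongrightarrow> \<omega>" unfolding w_def \<omega>_def by (intro tendsto_intros lim z)
    have "(\<lambda>n. cauchy_transform (\<tau> (r n)) (w n) - cauchy_transform (\<tau> (r n)) \<omega>) \<longlonglongrightarrow> 0"
    proof (rule Lim_null_comparison)
      show "\<forall>\<^sub>F n in sequentially. norm (cauchy_transform (\<tau> (r n)) (w n) - cauchy_transform (\<tau> (r n)) \<omega>)
          \<le> cmod (w n - \<omega>) / (Im z)\<^sup>2"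
        by (intro always_eventually allI real_distribution.cauchy_transform_lipschitz \<tau>(1) z Im)
      have "(\<lambda>n. cmod (w n - \<omega>) / (Im z)\<^sup>2) \<longlonglongrightarrow> cmod (\<omega> - \<omega>) / (Im z)\<^sup>2"
        using z by (intro tendsto_intros wlim) auto
      then show "(\<lambda>n. cmod (w n - \<omega>) / (Im z)\<^sup>2) \<longlonglongrightarrow> 0" by simp
    qed
    moreover have "(\<lambda>n. cauchy_transform (\<tau> (r n)) \<omega>) \<longlonglongrightarrow> cauchy_transform \<nu> \<omega>"
    proof -
      have "0 < Im \<omega>" using Im(1) z by linarith
      from LIMSEQ_subseq_LIMSEQ[OF weak_conv_cauchy_transform[OF \<tau> this] r]
      show ?thesis by (simp add: comp_def)
    qed
    ultimately have "(\<lambda>n. (cauchy_transform (\<tau> (r n)) (w n) - cauchy_transform (\<tau> (r n)) \<omega>)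
        + cauchy_transform (\<tau> (r n)) \<omega>) \<longlonglongrightarrow> 0 + cauchy_transform \<nu> \<omega>"
      by (rule tendsto_add)
    then have "(\<lambda>n. cauchy_transform (\<tau> (r n)) (w n)) \<longlonglongrightarrow> cauchy_transform \<nu> \<omega>" by simp
    moreover have "cauchy_transform (\<tau> (r n)) (w n) = cauchy_transform (\<kappa> (r n)) z" for n
      using \<kappa>(3)[of "r n"] z by (simp add: subordinate_def w_def)
    ultimately have "(\<lambda>n. cauchy_transform (\<kappa> (r n)) z) \<longlonglongrightarrow> cauchy_transform \<nu> \<omega>" by simp
    then have "cauchy_transform \<mu> z = cauchy_transform \<nu> \<omega>"
      using LIMSEQ_unique[OF lim[OF z]] by blast
    then show "cauchy_transform \<mu> z = cauchy_transform \<nu> (z - of_real (\<sigma>\<^sup>2) * cauchy_transform \<mu> z)"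
      by (simp add: \<omega>_def)
  qed
  then show ?thesis using \<mu> by blast
qed

section \<open>Points outside the support of the free convolution\<close>

context real_distribution
begin

lemma inv_square_compare:
  assumes "gap M z d" "gap M w e" "0 < c" "AE t in M. cmod (w - of_real t) \<le> c * cmod (z - of_real t)"
  shows "inv_square M z \<le> c\<^sup>2 * inv_square M w"
proof -
  have "inv_square M z \<le> (LINT t|M. c\<^sup>2 * (1 / (cmod (w - of_real t))\<^sup>2))"
    unfolding inv_square_def
  proof (rule integral_mono_AE)
    show "integrable M (\<lambda>t. 1 / (cmod (z - of_real t))\<^sup>2)" by (rule gap_integrable_square[OF assms(1)])
    show "integrable M (\<lambda>t. c\<^sup>2 * (1 / (cmod (w - of_real t))\<^sup>2))"
      by (rule integrable_mult_right[OF gap_integrable_square[OF assms(2)]])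
    show "AE t in M. 1 / (cmod (z - of_real t))\<^sup>2 \<le> c\<^sup>2 * (1 / (cmod (w - of_real t))\<^sup>2)"
      using gap_AE[OF assms(1)] gap_AE[OF assms(2)] assms(4)
    proof eventually_elim
      case (elim t)
      define a b where "a = cmod (z - of_real t)" and "b = cmod (w - of_real t)"
      have ab: "0 < a" "0 < b" "b \<le> c * a"
        using elim gap_pos[OF assms(1)] gap_pos[OF assms(2)] by (auto simp: a_def b_def)
      have "b\<^sup>2 \<le> (c * a)\<^sup>2" using ab by (intro power_mono) auto
      then have "1 / a\<^sup>2 \<le> c\<^sup>2 * (1 / b\<^sup>2)" using ab by (simp add: field_simps power_mult_distrib)
      then show ?case by (simp only: a_def b_def)
    qed
  qed
  also have "\<dots> = c\<^sup>2 * inv_square M w"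
    unfolding inv_square_def by (rule integral_mult_right_zero)
  finally show ?thesis .
qed

text \<open>Moving z by at most e times the gap changes every distance to the support by a relative
  error of at most e. The estimate is uniform in the measure, which is what a sequence of spectral
  measures requires.\<close>

lemma inv_square_near:
  assumes "gap M z d" "cmod (w - z) \<le> e * d" "0 \<le> e" "e < 1"
  shows "(1 - e)\<^sup>2 * inv_square M w \<le> inv_square M z" "inv_square M z \<le> (1 + e)\<^sup>2 * inv_square M w"
proof -
  have d: "0 < d" by (rule gap_pos[OF assms(1)])
  have "e * d < 1 * d" using assms d by (intro mult_strict_right_mono) auto
  then have gw: "gap M w (d - cmod (w - z))" using assms by (intro gap_shift[OF assms(1)]) auto
  have near: "AE t in M. \<bar>cmod (w - of_real t) - cmod (z - of_real t)\<bar> \<le> e * cmod (z - of_real t)"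
    using gap_AE[OF assms(1)]
  proof eventually_elim
    case (elim t)
    have "\<bar>cmod (w - of_real t) - cmod (z - of_real t)\<bar> \<le> cmod (w - z)"
      using norm_triangle_ineq3[of "w - of_real t" "z - of_real t"] by simp
    also have "\<dots> \<le> e * cmod (z - of_real t)"
      using assms(2,3) elim by (meson mult_left_mono order_trans)
    finally show ?case .
  qed
  have "inv_square M w \<le> (1 / (1 - e))\<^sup>2 * inv_square M z"
  proof (rule inv_square_compare[OF gw assms(1)])
    show "AE t in M. cmod (z - of_real t) \<le> 1 / (1 - e) * cmod (w - of_real t)"
      using near by eventually_elim (use assms(4) in \<open>simp add: field_simps\<close>)
  qed (use assms in auto)
  then show "(1 - e)\<^sup>2 * inv_square M w \<le> inv_square M z"
    using assms(4) by (simp add: power_divide field_simps)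
  show "inv_square M z \<le> (1 + e)\<^sup>2 * inv_square M w"
  proof (rule inv_square_compare[OF assms(1) gw])
    show "AE t in M. cmod (w - of_real t) \<le> (1 + e) * cmod (z - of_real t)"
      using near by eventually_elim (simp add: algebra_simps)
  qed (use assms in auto)
qed

text \<open>Under a gap the point x = u, where the extended integrand is infinite and the real one
  is 0, carries no mass.\<close>

lemma nn_integral_inverse_square:
  assumes "gap M (of_real u) d"
  shows "(\<integral>\<^sup>+x. inverse (ennreal ((u - x)\<^sup>2)) \<partial>M) = ennreal (inv_square M (of_real u))"
proof -
  have "(\<integral>\<^sup>+x. inverse (ennreal ((u - x)\<^sup>2)) \<partial>M) = (\<integral>\<^sup>+x. ennreal (1 / (cmod (of_real u - of_real x))\<^sup>2) \<partial>M)"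
  proof (rule nn_integral_cong_AE)
    show "AE x in M. inverse (ennreal ((u - x)\<^sup>2)) = ennreal (1 / (cmod (of_real u - of_real x))\<^sup>2)"
      using gap_AE[OF assms]
    proof eventually_elim
      case (elim x)
      then have "u - x \<noteq> 0" using gap_pos[OF assms] by auto
      then have "0 < (u - x)\<^sup>2" by simp
      then show ?case by (simp add: cmod_of_real_minus_of_real inverse_ennreal inverse_eq_divide)
    qed
  qed
  also have "\<dots> = ennreal (inv_square M (of_real u))"
    unfolding inv_square_def by (rule nn_integral_eq_integral[OF gap_integrable_square[OF assms]]) simp
  finally show ?thesis .
qed

end

text \<open>The open mapping theorem makes every \<open>w\<close> near \<open>u\<close> in the upper half-plane a value \<open>\<omega>(z)\<close>, where
  \<open>Im w \<le> C Im z\<close>; hence the bound \<open>1 - Im z / Im w \<le> 1 - 1 / C\<close>.\<close>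

lemma outside_support_subordination:
  assumes \<nu>: "real_distribution \<nu>" and \<kappa>: "real_distribution \<kappa>"
    and sub: "subordinate \<sigma> \<nu> \<kappa>" and x: "x \<notin> measure_support \<kappa>"
  defines "u \<equiv> x - \<sigma>\<^sup>2 * cauchy_transform \<kappa> x"
  shows "\<exists>r>0. \<exists>q<1. \<forall>w. cmod (w - of_real u) < r \<longrightarrow> 0 < Im w \<longrightarrow> \<sigma>\<^sup>2 * inv_square \<nu> w \<le> q"
proof -
  interpret N: real_distribution \<nu> by fact
  interpret K: real_distribution \<kappa> by fact
  obtain d where d: "gap \<kappa> (of_real x) d" using K.not_in_support_gap[OF x] by blast
  have d0: "0 < d" by (rule gap_pos[OF d])
  define S where "S = ball (complex_of_real x) (d / 2)"
  have gS: "gap \<kappa> z (d / 2)" if "z \<in> S" for z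
    using gap_mono[OF gap_shift[OF d, of z], of "d / 2"] that d0
    by (auto simp: S_def dist_norm norm_minus_commute)
  define \<omega> where "\<omega> z = z - of_real (\<sigma>\<^sup>2) * cauchy_transform \<kappa> z" for z :: complex
  have \<omega>u: "\<omega> (of_real x) = of_real u" by (simp add: \<omega>_def u_def K.cauchy_transform_of_real)
  have Im\<omega>: "Im (\<omega> z) = Im z * (1 + \<sigma>\<^sup>2 * inv_square \<kappa> z)" if "z \<in> S" for z
    using K.Im_cauchy_transform[OF gS[OF that]] by (simp add: \<omega>_def algebra_simps)
  \<comment> \<open>\<kappa> has a gap of d / 2 at every point of \<open>S\<close>, so
    \<open>C\<close> bounds the ratio of Im \<omega>(z) to Im z.\<close>
  define C where "C = 1 + \<sigma>\<^sup>2 * (1 / (d / 2)\<^sup>2)"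
  have C: "1 \<le> C" unfolding C_def using d0 by simp
  have le: "1 \<le> 1 + \<sigma>\<^sup>2 * inv_square \<kappa> z" "1 + \<sigma>\<^sup>2 * inv_square \<kappa> z \<le> C" if "z \<in> S" for z
  proof -
    have "\<sigma>\<^sup>2 * inv_square \<kappa> z \<le> \<sigma>\<^sup>2 * (1 / (d / 2)\<^sup>2)"
      by (rule mult_left_mono[OF K.inv_square_le[OF gS[OF that]]]) simp
    then show "1 + \<sigma>\<^sup>2 * inv_square \<kappa> z \<le> C" by (simp only: C_def add_left_mono)
    show "1 \<le> 1 + \<sigma>\<^sup>2 * inv_square \<kappa> z" using K.inv_square_nonneg[of z] by simp
  qed
  have hol: "\<omega> holomorphic_on S"
    unfolding \<omega>_def using K.cauchy_transform_holomorphic[of S] gS by (intro holomorphic_intros) blast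
  \<comment> \<open>Im \<omega> is positive above the axis and zero at x.\<close>
  have "\<not> \<omega> constant_on S"
  proof
    assume "\<omega> constant_on S"
    then obtain c where c: "\<And>z. z \<in> S \<Longrightarrow> \<omega> z = c" by (auto simp: constant_on_def)
    define z where "z = Complex x (d / 4)"
    have "z - of_real x = Complex 0 (d / 4)" by (simp add: z_def complex_eq_iff)
    then have "cmod (z - of_real x) = d / 4" using d0 by (simp add: cmod_def)
    then have zS: "z \<in> S" using d0 by (simp add: S_def dist_norm norm_minus_commute)
    moreover have "of_real x \<in> S" using d0 by (simp add: S_def)
    ultimately have "Im (\<omega> z) = Im (\<omega> (of_real x))" using c by metis
    then have "d / 4 * (1 + \<sigma>\<^sup>2 * inv_square \<kappa> z) = 0" using Im\<omega>[OF zS] by (simp add: \<omega>u z_def)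
    then show False using d0 le(1)[OF zS] by simp
  qed
  then have "open (\<omega> ` S)"
    by (intro open_mapping_thm[OF hol]) (auto simp: S_def)
  moreover have "of_real u \<in> \<omega> ` S"
  proof
    show "of_real u = \<omega> (of_real x)" by (rule \<omega>u[symmetric])
    show "of_real x \<in> S" using d0 by (simp add: S_def)
  qed
  ultimately obtain r where r: "0 < r" "ball (of_real u) r \<subseteq> \<omega> ` S"
    by (meson open_contains_ball)
  have "\<sigma>\<^sup>2 * inv_square \<nu> w \<le> 1 - 1 / C" if w: "cmod (w - of_real u) < r" "0 < Im w" for w
  proof -
    have "w \<in> ball (of_real u) r" using w by (simp add: dist_norm norm_minus_commute)
    then obtain z where z: "z \<in> S" "w = \<omega> z" using r(2) by blast
    define f where "f = 1 + \<sigma>\<^sup>2 * inv_square \<kappa> z"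
    have f: "1 \<le> f" "f \<le> C" using le[OF z(1)] by (auto simp: f_def)
    have Imw: "Im w = Im z * f" using Im\<omega>[OF z(1)] z(2) by (simp add: f_def)
    then have Imz: "0 < Im z" using w(2) f(1) by (simp add: zero_less_mult_iff)
    have "cauchy_transform \<nu> w = cauchy_transform \<kappa> z"
      using sub Imz by (simp add: subordinate_def z(2) \<omega>_def)
    then have "H_map \<sigma> \<nu> w = z" by (simp add: H_map_def z(2) \<omega>_def)
    then have "Im z = Im z * f * (1 - \<sigma>\<^sup>2 * inv_square \<nu> w)"
      using N.Im_H_map[OF gap_upper[OF w(2)], of \<sigma>] Imw by simp
    then have "f * (1 - \<sigma>\<^sup>2 * inv_square \<nu> w) = 1" using Imz by simp
    then have "1 - \<sigma>\<^sup>2 * inv_square \<nu> w = 1 / f" using f by (simp add: field_simps)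
    moreover have "1 / C \<le> 1 / f" using f by (intro frac_le) auto
    ultimately show ?thesis by linarith
  qed
  moreover have "1 - 1 / C < 1" using C by simp
  ultimately show ?thesis using r(1) by blast
qed

text \<open>The half-disc bound puts a whole real interval around u outside the support of \<nu>.
  There the bound extends to the axis, so the interval misses \<open>U_set\<close> and u is not even
  in its closure.\<close>

lemma outside_support_preimage:
  assumes s: "0 < \<sigma>" and \<nu>: "real_distribution \<nu>" and \<kappa>: "real_distribution \<kappa>"
    and sub: "subordinate \<sigma> \<nu> \<kappa>" and x: "x \<notin> measure_support \<kappa>"
  obtains u q where "u \<notin> measure_support \<nu>" "u \<notin> closure (U_set \<sigma> \<nu>)" "H_map \<sigma> \<nu> u = x"
    "q < 1" "\<sigma>\<^sup>2 * inv_square \<nu> (of_real u) \<le> q"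
proof -
  interpret N: real_distribution \<nu> by fact
  interpret K: real_distribution \<kappa> by fact
  define u where "u = x - \<sigma>\<^sup>2 * cauchy_transform \<kappa> x"
  obtain r q where r: "0 < r" and q: "q < 1"
    and rq: "\<And>w. cmod (w - of_real u) < r \<Longrightarrow> 0 < Im w \<Longrightarrow> \<sigma>\<^sup>2 * inv_square \<nu> w \<le> q"
    using outside_support_subordination[OF \<nu> \<kappa> sub x] unfolding u_def by blast
  have out: "v \<notin> measure_support \<nu>" if v: "\<bar>v - u\<bar> < r" for v
  proof (rule N.not_in_support_if_inv_square_bounded[of "r - \<bar>v - u\<bar>" _ "q / \<sigma>\<^sup>2"])
    fix w assume w: "cmod (w - of_real v) < r - \<bar>v - u\<bar>" "0 < Im w"
    have "cmod (w - of_real u) \<le> cmod (w - of_real v) + cmod (of_real v - of_real u)"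
      using norm_triangle_ineq[of "w - of_real v" "of_real v - of_real u"] by simp
    then have "cmod (w - of_real u) < r" using w(1) by (simp add: cmod_of_real_minus_of_real)
    then show "inv_square \<nu> w \<le> q / \<sigma>\<^sup>2" using rq[OF _ w(2)] s by (simp add: field_simps)
  qed (use v in simp)
  have small: "\<sigma>\<^sup>2 * inv_square \<nu> (of_real v) \<le> q" if v: "\<bar>v - u\<bar> < r" for v
  proof -
    obtain d where d: "gap \<nu> (of_real v) d" using N.not_in_support_gap[OF out[OF v]] by blast
    have d0: "0 < d" by (rule gap_pos[OF d])
    \<comment> \<open>The bound is known above the axis only. The points v + i e d carry it down to
      v as e tends to 0, at the cost of the factor (1 + e)^2.\<close>
    have "\<forall>\<^sub>F e in at_right 0. \<sigma>\<^sup>2 * inv_square \<nu> (of_real v) \<le> (1 + e)\<^sup>2 * q"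
    proof -
      define e0 where "e0 = min 1 ((r - \<bar>v - u\<bar>) / d)"
      have "0 < e0" using v d0 by (simp add: e0_def)
      then have "\<forall>\<^sub>F e in at_right 0. e \<in> {0<..<e0}" by (rule eventually_at_right_real)
      then show ?thesis
      proof eventually_elim
        case (elim e)
        define w where "w = Complex v (e * d)"
        have e: "0 < e" "e < 1" "e * d < r - \<bar>v - u\<bar>" using elim d0 by (auto simp: e0_def field_simps)
        have wv: "w - of_real v = Complex 0 (e * d)" by (simp add: w_def complex_eq_iff)
        then have cw: "cmod (w - of_real v) = e * d" using e d0 by (simp add: cmod_def)
        have "cmod (w - of_real u) \<le> cmod (w - of_real v) + cmod (of_real v - of_real u)"
          using norm_triangle_ineq[of "w - of_real v" "of_real v - of_real u"] by simp
        then have "cmod (w - of_real u) < r" using cw e(3) by (simp add: cmod_of_real_minus_of_real)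
        moreover have "0 < Im w" using e d0 by (simp add: w_def)
        ultimately have "\<sigma>\<^sup>2 * inv_square \<nu> w \<le> q" by (rule rq)
        then have "(1 + e)\<^sup>2 * (\<sigma>\<^sup>2 * inv_square \<nu> w) \<le> (1 + e)\<^sup>2 * q"
          by (rule mult_left_mono) simp
        moreover have "inv_square \<nu> (of_real v) \<le> (1 + e)\<^sup>2 * inv_square \<nu> w"
          by (rule N.inv_square_near(2)[OF d]) (use cw e in auto)
        then have "\<sigma>\<^sup>2 * inv_square \<nu> (of_real v) \<le> \<sigma>\<^sup>2 * ((1 + e)\<^sup>2 * inv_square \<nu> w)"
          by (rule mult_left_mono) simp
        moreover have "\<sigma>\<^sup>2 * ((1 + e)\<^sup>2 * inv_square \<nu> w) = (1 + e)\<^sup>2 * (\<sigma>\<^sup>2 * inv_square \<nu> w)" by simp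
        ultimately show ?case by linarith
      qed
    qed
    moreover have "((\<lambda>e. (1 + e)\<^sup>2 * q) \<longlongrightarrow> (1 + 0)\<^sup>2 * q) (at_right 0)" by (intro tendsto_intros)
    ultimately have "\<sigma>\<^sup>2 * inv_square \<nu> (of_real v) \<le> (1 + 0)\<^sup>2 * q"
      by (intro tendsto_lowerbound[of _ _ "at_right 0"]) auto
    then show ?thesis by simp
  qed
  have "ball u r \<inter> U_set \<sigma> \<nu> = {}"
  proof (rule ccontr)
    assume "ball u r \<inter> U_set \<sigma> \<nu> \<noteq> {}"
    then obtain v where v: "\<bar>v - u\<bar> < r" "v \<in> U_set \<sigma> \<nu>" by (auto simp: dist_real_def abs_minus_commute)
    obtain d where d: "gap \<nu> (of_real v) d" using N.not_in_support_gap[OF out[OF v(1)]] by blast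
    have "ennreal (1 / \<sigma>\<^sup>2) < ennreal (inv_square \<nu> (of_real v))"
      using v(2) by (simp add: U_set_def N.nn_integral_inverse_square[OF d])
    then have "1 / \<sigma>\<^sup>2 < inv_square \<nu> (of_real v)" by (simp add: ennreal_less_iff)
    then show False using small[OF v(1)] q s by (simp add: field_simps)
  qed
  then have "u \<notin> closure (U_set \<sigma> \<nu>)"
    using r closure_approachable[of u "U_set \<sigma> \<nu>"] by (force simp: dist_commute)
  moreover have "H_map \<sigma> \<nu> u = x"
  proof -
    obtain d where d: "gap \<nu> (of_real u) d" using N.not_in_support_gap[OF out[of u]] r by auto
    obtain d' where d': "gap \<kappa> (of_real x) d'" using K.not_in_support_gap[OF x] by blast
    define \<omega> where "\<omega> z = z - of_real (\<sigma>\<^sup>2) * cauchy_transform \<kappa> z" for z :: complex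
    have ck: "isCont (cauchy_transform \<kappa>) (complex_of_real x)"
      by (rule DERIV_isCont[OF K.cauchy_transform_has_field_derivative[OF d']])
    have cn: "isCont (cauchy_transform \<nu>) (complex_of_real u)"
      by (rule DERIV_isCont[OF N.cauchy_transform_has_field_derivative[OF d]])
    \<comment> \<open>Subordination is an equation above the axis; g_\<kappa>(x) = g_\<nu>(u) is its
      limit along the vertical line through x.\<close>
    define z where "z n = Complex x (inverse (real (Suc n)))" for n
    have zlim: "z \<longlonglongrightarrow> of_real x"
      using tendsto_Complex[OF tendsto_const LIMSEQ_inverse_real_of_nat, of x]
      by (simp add: z_def[abs_def] complex_of_real_def)
    have l1: "(\<lambda>n. cauchy_transform \<kappa> (z n)) \<longlonglongrightarrow> cauchy_transform \<kappa> (of_real x)"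
      by (rule isCont_tendsto_compose[OF ck zlim])
    have "(\<lambda>n. \<omega> (z n)) \<longlonglongrightarrow> \<omega> (of_real x)"
      unfolding \<omega>_def by (intro tendsto_intros l1 zlim)
    also have "\<omega> (of_real x) = of_real u" by (simp add: \<omega>_def u_def K.cauchy_transform_of_real)
    finally have "(\<lambda>n. cauchy_transform \<nu> (\<omega> (z n))) \<longlonglongrightarrow> cauchy_transform \<nu> (of_real u)"
      by (rule isCont_tendsto_compose[OF cn])
    moreover have "cauchy_transform \<nu> (\<omega> (z n)) = cauchy_transform \<kappa> (z n)" for n
      using sub by (simp add: subordinate_def \<omega>_def z_def)
    ultimately have "(\<lambda>n. cauchy_transform \<kappa> (z n)) \<longlonglongrightarrow> cauchy_transform \<nu> (of_real u)" by simp
    then have "cauchy_transform \<kappa> (complex_of_real x) = cauchy_transform \<nu> (of_real u)"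
      using LIMSEQ_unique[OF l1] by blast
    then have "cauchy_transform \<kappa> x = cauchy_transform \<nu> u"
      by (simp add: K.cauchy_transform_of_real N.cauchy_transform_of_real)
    then show ?thesis by (simp add: H_map_def u_def)
  qed
  ultimately show ?thesis using that[of u q] out[of u] small[of u] q r by simp
qed

text \<open>The subordination function is identified near \<open>x\<close> with the solution of \<open>H(w) = z\<close> close to \<open>u\<close>
  that Brouwer's theorem provides; there \<open>Im w \<le> Im z / (1 - q)\<close>.\<close>

lemma not_in_support_near_H_map:
  assumes s: "0 < \<sigma>" and \<tau>: "real_distribution \<tau>" and \<kappa>: "real_distribution \<kappa>"
    and sub: "subordinate \<sigma> \<tau> \<kappa>" and d: "gap \<tau> (of_real u) d" and \<eta>: "0 < \<eta>" "\<eta> < d" and q: "q < 1"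
    and small: "\<And>w. cmod (w - of_real u) \<le> \<eta> \<Longrightarrow> \<sigma>\<^sup>2 * inv_square \<tau> w \<le> q"
    and x: "\<bar>x - H_map \<sigma> \<tau> u\<bar> < (1 - q) * \<eta>"
  shows "x \<notin> measure_support \<kappa>"
proof -
  interpret T: real_distribution \<tau> by fact
  interpret K: real_distribution \<kappa> by fact
  define H where "H = H_map \<sigma> \<tau> u"
  have Hc: "H_map \<sigma> \<tau> (complex_of_real u) = of_real H"
    by (simp add: H_def H_map_def T.cauchy_transform_of_real)
  have gw: "gap \<tau> w (d - \<eta>)" if "cmod (w - of_real u) \<le> \<eta>" for w
    using gap_mono[OF gap_shift[OF d, of w], of "d - \<eta>"] that \<eta> by simp
  have "inv_square \<kappa> z \<le> (1 / (1 - q)) / \<sigma>\<^sup>2"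
    if z: "cmod (z - of_real x) < (1 - q) * \<eta> - \<bar>x - H\<bar>" "0 < Im z" for z
  proof -
    define f where "f w = z - of_real (\<sigma>\<^sup>2) * cauchy_transform \<tau> w" for w :: complex
    have zH: "cmod (z - of_real H) \<le> (1 - q) * \<eta>"
      using norm_triangle_ineq[of "z - of_real x" "of_real x - of_real H"] z(1)
      by (simp add: cmod_of_real_minus_of_real)
    have hol: "cauchy_transform \<tau> holomorphic_on cball (of_real u) \<eta>"
      using gw by (intro T.cauchy_transform_holomorphic) (auto simp: dist_norm norm_minus_commute)
    have cont: "continuous_on (cball (of_real u) \<eta>) f"
      unfolding f_def by (intro continuous_intros holomorphic_on_imp_continuous_on[OF hol])
    \<comment> \<open>The displacement of z from H(u) costs at most (1 - q) \<eta>, the variation of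
      \<sigma>^2 g over the ball at most q \<eta>. This dictates the tolerance (1 - q) \<eta> for
      x.\<close>
    have "f \<in> cball (of_real u) \<eta> \<rightarrow> cball (of_real u) \<eta>"
    proof
      fix w :: complex assume "w \<in> cball (of_real u) \<eta>"
      then have w: "cmod (w - of_real u) \<le> \<eta>" by (simp add: dist_norm norm_minus_commute)
      have "f w - of_real u = (z - of_real H) - of_real (\<sigma>\<^sup>2) * (cauchy_transform \<tau> w - cauchy_transform \<tau> (of_real u))"
        using Hc by (simp add: f_def H_map_def algebra_simps)
      also have "\<dots> = (z - of_real H) + of_real (\<sigma>\<^sup>2) * ((w - of_real u) * inv_prod \<tau> w (of_real u))"
        unfolding T.cauchy_transform_diff[OF gw[OF w] d] by (simp add: algebra_simps)
      finally have "cmod (f w - of_real u) \<le> cmod (z - of_real H) + cmod (of_real (\<sigma>\<^sup>2) * ((w - of_real u) * inv_prod \<tau> w (of_real u)))"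
        by (simp only: norm_triangle_ineq)
      also have "cmod (of_real (\<sigma>\<^sup>2) * ((w - of_real u) * inv_prod \<tau> w (of_real u)))
          = cmod (w - of_real u) * (\<sigma>\<^sup>2 * cmod (inv_prod \<tau> w (of_real u)))"
        by (simp add: norm_mult norm_power)
      also have "\<dots> \<le> \<eta> * q"
      proof (rule mult_mono)
        have "\<sigma>\<^sup>2 * cmod (inv_prod \<tau> w (of_real u)) \<le> \<sigma>\<^sup>2 * ((inv_square \<tau> w + inv_square \<tau> (of_real u)) / 2)"
          by (intro mult_left_mono T.inv_prod_le[OF gw[OF w] d]) simp
        also have "\<dots> = (\<sigma>\<^sup>2 * inv_square \<tau> w + \<sigma>\<^sup>2 * inv_square \<tau> (of_real u)) / 2" by (simp add: algebra_simps)
        also have "\<dots> \<le> q" using small[OF w] small[of "of_real u"] \<eta> by simp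
        finally show "\<sigma>\<^sup>2 * cmod (inv_prod \<tau> w (of_real u)) \<le> q" .
      qed (use w \<eta> in auto)
      finally have "cmod (f w - of_real u) \<le> \<eta>" using zH by (simp add: algebra_simps)
      then show "f w \<in> cball (of_real u) \<eta>" by (simp add: dist_norm norm_minus_commute)
    qed
    then obtain w where w': "w \<in> cball (of_real u) \<eta>" "f w = w"
      using brouwer_ball[OF \<eta>(1) cont] by blast
    then have w: "cmod (w - of_real u) \<le> \<eta>" by (simp add: dist_norm norm_minus_commute)
    have Hw: "H_map \<sigma> \<tau> w = z" using w'(2) by (simp add: f_def H_map_def algebra_simps)
    define a where "a = 1 - \<sigma>\<^sup>2 * inv_square \<tau> w"
    have a: "1 - q \<le> a" using small[OF w] by (simp add: a_def)
    have Imz: "Im z = Im w * a" using T.Im_H_map[OF gw[OF w], of \<sigma>] Hw by (simp add: a_def)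
    have "0 < a" using a q by linarith
    then have Imw: "0 < Im w" using Imz z(2) by (simp add: zero_less_mult_iff)
    define v where "v = z - of_real (\<sigma>\<^sup>2) * cauchy_transform \<kappa> z"
    have v: "0 < Im v" using K.Im_subordination_ge[OF z(2), of \<sigma>] z(2) unfolding v_def by linarith
    have "cauchy_transform \<tau> v = cauchy_transform \<kappa> z"
      using sub z(2) by (simp add: subordinate_def v_def)
    then have Hv: "H_map \<sigma> \<tau> v = z" by (simp add: H_map_def v_def)
    have Imv: "Im v = Im z * (1 + \<sigma>\<^sup>2 * inv_square \<kappa> z)"
      using K.Im_cauchy_transform[OF gap_upper[OF z(2)]] by (simp add: v_def algebra_simps)
    have "v = w" by (rule T.H_map_inj_upper[OF v Imw, of \<sigma>]) (use Hv Hw z(2) in auto)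
    then have Imw': "Im w = Im z * (1 + \<sigma>\<^sup>2 * inv_square \<kappa> z)" using Imv by simp
    \<comment> \<open>Im grows from z to \<omega>(z) = w by the factor 1 + \<sigma>^2
      \<open>inv_square \<kappa> z\<close> and shrinks back from w to H(w) = z by \<open>a\<close>,
      so the two factors are reciprocal.\<close>
    have "Im z * 1 = Im w * a" using Imz by simp
    also have "\<dots> = Im z * ((1 + \<sigma>\<^sup>2 * inv_square \<kappa> z) * a)"
      unfolding Imw' by (simp only: mult.assoc)
    finally have "Im z * 1 = Im z * ((1 + \<sigma>\<^sup>2 * inv_square \<kappa> z) * a)" .
    then have "(1 + \<sigma>\<^sup>2 * inv_square \<kappa> z) * a = 1" using z(2) by simp
    then have "1 + \<sigma>\<^sup>2 * inv_square \<kappa> z = 1 / a" using \<open>0 < a\<close> by (simp add: field_simps)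
    moreover have "1 / a \<le> 1 / (1 - q)" using a q by (intro frac_le) auto
    ultimately have "\<sigma>\<^sup>2 * inv_square \<kappa> z \<le> 1 / (1 - q)" by linarith
    then have "inv_square \<kappa> z * \<sigma>\<^sup>2 \<le> 1 / (1 - q)" by (simp only: mult.commute)
    then show ?thesis using s by (subst pos_le_divide_eq) simp_all
  qed
  then show ?thesis
    using x by (intro K.not_in_support_if_inv_square_bounded[of "(1 - q) * \<eta> - \<bar>x - H\<bar>"]) (auto simp: H_def)
qed

text \<open>Weak convergence tests only bounded continuous functions. As no mass lies in the gap, a
  singular f may be replaced by such an h that agrees with it outside the gap.\<close>

lemma weak_conv_gap_integral:
  fixes \<tau> :: "nat \<Rightarrow> real measure" and h :: "real \<Rightarrow> real"
  assumes \<tau>: "\<And>n. real_distribution (\<tau> n)" "real_distribution \<nu>" "weak_conv_m \<tau> \<nu>"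
    and ev: "eventually (\<lambda>n. gap (\<tau> n) (of_real u) d) sequentially" and gap: "gap \<nu> (of_real u) d"
    and h: "\<And>t. isCont h t" "\<And>t. \<bar>h t\<bar> \<le> C" and f: "\<And>t. d \<le> \<bar>u - t\<bar> \<Longrightarrow> f t = h t"
    and [measurable]: "f \<in> borel_measurable borel"
  shows "(\<lambda>n. LINT t|\<tau> n. f t) \<longlonglongrightarrow> (LINT t|\<nu>. f t)"
proof -
  have [measurable]: "h \<in> borel_measurable borel"
    by (intro borel_measurable_continuous_onI continuous_at_imp_continuous_on ballI h(1))
  have eq: "(LINT t|\<rho>. f t) = (LINT t|\<rho>. h t)" if "real_distribution \<rho>" "gap \<rho> (of_real u) d" for \<rho>
  proof -
    interpret real_distribution \<rho> by fact
    show ?thesis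
    proof (rule integral_cong_AE)
      show "AE t in \<rho>. f t = h t"
        using gap_AE[OF that(2)] by eventually_elim (simp add: f cmod_of_real_minus_of_real)
    qed simp_all
  qed
  have "(\<lambda>n. LINT t|\<tau> n. h t) \<longlonglongrightarrow> (LINT t|\<nu>. h t)"
    by (rule weak_conv_imp_integral_bdd_continuous_conv[OF \<tau> h(1), of C]) (simp add: h(2))
  moreover have "eventually (\<lambda>n. (LINT t|\<tau> n. h t) = (LINT t|\<tau> n. f t)) sequentially"
    using ev by eventually_elim (simp add: eq \<tau>(1))
  ultimately have "(\<lambda>n. LINT t|\<tau> n. f t) \<longlonglongrightarrow> (LINT t|\<nu>. h t)"
    by (rule Lim_transform_eventually)
  then show ?thesis by (simp add: eq \<tau>(2) gap)
qed

lemma weak_conv_gap: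
  fixes \<tau> :: "nat \<Rightarrow> real measure"
  assumes \<tau>: "\<And>n. real_distribution (\<tau> n)" "real_distribution \<nu>" "weak_conv_m \<tau> \<nu>"
    and ev: "eventually (\<lambda>n. gap (\<tau> n) (of_real u) d) sequentially" and gap: "gap \<nu> (of_real u) d"
  shows "(\<lambda>n. inv_square (\<tau> n) (of_real u)) \<longlonglongrightarrow> inv_square \<nu> (of_real u)"
    and "(\<lambda>n. cauchy_transform (\<tau> n) u) \<longlonglongrightarrow> cauchy_transform \<nu> u"
proof -
  have d: "0 < d" by (rule gap_pos[OF gap])
  \<comment> \<open>The distance truncated at the gap. Both 1 / m^2 and (u - t) / m^2 are bounded
    and continuous, and they agree with 1 / (u - t)^2 and 1 / (u - t) outside the gap; the second
    form keeps the sign.\<close>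
  define m where "m t = max d \<bar>u - t\<bar>" for t
  have m: "0 < m t" "d \<le> m t" "\<bar>u - t\<bar> \<le> m t" "isCont m t" for t
    using d unfolding m_def by (auto intro!: continuous_intros simp: less_max_iff_disj)
  have nz: "m t \<noteq> 0" for t using m(1)[of t] by simp
  have mm: "d * d \<le> m t * m t" for t using m(2)[of t] d by (intro mult_mono) auto
  have "(\<lambda>n. LINT t|\<tau> n. 1 / (cmod (of_real u - of_real t))\<^sup>2) \<longlonglongrightarrow> (LINT t|\<nu>. 1 / (cmod (of_real u - of_real t))\<^sup>2)"
  proof (rule weak_conv_gap_integral[OF \<tau> ev gap, where h = "\<lambda>t. 1 / (m t * m t)" and C = "1 / (d * d)"])
    show "isCont (\<lambda>t. 1 / (m t * m t)) t" for t
      using nz[of t] by (intro continuous_intros m) auto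
    show "\<bar>1 / (m t * m t)\<bar> \<le> 1 / (d * d)" for t
      using m(1)[of t] d mm[of t] by (simp add: frac_le)
    show "1 / (cmod (of_real u - of_real t))\<^sup>2 = 1 / (m t * m t)" if "d \<le> \<bar>u - t\<bar>" for t
      using that by (simp add: cmod_of_real_minus_of_real m_def max_def power2_eq_square)
  qed simp
  then show "(\<lambda>n. inv_square (\<tau> n) (of_real u)) \<longlonglongrightarrow> inv_square \<nu> (of_real u)"
    unfolding inv_square_def .
  have "(\<lambda>n. LINT t|\<tau> n. 1 / (u - t)) \<longlonglongrightarrow> (LINT t|\<nu>. 1 / (u - t))"
  proof (rule weak_conv_gap_integral[OF \<tau> ev gap, where h = "\<lambda>t. (u - t) / (m t * m t)" and C = "1 / d"])
    show "isCont (\<lambda>t. (u - t) / (m t * m t)) t" for t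
      using nz[of t] by (intro continuous_intros m) auto
    show "\<bar>(u - t) / (m t * m t)\<bar> \<le> 1 / d" for t
    proof -
      have "\<bar>u - t\<bar> / (m t * m t) \<le> m t / (m t * m t)"
        using m(1)[of t] m(3)[of t] by (intro divide_right_mono) auto
      also have "\<dots> = 1 / m t" using nz by simp
      also have "\<dots> \<le> 1 / d" using m(2)[of t] d by (intro frac_le) auto
      finally show ?thesis by (simp add: abs_mult)
    qed
    show "1 / (u - t) = (u - t) / (m t * m t)" if "d \<le> \<bar>u - t\<bar>" for t
    proof -
      have "m t * m t = (u - t) * (u - t)" using that by (simp add: m_def max_def)
      then show ?thesis using nz by (metis mult_eq_0_iff nonzero_divide_mult_cancel_left)
    qed
  qed simp
  then show "(\<lambda>n. cauchy_transform (\<tau> n) u) \<longlonglongrightarrow> cauchy_transform \<nu> u"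
    unfolding cauchy_transform_def by simp
qed

lemma eventually_not_in_support_near:
  fixes \<tau> \<kappa> :: "nat \<Rightarrow> real measure"
  assumes s: "0 < \<sigma>" and \<tau>: "\<And>n. real_distribution (\<tau> n)" "real_distribution \<nu>" "weak_conv_m \<tau> \<nu>"
    and \<kappa>: "eventually (\<lambda>n. real_distribution (\<kappa> n) \<and> subordinate \<sigma> (\<tau> n) (\<kappa> n)) sequentially"
    and ev: "eventually (\<lambda>n. gap (\<tau> n) (of_real u) d) sequentially" and gap: "gap \<nu> (of_real u) d"
    and q0: "\<sigma>\<^sup>2 * inv_square \<nu> (of_real u) < 1"
  shows "\<exists>r>0. eventually (\<lambda>n. \<forall>x. \<bar>x - H_map \<sigma> \<nu> u\<bar> < r \<longrightarrow> x \<notin> measure_support (\<kappa> n)) sequentially"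
proof -
  have d: "0 < d" by (rule gap_pos[OF gap])
  define S0 where "S0 = \<sigma>\<^sup>2 * inv_square \<nu> (of_real u)"
  have S0: "0 \<le> S0" "S0 < 1"
    using q0 real_distribution.inv_square_nonneg[OF \<tau>(2)] by (simp_all add: S0_def)
  \<comment> \<open>\<open>q1\<close> is the bound reached at u itself for large n, \<open>q\<close>
    the weaker one on a disc around u.\<close>
  define q1 q where "q1 = (S0 + 1) / 2" and "q = (q1 + 1) / 2"
  have q: "S0 < q1" "0 < q1" "q1 < q" "q < 1" using S0 by (simp_all add: q1_def q_def)
  define p where "p = q1 / q"
  have p: "0 < p" "p < 1" "p * q = q1" using q by (simp_all add: p_def)
  \<comment> \<open>Chosen so that (1 - e)^2 \<ge> 1 - 2 e = p: the loss from u to the disc is then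
    at most the factor 1 / p = q / q1.\<close>
  define e where "e = (1 - p) / 2"
  have e: "0 < e" "e < 1" "p \<le> (1 - e)\<^sup>2"
  proof -
    show "0 < e" "e < 1" using p by (simp_all add: e_def)
    have "p = 1 - 2 * e" by (simp add: e_def field_simps)
    also have "\<dots> \<le> (1 - e)\<^sup>2" by (simp add: power2_eq_square algebra_simps)
    finally show "p \<le> (1 - e)\<^sup>2" .
  qed
  define \<eta> where "\<eta> = e * d"
  have \<eta>: "0 < \<eta>" "\<eta> < d" using e d by (simp_all add: \<eta>_def)
  \<comment> \<open>Half of the tolerance (1 - q) \<eta> is for the distance of x from the limit of
    H(u), the other half for the convergence of H(u).\<close>
  define r where "r = (1 - q) * \<eta> / 2"
  have r: "0 < r" using q \<eta> by (simp add: r_def)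
  have "(\<lambda>n. \<sigma>\<^sup>2 * inv_square (\<tau> n) (of_real u)) \<longlonglongrightarrow> S0"
    unfolding S0_def by (intro tendsto_intros weak_conv_gap(1)[OF \<tau> ev gap])
  then have e1: "eventually (\<lambda>n. \<sigma>\<^sup>2 * inv_square (\<tau> n) (of_real u) < q1) sequentially"
    using q(1) by (rule order_tendstoD(2))
  have "(\<lambda>n. H_map \<sigma> (\<tau> n) u) \<longlonglongrightarrow> H_map \<sigma> \<nu> u"
    unfolding H_map_def by (intro tendsto_intros weak_conv_gap(2)[OF \<tau> ev gap])
  then have e2: "eventually (\<lambda>n. dist (H_map \<sigma> (\<tau> n) u) (H_map \<sigma> \<nu> u) < r) sequentially"
    using r by (rule tendstoD)
  have "eventually (\<lambda>n. \<forall>x. \<bar>x - H_map \<sigma> \<nu> u\<bar> < r \<longrightarrow> x \<notin> measure_support (\<kappa> n)) sequentially"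
    using e1 e2 \<kappa> ev
  proof eventually_elim
    case (elim n)
    show ?case
    proof (intro allI impI)
      fix x assume x: "\<bar>x - H_map \<sigma> \<nu> u\<bar> < r"
      show "x \<notin> measure_support (\<kappa> n)"
      proof (rule not_in_support_near_H_map[OF s \<tau>(1) _ _ elim(4) \<eta> q(4)])
        show "real_distribution (\<kappa> n)" "subordinate \<sigma> (\<tau> n) (\<kappa> n)" using elim(3) by auto
        show "\<bar>x - H_map \<sigma> (\<tau> n) u\<bar> < (1 - q) * \<eta>"
          using x elim(2) unfolding r_def dist_real_def by linarith
        fix w assume w: "cmod (w - of_real u) \<le> \<eta>"
        have "(1 - e)\<^sup>2 * inv_square (\<tau> n) w \<le> inv_square (\<tau> n) (of_real u)"
          by (rule real_distribution.inv_square_near(1)[OF \<tau>(1) elim(4)]) (use w e in \<open>auto simp: \<eta>_def\<close>)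
        then have "\<sigma>\<^sup>2 * ((1 - e)\<^sup>2 * inv_square (\<tau> n) w) \<le> \<sigma>\<^sup>2 * inv_square (\<tau> n) (of_real u)"
          by (rule mult_left_mono) simp
        then have a: "(1 - e)\<^sup>2 * (\<sigma>\<^sup>2 * inv_square (\<tau> n) w) < q1"
          using elim(1) by (simp only: mult.left_commute)
        have "p * (\<sigma>\<^sup>2 * inv_square (\<tau> n) w) \<le> (1 - e)\<^sup>2 * (\<sigma>\<^sup>2 * inv_square (\<tau> n) w)"
          using e(3) real_distribution.inv_square_nonneg[OF \<tau>(1)]
          by (intro mult_right_mono mult_nonneg_nonneg) auto
        then have "p * (\<sigma>\<^sup>2 * inv_square (\<tau> n) w) \<le> p * q"
          using a p(3) by linarith
        then show "\<sigma>\<^sup>2 * inv_square (\<tau> n) w \<le> q"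
          by (rule mult_left_le_imp_le) (rule p(1))
      qed
    qed
  qed
  then show ?thesis using r by blast
qed

section \<open>Spectral measures and the main theorem\<close>

lemma weak_conv_m_shift: "weak_conv_m \<mu> \<nu> \<Longrightarrow> weak_conv_m (\<lambda>n. \<mu> (n + k)) \<nu>"
  unfolding weak_conv_m_def weak_conv_def
  using LIMSEQ_ignore_initial_segment by blast

lemma spectral_measure_eq_law:
  "spectral_measure A = law (map_pmf Re (pmf_of_multiset (eigenvalue_mset A)))"
  unfolding spectral_measure_def law_def
  by (simp add: map_pmf_rep_eq distr_distr comp_def)

lemma semicircle_free_convolution_pmf:
  assumes "0 < \<sigma>" "finite (set_pmf p)" "\<forall>t\<in>set_pmf p. \<bar>t\<bar> \<le> B"
  shows "real_distribution (semicircle \<sigma> \<boxplus> law p)"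
    and "AE t in semicircle \<sigma> \<boxplus> law p. \<bar>t\<bar> \<le> B + 2 * \<sigma>"
    and "subordinate \<sigma> (law p) (semicircle \<sigma> \<boxplus> law p)"
proof -
  have "\<exists>\<kappa>. real_distribution \<kappa> \<and> (AE t in \<kappa>. \<bar>t\<bar> \<le> B + 2 * \<sigma>) \<and> subordinate \<sigma> (law p) \<kappa>"
    by (rule subordinate_exists_pmf[OF assms(1,2)]) (use assms(3) in blast)
  then obtain \<kappa> where \<kappa>: "real_distribution \<kappa>" "AE t in \<kappa>. \<bar>t\<bar> \<le> B + 2 * \<sigma>" "subordinate \<sigma> (law p) \<kappa>"
    by blast
  have "AE t in law p. \<bar>t\<bar> \<le> B + 2 * \<sigma>"
    using assms(1) assms(3) by (subst AE_law) (auto intro: add_increasing2)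
  note eq = free_convolution_semicircle_eq[OF assms(1) real_distribution_law this \<kappa>]
  show "real_distribution (semicircle \<sigma> \<boxplus> law p)" "AE t in semicircle \<sigma> \<boxplus> law p. \<bar>t\<bar> \<le> B + 2 * \<sigma>"
    "subordinate \<sigma> (law p) (semicircle \<sigma> \<boxplus> law p)"
    unfolding eq by (rule \<kappa>)+
qed

text \<open>\<nu> is not discretised separately: in the application the spectral measures themselves
  are the finitely supported approximations.\<close>

lemma semicircle_free_convolution_limit:
  fixes p :: "nat \<Rightarrow> real pmf"
  assumes s: "0 < \<sigma>" and p: "\<And>n. finite (set_pmf (p n))" "\<And>n. \<forall>t\<in>set_pmf (p n). \<bar>t\<bar> \<le> B"
    and \<nu>: "real_distribution \<nu>" "weak_conv_m (\<lambda>n. law (p n)) \<nu>"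
  shows "real_distribution (semicircle \<sigma> \<boxplus> \<nu>) \<and> subordinate \<sigma> \<nu> (semicircle \<sigma> \<boxplus> \<nu>)"
proof -
  define \<kappa> where "\<kappa> n = semicircle \<sigma> \<boxplus> law (p n)" for n
  have \<kappa>: "real_distribution (\<kappa> n)" "AE t in \<kappa> n. \<bar>t\<bar> \<le> B + 2 * \<sigma>" "subordinate \<sigma> (law (p n)) (\<kappa> n)" for n
    unfolding \<kappa>_def by (rule semicircle_free_convolution_pmf[OF s p(1) p(2)])+
  have "\<exists>\<mu>. real_distribution \<mu> \<and> (AE t in \<mu>. \<bar>t\<bar> \<le> B + 2 * \<sigma>) \<and> subordinate \<sigma> \<nu> \<mu>"
    by (rule subordinate_weak_limit[where \<tau> = "\<lambda>n. law (p n)" and \<kappa> = \<kappa>])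
      (rule real_distribution_law \<nu> \<kappa>)+
  then obtain \<mu> where \<mu>: "real_distribution \<mu>" "AE t in \<mu>. \<bar>t\<bar> \<le> B + 2 * \<sigma>" "subordinate \<sigma> \<nu> \<mu>"
    by blast
  have "AE t in law (p n). \<bar>t\<bar> \<le> B + 2 * \<sigma>" for n
    using s p(2)[of n] by (subst AE_law) (auto intro: add_increasing2)
  then have "AE t in \<nu>. \<bar>t\<bar> \<le> B + 2 * \<sigma>"
    by (intro weak_conv_bounded[where \<mu> = "\<lambda>n. law (p n)", OF real_distribution_law \<nu>])
  from free_convolution_semicircle_eq[OF s \<nu>(1) this \<mu>] show ?thesis using \<mu> by simp
qed

lemma measure_support_pos_infdist:
  assumes "real_distribution \<nu>" "compact (measure_support \<nu>)" "u \<notin> measure_support \<nu>"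
  shows "0 < infdist u (measure_support \<nu>)"
  using assms real_distribution.measure_support_nonempty compact_imp_closed infdist_pos_not_in_closed by blast

theorem theorem6p1:
  fixes \<sigma> :: real
    and A :: "nat \<Rightarrow> complex mat"
    and \<nu> :: "real measure"
    and r J :: nat
    and \<theta> :: "nat \<Rightarrow> real"
    and k :: "nat \<Rightarrow> nat"
    and \<beta> :: "nat \<Rightarrow> nat \<Rightarrow> real"
    and \<epsilon> :: real
  assumes "\<sigma> > 0"
    and "\<And>N. A N \<in> carrier_mat N N"
    and "\<And>N. hermitian_mat (A N)"
    and "real_distribution \<nu>"
    and "compact (measure_support \<nu>)"
    and "weak_conv_m (\<lambda>N. spectral_measure (A N)) \<nu>"
    and "\<And>i j. 1 \<le> i \<Longrightarrow> i < j \<Longrightarrow> j \<le> J \<Longrightarrow> \<theta> i > \<theta> j"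
    and "\<And>j. j \<in> {1..J} \<Longrightarrow> \<theta> j \<notin> measure_support \<nu>"
    and "\<And>j. j \<in> {1..J} \<Longrightarrow> k j \<ge> 1"
    and "(\<Sum>j=1..J. k j) = r"
    and "\<And>N. N \<ge> r \<Longrightarrow> eigenvalue_mset (A N) =
           image_mset (\<lambda>j. complex_of_real (\<beta> N j)) (mset_set {1..N - r}) +
           (\<Sum>j=1..J. replicate_mset (k j) (complex_of_real (\<theta> j)))"
    and "\<And>N j. N \<ge> r \<Longrightarrow> j \<in> {1..J} \<Longrightarrow>
           count (eigenvalue_mset (A N)) (complex_of_real (\<theta> j)) = k j"
    and "(\<lambda>N. MAX j\<in>{1..N - r}. infdist (\<beta> N j) (measure_support \<nu>)) \<longlonglongrightarrow> 0"
    and "\<epsilon> > 0"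
  shows "\<forall>\<^sub>F N in sequentially.
           measure_support (semicircle \<sigma> \<boxplus> spectral_measure (A N))
             \<subseteq> neighbourhood (K_set \<sigma> \<nu> (\<theta> ` {1..J})) \<epsilon>"
proof -
  note s = assms(1) and \<nu> = assms(4)
  interpret N: real_distribution \<nu> by (rule \<nu>)
  define S where "S = measure_support \<nu>"
  have S: "S \<noteq> {}" "compact S" using N.measure_support_nonempty assms(5) by (simp_all add: S_def)
  define P where "P N = map_pmf Re (pmf_of_multiset (eigenvalue_mset (A N)))" for N
  have law: "spectral_measure (A N) = law (P N)" for N
    by (simp add: P_def spectral_measure_eq_law)
  \<comment> \<open>r < N rather than r \<le> N: a nonempty block of \<beta> makes the eigenvalue
    multiset nonempty, and \<open>pmf_of_multiset\<close> is only specified there.\<close>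
  have setP: "set_pmf (P N) \<subseteq> \<beta> N ` {1..N - r} \<union> \<theta> ` {1..J}" if N: "r < N" for N
  proof -
    have E: "eigenvalue_mset (A N) = image_mset (\<lambda>j. complex_of_real (\<beta> N j)) (mset_set {1..N - r}) +
           (\<Sum>j=1..J. replicate_mset (k j) (complex_of_real (\<theta> j)))"
      by (rule assms(11)) (use N in simp)
    have "set_mset (\<Sum>j=1..J. replicate_mset (k j) (complex_of_real (\<theta> j))) \<subseteq> (\<lambda>j. complex_of_real (\<theta> j)) ` {1..J}"
      by (auto simp: set_mset_sum split: if_splits)
    then have sub: "set_mset (eigenvalue_mset (A N)) \<subseteq> (\<lambda>j. complex_of_real (\<beta> N j)) ` {1..N - r} \<union> (\<lambda>j. complex_of_real (\<theta> j)) ` {1..J}"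
      unfolding E by auto
    have "1 \<in> {1..N - r}" using N by simp
    then have "mset_set {1..N - r} \<noteq> {#}" by (metis empty_not_insert finite_atLeastAtMost mset_set_empty_iff empty_iff)
    then have "eigenvalue_mset (A N) \<noteq> {#}" unfolding E by simp
    then have "set_pmf (P N) = Re ` set_mset (eigenvalue_mset (A N))"
      by (simp add: P_def)
    also have "\<dots> \<subseteq> Re ` ((\<lambda>j. complex_of_real (\<beta> N j)) ` {1..N - r} \<union> (\<lambda>j. complex_of_real (\<theta> j)) ` {1..J})"
      by (rule image_mono[OF sub])
    also have "\<dots> = \<beta> N ` {1..N - r} \<union> \<theta> ` {1..J}" by (simp add: image_Un image_image)
    finally show ?thesis .
  qed
  have near: "\<forall>\<^sub>F N in sequentially. r < N \<and> (\<forall>j\<in>{1..N - r}. infdist (\<beta> N j) S < d)" if "0 < d" for d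
  proof -
    have "\<forall>\<^sub>F N in sequentially. (MAX j\<in>{1..N - r}. infdist (\<beta> N j) S) < d"
      using assms(13) that unfolding S_def by (rule order_tendstoD(2))
    then show ?thesis using eventually_gt_at_top[of r]
    proof eventually_elim
      case (elim N)
      have "infdist (\<beta> N j) S \<le> (MAX j\<in>{1..N - r}. infdist (\<beta> N j) S)" if "j \<in> {1..N - r}" for j
        using that by (intro Max_ge) auto
      then show ?case using elim by (meson le_less_trans)
    qed
  qed
  obtain B0 where B0: "\<And>x. x \<in> S \<Longrightarrow> \<bar>x\<bar> \<le> B0"
    using compact_imp_bounded[OF S(2)] unfolding bounded_iff by auto
  obtain B1 where B1: "\<And>x. x \<in> \<theta> ` {1..J} \<Longrightarrow> \<bar>x\<bar> \<le> B1"
    using finite_imp_bounded[of "\<theta> ` {1..J}"] unfolding bounded_iff by auto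
  \<comment> \<open>The \<beta> are eventually within 1 of the support of \<nu>, which
    \<open>B0\<close> bounds; \<open>B1\<close> bounds the spikes.\<close>
  define B where "B = max (B0 + 1) B1"
  obtain N0 where N0: "\<And>N. N0 \<le> N \<Longrightarrow> r < N \<and> (\<forall>j\<in>{1..N - r}. infdist (\<beta> N j) S < 1)"
    using near[of 1] unfolding eventually_sequentially by auto
  have PB: "\<bar>t\<bar> \<le> B" if N: "N0 \<le> N" and t: "t \<in> set_pmf (P N)" for N t
  proof -
    have "t \<in> \<beta> N ` {1..N - r} \<union> \<theta> ` {1..J}" using setP N0[OF N] t by blast
    then show ?thesis
    proof
      assume "t \<in> \<theta> ` {1..J}"
      then show ?thesis using B1 by (auto simp: B_def intro: max.coboundedI2)
    next
      assume "t \<in> \<beta> N ` {1..N - r}"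
      then have "infdist t S < 1" using N0[OF N] by blast
      then obtain y where "y \<in> S" "dist t y < 1"
        using infdist_attains_inf[OF compact_imp_closed[OF S(2)] S(1), of t] by metis
      then show ?thesis using B0[of y] by (auto simp: B_def dist_real_def)
    qed
  qed
  have Pfin: "finite (set_pmf (P N))" if "N0 \<le> N" for N
    using finite_subset[OF setP] N0[OF that] by simp
  \<comment> \<open>Dropping the first N0 matrices makes finiteness and the common bound hold for
    every index, as the weak limit lemmas demand.\<close>
  define \<tau> where "\<tau> n = law (P (n + N0))" for n
  have \<tau>: "real_distribution (\<tau> n)" "weak_conv_m \<tau> \<nu>" for n
    using weak_conv_m_shift[OF assms(6), of N0] real_distribution_law by (simp_all add: \<tau>_def[abs_def] law)
  define \<kappa> where "\<kappa> n = semicircle \<sigma> \<boxplus> \<tau> n" for n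
  have \<kappa>: "real_distribution (\<kappa> n)" "AE t in \<kappa> n. \<bar>t\<bar> \<le> B + 2 * \<sigma>" "subordinate \<sigma> (\<tau> n) (\<kappa> n)" for n
  proof -
    have "finite (set_pmf (P (n + N0)))" "\<forall>t\<in>set_pmf (P (n + N0)). \<bar>t\<bar> \<le> B"
      using Pfin[of "n + N0"] PB[of "n + N0"] by simp_all
    note semicircle_free_convolution_pmf[OF s this]
    then show "real_distribution (\<kappa> n)" "AE t in \<kappa> n. \<bar>t\<bar> \<le> B + 2 * \<sigma>" "subordinate \<sigma> (\<tau> n) (\<kappa> n)"
      by (simp_all only: \<kappa>_def \<tau>_def)
  qed
  define \<mu> where "\<mu> = semicircle \<sigma> \<boxplus> \<nu>"
  have "real_distribution \<mu> \<and> subordinate \<sigma> \<nu> \<mu>"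
    unfolding \<mu>_def
  proof (rule semicircle_free_convolution_limit[where p = "\<lambda>n. P (n + N0)" and B = B])
    show "weak_conv_m (\<lambda>n. law (P (n + N0))) \<nu>" using \<tau>(2) by (simp only: \<tau>_def[abs_def])
    show "finite (set_pmf (P (n + N0)))" for n by (rule Pfin) simp
    show "\<forall>t\<in>set_pmf (P (n + N0)). \<bar>t\<bar> \<le> B" for n by (intro ballI PB[of "n + N0"]) simp
  qed (rule s \<nu>)+
  then have \<mu>: "real_distribution \<mu>" "subordinate \<sigma> \<nu> \<mu>" by simp_all
  define K where "K = K_set \<sigma> \<nu> (\<theta> ` {1..J})"
  have local: "\<exists>\<rho>>0. \<forall>\<^sub>F n in sequentially. \<forall>y. \<bar>y - x\<bar> < \<rho> \<longrightarrow> y \<notin> measure_support (\<kappa> n)"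
    if x: "x \<notin> K" for x
  proof -
    have x\<mu>: "x \<notin> measure_support \<mu>" using x by (auto simp: K_def K_set_def \<mu>_def)
    obtain u q where u: "u \<notin> measure_support \<nu>" "u \<notin> closure (U_set \<sigma> \<nu>)" "H_map \<sigma> \<nu> u = x"
      and q: "q < 1" "\<sigma>\<^sup>2 * inv_square \<nu> (of_real u) \<le> q"
      by (rule outside_support_preimage[OF s \<nu> \<mu> x\<mu>])
    have u\<theta>: "u \<notin> \<theta> ` {1..J}"
    proof
      assume "u \<in> \<theta> ` {1..J}"
      then have "u \<in> Theta_set \<sigma> \<nu> (\<theta> ` {1..J})" using u(2) by (simp add: Theta_set_def)
      then show False using x u(3) by (auto simp: K_def K_set_def)
    qed
    obtain d1 where d1_pos: "0 < d1" and d1_le: "\<forall>t\<in>\<theta> ` {1..J}. t \<noteq> u \<longrightarrow> d1 \<le> dist u t"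
      using finite_set_avoid[of "\<theta> ` {1..J}" u] by blast
    have d1: "d1 \<le> \<bar>u - t\<bar>" if "t \<in> \<theta> ` {1..J}" for t
    proof -
      have "t \<noteq> u" using that u\<theta> by blast
      then show ?thesis using d1_le that by (simp only: dist_real_def) blast
    qed
    obtain d2 where d2: "gap \<nu> (of_real u) d2" using N.not_in_support_gap[OF u(1)] by blast
    \<comment> \<open>Half the distance: a \<beta> within \<open>d3\<close> of the support of \<nu>
      is still at least \<open>d3\<close> away from u.\<close>
    define d3 where "d3 = infdist u S / 2"
    have d3: "0 < d3"
      using measure_support_pos_infdist[OF \<nu> assms(5) u(1)] by (simp add: d3_def S_def)
    define d where "d = min d1 (min d2 d3)"
    have d: "0 < d" "d \<le> d1" "d \<le> d2" "d \<le> d3" using d1_pos d3 gap_pos[OF d2] by (auto simp: d_def)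
    have "\<forall>\<^sub>F n in sequentially. gap (law (P n)) (of_real u) d"
      using near[OF d3]
    proof eventually_elim
      case (elim n)
      have "d \<le> \<bar>u - t\<bar>" if t: "t \<in> set_pmf (P n)" for t
      proof -
        have "t \<in> \<beta> n ` {1..n - r} \<union> \<theta> ` {1..J}" using setP elim t by blast
        then show ?thesis
        proof
          assume "t \<in> \<theta> ` {1..J}"
          then show ?thesis using d1[of t] d(2) by linarith
        next
          assume "t \<in> \<beta> n ` {1..n - r}"
          then have "infdist t S < d3" using elim by blast
          moreover have "infdist u S \<le> infdist t S + dist u t" by (rule infdist_triangle)
          ultimately show ?thesis using d(4) by (simp add: d3_def dist_real_def)
        qed
      qed
      then show ?case unfolding gap_def using d(1)
        by (subst AE_law) (auto simp: cmod_of_real_minus_of_real)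
    qed
    then have ev: "\<forall>\<^sub>F n in sequentially. gap (\<tau> n) (of_real u) d"
      unfolding \<tau>_def using eventually_sequentially_seg[of "\<lambda>n. gap (law (P n)) (of_real u) d" N0] by simp
    show ?thesis
      using eventually_not_in_support_near[OF s \<tau>(1) \<nu> \<tau>(2) _ ev gap_mono[OF d2 d(1,3)]] \<kappa> q u(3)
      by auto
  qed
  define L where "L = B + 2 * \<sigma>"
  \<comment> \<open>\<open>L\<close> bounds the supports of all \<open>\<kappa> n\<close>, so the
    points still to be excluded form a compact set and finitely many of the local statements
    suffice.\<close>
  define C where "C = {-L..L} \<inter> {x. \<epsilon> \<le> infdist x K}"
  have "closed {x. \<epsilon> \<le> infdist x K}" by (intro closed_Collect_le continuous_intros)
  then have C: "compact C" unfolding C_def by (intro compact_Int_closed) auto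
  have "x \<notin> K" if "x \<in> C" for x using that assms(14) by (auto simp: C_def)
  then have "\<forall>x\<in>C. \<exists>\<rho>>0. \<forall>\<^sub>F n in sequentially. \<forall>y. \<bar>y - x\<bar> < \<rho> \<longrightarrow> y \<notin> measure_support (\<kappa> n)"
    using local by blast
  from bchoice[OF this] obtain \<rho> where
    \<rho>': "\<forall>x\<in>C. 0 < \<rho> x \<and> (\<forall>\<^sub>F n in sequentially. \<forall>y. \<bar>y - x\<bar> < \<rho> x \<longrightarrow> y \<notin> measure_support (\<kappa> n))"
    by (elim exE) (rule that)
  have \<rho>: "0 < \<rho> x" "\<forall>\<^sub>F n in sequentially. \<forall>y. \<bar>y - x\<bar> < \<rho> x \<longrightarrow> y \<notin> measure_support (\<kappa> n)"
    if "x \<in> C" for x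
    using bspec[OF \<rho>' that] by (rule conjunct1, rule conjunct2)
  obtain D where D: "D \<subseteq> C" "finite D" "C \<subseteq> (\<Union>x\<in>D. ball x (\<rho> x))"
    by (rule compactE_image[OF C, of C "\<lambda>x. ball x (\<rho> x)"]) (use \<rho>(1) in auto)
  have "\<forall>\<^sub>F n in sequentially. \<forall>x\<in>D. \<forall>y. \<bar>y - x\<bar> < \<rho> x \<longrightarrow> y \<notin> measure_support (\<kappa> n)"
    using D(1) \<rho>(2) by (intro eventually_ball_finite[OF D(2)]) auto
  then have "\<forall>\<^sub>F n in sequentially. measure_support (\<kappa> n) \<subseteq> neighbourhood K \<epsilon>"
  proof eventually_elim
    case (elim n)
    show ?case
    proof
      fix y assume y: "y \<in> measure_support (\<kappa> n)"
      have "\<bar>y\<bar> \<le> L" using real_distribution.bounded_support[OF \<kappa>(1,2) y] by (simp add: L_def)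
      moreover have "y \<notin> C"
      proof
        assume "y \<in> C"
        then obtain x where "x \<in> D" "y \<in> ball x (\<rho> x)" using D(3) by blast
        then show False using elim y by (auto simp: dist_real_def abs_minus_commute)
      qed
      ultimately show "y \<in> neighbourhood K \<epsilon>" by (auto simp: C_def neighbourhood_def)
    qed
  qed
  then have "\<forall>\<^sub>F n in sequentially. measure_support (semicircle \<sigma> \<boxplus> spectral_measure (A (n + N0))) \<subseteq> neighbourhood K \<epsilon>"
    by (simp add: \<kappa>_def \<tau>_def law)
  then show ?thesis
    unfolding K_def
    by (subst (asm) eventually_sequentially_seg[of "\<lambda>n. measure_support (semicircle \<sigma> \<boxplus> spectral_measure (A n)) \<subseteq> neighbourhood (K_set \<sigma> \<nu> (\<theta> ` {1..J})) \<epsilon>"])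
qed

end
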